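(* Let $W_n$, $n\in\mathbb N$, be a sequence of stochastic processes with paths in $C[0,1]$, and let $\rho_0:[0,1]\to[0,\infty)$ be an increasing function with $\rho_0(0)=0$. Suppose there exist $C>0$ and, for any $t>C$, some $\kappa(t)>1$ and $K(t)>0$ such that for all $n$ $$P\left(\frac{|W_n(u)-W_n(v)|}{\rho_0(|u-v|)}>t\right)\le K(t)\,|u-v|^{\kappa(t)},\qquad u,v\in[0,1],\ u\ne v.$$ Assume further that there exist $p>0$ and $\widetilde K>0$ such that $$\rho_0(zh)\le\widetilde K z^p\rho_0(h),\qquad h,z\in[0,1].$$ Then: (a) For any $t>C$, $$\sup_n P\left(\sup_{u,v\in[0,1],\,0<|u-v|\le h}\frac{|W_n(u)-W_n(v)|}{\rho_0(|u-v|)}>t\right)\longrightarrow0\quad\text{as }h\to0.$$ (b) For any modulus of continuity $\rho$ such that $\rho(h)/\rho_0(h)\to\infty$ as $h\to0$, the sequence $|W_n|_\rho$ is stochastically bounded. (c) If furthermore there exists a limiting process $W$ with paths in $C[0,1]$ such that the finite-dimensional marginals of $W_n$ converge weakly to those of $W$, then for any modulus of continuity $\rho$: if $\rho(h)/\rho_0(h)\to\infty$ as $h\to0$, then $W_n\Rightarrow W$ weakly in $C_0^\rho$; if $\rho(h)/\rho_0(h)\to1$ as $h\to0$, then $|W_n|_\rho\Rightarrow_C|W|_\rho$ (thresholded weak convergence with threshold $C$).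
   Context: A modulus of continuity is a continuous increasing function $\rho:[0,1]\to[0,\infty)$ with $\rho(0)=0$ and $\rho(h)>0$ for $h>0$. For $f\in C[0,1]$, $|f|_\rho=\sup_{u\neq v\in[0,1]}|f(u)-f(v)|/\rho(|u-v|)$, $\|f\|_\rho=\|f\|_\infty+|f|_\rho$, $C^\rho=\{f\in C[0,1]:\|f\|_\rho<\infty\}$, and $C_0^\rho$ is the subspace of $f\in C^\rho$ with $\lim_{\delta\to0}\sup_{0<|u-v|<\delta}|f(u)-f(v)|/\rho(|u-v|)=0$, equipped with $\|\cdot\|_\rho$. Thresholded weak convergence: for random variables, $X_n\Rightarrow_\tau X$ ($\tau\in\mathbb R$) means $P(X_n>t)\to P(X>t)$ for every $t>\tau$ that is a continuity point of the distribution function of $X$. *)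

theory Defs
  imports "HOL-Probability.Probability"
begin

section \<open>Moduli of continuity and Hoelder-type spaces on the unit interval\<close>

text \<open>
  Functions on \<open>[0,1]\<close> are represented by functions \<open>real \<Rightarrow> real\<close> of which only the
  values on \<open>{0..1}\<close> are used. ``Increasing'' is read in the wide sense (non-decreasing).
\<close>

definition modulus_of_continuity :: "(real \<Rightarrow> real) \<Rightarrow> bool" where
  "modulus_of_continuity \<rho> \<longleftrightarrow>
     continuous_on {0..1} \<rho> \<and> mono_on {0..1} \<rho> \<and> \<rho> 0 = 0 \<and> (\<forall>h\<in>{0<..1}. \<rho> h > 0)"

text \<open>
  Quotients and suprema are formed in the extended reals: suprema may be infinite, and
  \<open>x / 0 = \<infinity>\<close> for \<open>x > 0\<close> (while \<open>0 / 0 = 0\<close>), which matters only if the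
  denominator is a function that vanishes at some positive argument.
\<close>

definition incr_ratio :: "(real \<Rightarrow> real) \<Rightarrow> (real \<Rightarrow> real) \<Rightarrow> real \<Rightarrow> real \<Rightarrow> ereal" where
  "incr_ratio \<rho> f u v = ereal \<bar>f u - f v\<bar> / ereal (\<rho> \<bar>u - v\<bar>)"

definition holder_seminorm :: "(real \<Rightarrow> real) \<Rightarrow> (real \<Rightarrow> real) \<Rightarrow> ereal" where
  "holder_seminorm \<rho> f =
     (SUP (u, v)\<in>{(u, v). u \<in> {0..1} \<and> v \<in> {0..1} \<and> u \<noteq> v}. incr_ratio \<rho> f u v)"

definition holder_norm :: "(real \<Rightarrow> real) \<Rightarrow> (real \<Rightarrow> real) \<Rightarrow> ereal" where
  "holder_norm \<rho> f = (SUP u\<in>{0..1}. ereal \<bar>f u\<bar>) + holder_seminorm \<rho> f"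

text \<open>
  Elements are extensional (fixed to \<open>undefined\<close> off \<open>{0..1}\<close>), so that equality of
  elements is equality as functions on \<open>[0,1]\<close>.
\<close>

definition C_rho :: "(real \<Rightarrow> real) \<Rightarrow> (real \<Rightarrow> real) set" where
  "C_rho \<rho> = {f. f \<in> extensional {0..1} \<and> continuous_on {0..1} f \<and> holder_norm \<rho> f < \<infinity>}"

definition C0_rho :: "(real \<Rightarrow> real) \<Rightarrow> (real \<Rightarrow> real) set" where
  "C0_rho \<rho> = {f \<in> C_rho \<rho>.
     ((\<lambda>\<delta>. SUP (u, v)\<in>{(u, v). u \<in> {0..1} \<and> v \<in> {0..1} \<and> 0 < \<bar>u - v\<bar> \<and> \<bar>u - v\<bar> < \<delta>}.
              incr_ratio \<rho> f u v) \<longlongrightarrow> 0) (at_right 0)}"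

definition holder_dist :: "(real \<Rightarrow> real) \<Rightarrow> (real \<Rightarrow> real) \<Rightarrow> (real \<Rightarrow> real) \<Rightarrow> real" where
  "holder_dist \<rho> f g = real_of_ereal (holder_norm \<rho> (\<lambda>u. f u - g u))"

definition C0_rho_topology :: "(real \<Rightarrow> real) \<Rightarrow> (real \<Rightarrow> real) topology" where
  "C0_rho_topology \<rho> = Metric_space.mtopology (C0_rho \<rho>) (holder_dist \<rho>)"

lemma incr_ratio_modulus:
  assumes "modulus_of_continuity \<rho>" "u \<in> {0..1}" "v \<in> {0..1}" "u \<noteq> v"
  shows "\<rho> \<bar>u - v\<bar> > 0" "incr_ratio \<rho> f u v = ereal (\<bar>f u - f v\<bar> / \<rho> \<bar>u - v\<bar>)"
proof -
  have "\<bar>u - v\<bar> \<in> {0<..1}" using assms by auto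
  then show pos: "\<rho> \<bar>u - v\<bar> > 0" using assms(1) by (simp add: modulus_of_continuity_def)
  show "incr_ratio \<rho> f u v = ereal (\<bar>f u - f v\<bar> / \<rho> \<bar>u - v\<bar>)"
    using pos by (simp add: incr_ratio_def)
qed

lemma sup_norm_le_holder_norm:
  assumes "modulus_of_continuity \<rho>"
  shows "0 \<le> holder_seminorm \<rho> f" "(SUP u\<in>{0..1::real}. ereal \<bar>f u\<bar>) \<ge> 0"
    "u \<in> {0..1} \<Longrightarrow> ereal \<bar>f u\<bar> \<le> holder_norm \<rho> f"
proof -
  have "incr_ratio \<rho> f 0 1 \<le> holder_seminorm \<rho> f"
    unfolding holder_seminorm_def by (rule SUP_upper2[of "(0, 1)"]) auto
  moreover have "0 \<le> incr_ratio \<rho> f 0 1"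
    using incr_ratio_modulus[OF assms, of 0 1] by simp
  ultimately show s: "0 \<le> holder_seminorm \<rho> f" by simp
  show "(SUP u\<in>{0..1::real}. ereal \<bar>f u\<bar>) \<ge> 0"
    by (rule SUP_upper2[of 0]) auto
  assume "u \<in> {0..1}"
  then have "ereal \<bar>f u\<bar> \<le> (SUP u\<in>{0..1}. ereal \<bar>f u\<bar>)" by (rule SUP_upper)
  then show "ereal \<bar>f u\<bar> \<le> holder_norm \<rho> f"
    unfolding holder_norm_def using s by (metis add.right_neutral add_mono)
qed

lemma holder_norm_nonneg:
  assumes "modulus_of_continuity \<rho>"
  shows "0 \<le> holder_norm \<rho> f"
  unfolding holder_norm_def using sup_norm_le_holder_norm[OF assms] by (intro add_nonneg_nonneg)

lemma holder_norm_minus: "holder_norm \<rho> (\<lambda>u. f u - g u) = holder_norm \<rho> (\<lambda>u. g u - f u)"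
proof -
  have "incr_ratio \<rho> (\<lambda>u. f u - g u) = incr_ratio \<rho> (\<lambda>u. g u - f u)"
    by (intro ext) (simp add: incr_ratio_def abs_if)
  then show ?thesis
    by (simp add: holder_norm_def holder_seminorm_def abs_minus_commute)
qed

lemma holder_norm_triangle:
  assumes "modulus_of_continuity \<rho>"
  shows "holder_norm \<rho> (\<lambda>u. f u + g u) \<le> holder_norm \<rho> f + holder_norm \<rho> g"
proof -
  have "(SUP u\<in>{0..1::real}. ereal \<bar>f u + g u\<bar>)
      \<le> (SUP u\<in>{0..1}. ereal \<bar>f u\<bar>) + (SUP u\<in>{0..1}. ereal \<bar>g u\<bar>)"
  proof (rule SUP_least)
    fix u :: real assume "u \<in> {0..1}"
    then have "ereal \<bar>f u\<bar> + ereal \<bar>g u\<bar> \<le> (SUP u\<in>{0..1}. ereal \<bar>f u\<bar>) + (SUP u\<in>{0..1}. ereal \<bar>g u\<bar>)"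
      by (intro add_mono SUP_upper)
    moreover have "ereal \<bar>f u + g u\<bar> \<le> ereal \<bar>f u\<bar> + ereal \<bar>g u\<bar>" by simp
    ultimately show "ereal \<bar>f u + g u\<bar>
        \<le> (SUP u\<in>{0..1}. ereal \<bar>f u\<bar>) + (SUP u\<in>{0..1}. ereal \<bar>g u\<bar>)"
      by (rule order_trans[rotated])
  qed
  moreover have "holder_seminorm \<rho> (\<lambda>u. f u + g u) \<le> holder_seminorm \<rho> f + holder_seminorm \<rho> g"
    unfolding holder_seminorm_def[of _ "\<lambda>u. f u + g u"]
  proof (rule SUP_least, clarify)
    fix u v :: real assume uv: "u \<in> {0..1}" "v \<in> {0..1}" "u \<noteq> v"
    have "incr_ratio \<rho> k u v \<le> holder_seminorm \<rho> k" for k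
      unfolding holder_seminorm_def using uv by (intro SUP_upper2[of "(u, v)"]) auto
    then have "incr_ratio \<rho> f u v + incr_ratio \<rho> g u v \<le> holder_seminorm \<rho> f + holder_seminorm \<rho> g"
      by (intro add_mono)
    moreover have "\<bar>f u + g u - (f v + g v)\<bar> \<le> \<bar>f u - f v\<bar> + \<bar>g u - g v\<bar>" by simp
    then have "incr_ratio \<rho> (\<lambda>u. f u + g u) u v \<le> incr_ratio \<rho> f u v + incr_ratio \<rho> g u v"
      using incr_ratio_modulus[OF assms uv]
      by (simp add: add_divide_distrib[symmetric] divide_right_mono)
    ultimately show "incr_ratio \<rho> (\<lambda>u. f u + g u) u v \<le> holder_seminorm \<rho> f + holder_seminorm \<rho> g"
      by (rule order_trans[rotated])
  qed
  ultimately have "holder_norm \<rho> (\<lambda>u. f u + g u)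
     \<le> ((SUP u\<in>{0..1}. ereal \<bar>f u\<bar>) + (SUP u\<in>{0..1}. ereal \<bar>g u\<bar>))
       + (holder_seminorm \<rho> f + holder_seminorm \<rho> g)"
    unfolding holder_norm_def by (rule add_mono)
  then show ?thesis
    unfolding holder_norm_def by (simp only: ac_simps)
qed

lemma Metric_space_C0_rho:
  assumes "modulus_of_continuity \<rho>"
  shows "Metric_space (C0_rho \<rho>) (holder_dist \<rho>)"
proof
  fix f g
  show "0 \<le> holder_dist \<rho> f g"
    by (simp add: holder_dist_def real_of_ereal_pos holder_norm_nonneg[OF assms])
  show "holder_dist \<rho> f g = holder_dist \<rho> g f"
    unfolding holder_dist_def by (simp only: holder_norm_minus[of \<rho> f g])
next
  have fin: "\<bar>holder_norm \<rho> (\<lambda>u. f u - g u)\<bar> \<noteq> \<infinity>" if "f \<in> C0_rho \<rho>" "g \<in> C0_rho \<rho>" for f g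
  proof -
    have "holder_norm \<rho> (\<lambda>u. f u - g u) \<le> holder_norm \<rho> f + holder_norm \<rho> (\<lambda>u. 0 - g u)"
      using holder_norm_triangle[OF assms, of f "\<lambda>u. 0 - g u"] by simp
    also have "\<dots> = holder_norm \<rho> f + holder_norm \<rho> g"
      using holder_norm_minus[of \<rho> "\<lambda>_. 0" g] by simp
    also have "\<dots> < \<infinity>" using that by (auto simp: C0_rho_def C_rho_def)
    finally show ?thesis using holder_norm_nonneg[OF assms, of "\<lambda>u. f u - g u"] by auto
  qed
  fix f g h
  assume f: "f \<in> C0_rho \<rho>" and g: "g \<in> C0_rho \<rho>"
  show "holder_dist \<rho> f g = 0 \<longleftrightarrow> f = g"
  proof
    assume "holder_dist \<rho> f g = 0"
    then have z: "holder_norm \<rho> (\<lambda>u. f u - g u) = 0"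
      using fin[OF f g] by (auto simp: holder_dist_def real_of_ereal_eq_0)
    have "f u = g u" if "u \<in> {0..1}" for u
      using sup_norm_le_holder_norm(3)[OF assms that, of "\<lambda>u. f u - g u"] z by simp
    moreover have "f \<in> extensional {0..1}" "g \<in> extensional {0..1}"
      using f g by (auto simp: C0_rho_def C_rho_def)
    ultimately show "f = g" by (intro extensionalityI)
  next
    assume "f = g"
    have "holder_seminorm \<rho> (\<lambda>u. 0) \<le> 0"
      unfolding holder_seminorm_def by (rule SUP_least) (auto simp: incr_ratio_def zero_ereal_def[symmetric])
    then have "holder_seminorm \<rho> (\<lambda>u. 0) = 0"
      using sup_norm_le_holder_norm(1)[OF assms, of "\<lambda>u. 0"] by (rule antisym)
    then have "holder_norm \<rho> (\<lambda>u. 0) = 0"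
      by (simp add: holder_norm_def flip: zero_ereal_def)
    then show "holder_dist \<rho> f g = 0" using \<open>f = g\<close> by (simp add: holder_dist_def)
  qed
  assume h: "h \<in> C0_rho \<rho>"
  have "holder_norm \<rho> (\<lambda>u. f u - h u)
      \<le> holder_norm \<rho> (\<lambda>u. f u - g u) + holder_norm \<rho> (\<lambda>u. g u - h u)"
    using holder_norm_triangle[OF assms, of "\<lambda>u. f u - g u" "\<lambda>u. g u - h u"] by simp
  then show "holder_dist \<rho> f h \<le> holder_dist \<rho> f g + holder_dist \<rho> g h"
    using fin[OF f g] fin[OF g h] fin[OF f h] unfolding holder_dist_def
    by (cases "holder_norm \<rho> (\<lambda>u. f u - g u)"; cases "holder_norm \<rho> (\<lambda>u. g u - h u)";
        cases "holder_norm \<rho> (\<lambda>u. f u - h u)") auto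
qed

section \<open>Stochastic processes and convergence\<close>

text \<open>
  A process is given by its sample paths \<open>X \<omega> :: real \<Rightarrow> real\<close>. The members of a sequence may
  live on different probability spaces \<open>M n\<close>.
\<close>

definition C01_process :: "'a measure \<Rightarrow> ('a \<Rightarrow> real \<Rightarrow> real) \<Rightarrow> bool" where
  "C01_process M X \<longleftrightarrow> prob_space M \<and>
     (\<forall>u\<in>{0..1}. (\<lambda>\<omega>. X \<omega> u) \<in> borel_measurable M) \<and>
     (\<forall>\<omega>\<in>space M. continuous_on {0..1} (X \<omega>))"

definition borel_of_topology :: "'c topology \<Rightarrow> 'c measure" where
  "borel_of_topology T = sigma (topspace T) {U. openin T U}"

text \<open>
  \<open>X\<close> takes values in \<open>T\<close> almost surely and is Borel measurable where it does; this is needed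
  because continuous paths lie in the smaller space \<open>C0_rho \<rho>\<close> only almost surely.
\<close>

definition random_element :: "'a measure \<Rightarrow> 'c topology \<Rightarrow> ('a \<Rightarrow> 'c) \<Rightarrow> bool" where
  "random_element M T X \<longleftrightarrow>
     {\<omega>\<in>space M. X \<omega> \<in> topspace T} \<in> sets M \<and> (AE \<omega> in M. X \<omega> \<in> topspace T) \<and>
     X \<in> measurable (restrict_space M {\<omega>\<in>space M. X \<omega> \<in> topspace T}) (borel_of_topology T)"

definition weakly_converges ::
  "'c topology \<Rightarrow> (nat \<Rightarrow> 'a measure) \<Rightarrow> (nat \<Rightarrow> 'a \<Rightarrow> 'c) \<Rightarrow> 'b measure \<Rightarrow> ('b \<Rightarrow> 'c) \<Rightarrow> bool"
where
  "weakly_converges T M X N Y \<longleftrightarrow>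
     (\<forall>n. random_element (M n) T (X n)) \<and> random_element N T Y \<and>
     (\<forall>\<phi>. continuous_map T euclideanreal \<phi> \<and> bounded (\<phi> ` topspace T) \<longrightarrow>
        (\<lambda>n. LINT \<omega>:{\<omega>\<in>space (M n). X n \<omega> \<in> topspace T}|M n. \<phi> (X n \<omega>))
          \<longlonglongrightarrow> (LINT \<omega>:{\<omega>\<in>space N. Y \<omega> \<in> topspace T}|N. \<phi> (Y \<omega>)))"

definition fidi_converges ::
  "(nat \<Rightarrow> 'a measure) \<Rightarrow> (nat \<Rightarrow> 'a \<Rightarrow> real \<Rightarrow> real) \<Rightarrow> 'b measure \<Rightarrow> ('b \<Rightarrow> real \<Rightarrow> real) \<Rightarrow> bool"
where
  "fidi_converges M X N Y \<longleftrightarrow>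
     (\<forall>J. finite J \<and> J \<subseteq> {0..1} \<longrightarrow>
        weakly_converges (product_topology (\<lambda>_. euclideanreal) J)
          M (\<lambda>n \<omega>. restrict (X n \<omega>) J) N (\<lambda>\<omega>. restrict (Y \<omega>) J))"

definition stochastically_bounded :: "(nat \<Rightarrow> 'a measure) \<Rightarrow> (nat \<Rightarrow> 'a \<Rightarrow> ereal) \<Rightarrow> bool" where
  "stochastically_bounded M X \<longleftrightarrow>
     (\<forall>n. X n \<in> borel_measurable (M n)) \<and>
     (\<forall>\<epsilon>>0. \<exists>t::real. \<forall>n. measure (M n) {\<omega>\<in>space (M n). \<bar>X n \<omega>\<bar> > ereal t} \<le> \<epsilon>)"

definition thresholded_weakly_converges ::
  "real \<Rightarrow> (nat \<Rightarrow> 'a measure) \<Rightarrow> (nat \<Rightarrow> 'a \<Rightarrow> ereal) \<Rightarrow> 'b measure \<Rightarrow> ('b \<Rightarrow> ereal) \<Rightarrow> bool"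
where
  "thresholded_weakly_converges \<tau> M X N Y \<longleftrightarrow>
     (\<forall>n. X n \<in> borel_measurable (M n)) \<and> Y \<in> borel_measurable N \<and>
     (\<forall>t>\<tau>. isCont (\<lambda>s. measure N {\<omega>\<in>space N. Y \<omega> \<le> ereal s}) t \<longrightarrow>
        (\<lambda>n. measure (M n) {\<omega>\<in>space (M n). X n \<omega> > ereal t})
          \<longlonglongrightarrow> measure N {\<omega>\<in>space N. Y \<omega> > ereal t})"

end

theory Submission
  imports Defs
begin

text \<open>
  Chaining along dyadic points shows that a process with the assumed tails satisfies
  \<open>\<bar>f u - f v\<bar> \<le> t * \<rho>\<^sub>0 \<bar>u - v\<bar>\<close> at all distances below some \<open>h\<close>, with probability close to 1 uniformly in
  the sequence. No constant is lost, because a pair of points is compared with a pair lying between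
  them on a much finer grid. The estimate transfers to every larger modulus, and large
  increments are sums of boundedly many small ones.

  The limit process inherits the tail bound. For the thresholded statement, increments at distances
  above \<open>h\<close> are read off a finite dyadic grid. Weak convergence avoids Prokhorov's theorem: on
  functions whose increments at scale \<open>1 / k\<close> are at most \<open>\<epsilon> * \<rho>\<close>, the distance of the little
  Hoelder space is controlled by the values at the points \<open>i / k\<close>, so a bounded Lipschitz functional
  is approximated by a continuous function of these values, and bounded continuous functionals are
  increasing limits of Lipschitz ones.
\<close>

section \<open>Increments bounded by a modulus\<close>

text \<open>The claims concern every level above \<open>C\<close> itself, so a chaining bound with a
  fixed multiplicative loss would be too weak. For \<open>t > C\<close> the tail bound is used at
  some \<open>s\<close> with \<open>C < s < t\<close>. Pairs of level \<open>m + L\<close> at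
  distance up to \<open>1 / 2 ^ m\<close> are bounded with constant \<open>s\<close>; the finer
  links add a relative error of \<open>2 * (K * q ^ L / (1 - q))\<close>,
  \<open>q = (1/2) powr p\<close>, geometric because of the growth condition on
  \<open>\<rho>\<^sub>0\<close>. A large fixed \<open>L\<close> makes it fit between
  \<open>s\<close> and \<open>t\<close>. Scale \<open>m\<close> then involves of the order of
  \<open>2 ^ m\<close> pairs, each failing with probability of the order of
  \<open>2 powr (- \<kappa> * m)\<close>, and \<open>\<kappa> > 1\<close> makes this summable in
  \<open>m\<close>. The processes may live on different spaces, so all bounds are on probabilities
  and uniform in \<open>n\<close>. A second obstacle is that paths lie in
  \<open>C0_rho \<rho>\<close> only almost surely and that the Borel sets there come from the norm,
  not from coordinates; countable descriptions of membership and of open sets by increments and grid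
  values supply measurability.\<close>

text \<open>The product form stays meaningful where \<open>\<rho>\<^sub>0\<close> vanishes at a
  positive argument. With \<open>h = 1\<close> it covers all pairs and bounds the seminorm by
  \<open>c\<close>.\<close>

definition osc_le :: "(real \<Rightarrow> real) \<Rightarrow> (real \<Rightarrow> real) \<Rightarrow> real \<Rightarrow> real \<Rightarrow> bool" where
  "osc_le \<rho> f c h \<longleftrightarrow>
     (\<forall>u\<in>{0..1}. \<forall>v\<in>{0..1}. \<bar>u - v\<bar> \<le> h \<longrightarrow> \<bar>f u - f v\<bar> \<le> c * \<rho> \<bar>u - v\<bar>)"

lemma osc_leI:
  assumes "\<rho> 0 = 0"
    and "\<And>u v. 0 \<le> u \<Longrightarrow> u < v \<Longrightarrow> v \<le> 1 \<Longrightarrow> v - u \<le> h \<Longrightarrow> \<bar>f u - f v\<bar> \<le> c * \<rho> (v - u)"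
  shows "osc_le \<rho> f c h"
  unfolding osc_le_def
proof (intro ballI impI)
  fix u v :: real assume uv: "u \<in> {0..1}" "v \<in> {0..1}" "\<bar>u - v\<bar> \<le> h"
  consider "u = v" | "u < v" | "v < u" by linarith
  then show "\<bar>f u - f v\<bar> \<le> c * \<rho> \<bar>u - v\<bar>"
  proof cases
    case 1 then show ?thesis using assms(1) by simp
  next
    case 2 then show ?thesis using assms(2)[of u v] uv by (simp add: abs_minus_commute)
  next
    case 3 then show ?thesis using assms(2)[of v u] uv by (simp add: abs_minus_commute)
  qed
qed

lemma osc_le_anti: "osc_le \<rho> f c h \<Longrightarrow> h' \<le> h \<Longrightarrow> osc_le \<rho> f c h'"
  by (auto simp: osc_le_def)

text \<open>The conventions for division by zero make the quotient and the product form agree even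
  where \<rho> vanishes. A negative \<open>t\<close> would break this, because
  \<open>0 / 0 = 0\<close> exceeds it.\<close>

lemma incr_ratio_gt_iff:
  assumes "0 \<le> t" "0 \<le> \<rho> \<bar>u - v\<bar>"
  shows "incr_ratio \<rho> f u v > ereal t \<longleftrightarrow> \<bar>f u - f v\<bar> > t * \<rho> \<bar>u - v\<bar>"
proof (cases "\<rho> \<bar>u - v\<bar> = 0")
  case True
  then show ?thesis using assms by (cases "f u = f v") (auto simp: incr_ratio_def zero_ereal_def[symmetric] divide_ereal_def)
next
  case False
  then have "\<rho> \<bar>u - v\<bar> > 0" using assms by simp
  then show ?thesis by (simp add: incr_ratio_def field_simps)
qed

lemma less_SUP_incr_ratio_iff:
  assumes "\<And>h. h \<in> {0..1} \<Longrightarrow> 0 \<le> \<rho> h" "\<rho> 0 = 0" "0 \<le> t"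
  shows "(SUP (u, v)\<in>{(u, v). u \<in> {0..1} \<and> v \<in> {0..1} \<and> 0 < \<bar>u - v\<bar> \<and> \<bar>u - v\<bar> \<le> h}.
               incr_ratio \<rho> f u v) > ereal t \<longleftrightarrow> \<not> osc_le \<rho> f t h"
proof -
  have *: "incr_ratio \<rho> f u v > ereal t \<longleftrightarrow> \<bar>f u - f v\<bar> > t * \<rho> \<bar>u - v\<bar>"
    if "u \<in> {0..1}" "v \<in> {0..1}" for u v
  proof (rule incr_ratio_gt_iff[OF assms(3)])
    have "\<bar>u - v\<bar> \<in> {0..1}" using that by auto
    then show "0 \<le> \<rho> \<bar>u - v\<bar>" by (rule assms(1))
  qed
  show ?thesis
  proof
    assume "(SUP (u, v)\<in>{(u, v). u \<in> {0..1} \<and> v \<in> {0..1} \<and> 0 < \<bar>u - v\<bar> \<and> \<bar>u - v\<bar> \<le> h}.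
               incr_ratio \<rho> f u v) > ereal t"
    then obtain u v where "u \<in> {0..1}" "v \<in> {0..1}" "\<bar>u - v\<bar> \<le> h" "incr_ratio \<rho> f u v > ereal t"
      unfolding less_SUP_iff by auto
    then show "\<not> osc_le \<rho> f t h" using *[of u v] unfolding osc_le_def by force
  next
    assume "\<not> osc_le \<rho> f t h"
    then obtain u v where uv: "u \<in> {0..1}" "v \<in> {0..1}" "\<bar>u - v\<bar> \<le> h"
        "\<bar>f u - f v\<bar> > t * \<rho> \<bar>u - v\<bar>"
      unfolding osc_le_def by force
    then have "u \<noteq> v" using assms(2) by auto
    then show "(SUP (u, v)\<in>{(u, v). u \<in> {0..1} \<and> v \<in> {0..1} \<and> 0 < \<bar>u - v\<bar> \<and> \<bar>u - v\<bar> \<le> h}.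
               incr_ratio \<rho> f u v) > ereal t"
      unfolding less_SUP_iff using uv *[of u v] by (intro bexI[of _ "(u, v)"]) auto
  qed
qed

lemma less_holder_seminorm_iff:
  assumes "\<And>h. h \<in> {0..1} \<Longrightarrow> 0 \<le> \<rho> h" "\<rho> 0 = 0" "0 \<le> t"
  shows "holder_seminorm \<rho> f > ereal t \<longleftrightarrow> \<not> osc_le \<rho> f t 1"
proof -
  have "{(u, v). u \<in> {0..1} \<and> v \<in> {0..1} \<and> u \<noteq> v} =
     {(u, v). u \<in> {0..1} \<and> v \<in> {0..1::real} \<and> 0 < \<bar>u - v\<bar> \<and> \<bar>u - v\<bar> \<le> 1}" by auto
  then show ?thesis
    unfolding holder_seminorm_def using less_SUP_incr_ratio_iff[where \<rho>=\<rho> and h=1 and f=f, OF assms] by simp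
qed

lemma modulus_nonneg: "modulus_of_continuity \<rho> \<Longrightarrow> h \<in> {0..1} \<Longrightarrow> 0 \<le> \<rho> h"
  unfolding modulus_of_continuity_def
  by (metis atLeastAtMost_iff greaterThanAtMost_iff less_eq_real_def)

section \<open>Dyadic approximation\<close>

definition dyadic_ceil :: "real \<Rightarrow> nat \<Rightarrow> nat" where
  "dyadic_ceil u n = nat \<lceil>2 ^ n * u\<rceil>"

definition dyadic_floor :: "real \<Rightarrow> nat \<Rightarrow> nat" where
  "dyadic_floor u n = nat \<lfloor>2 ^ n * u\<rfloor>"

lemma dyadic_ceil_bounds:
  assumes "0 \<le> u" "u \<le> 1"
  shows "u \<le> dyadic_ceil u n / 2 ^ n" "dyadic_ceil u n / 2 ^ n < u + 1 / 2 ^ n"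
    "dyadic_ceil u n \<le> 2 ^ n"
proof -
  have 0: "0 \<le> 2 ^ n * u" using assms by simp
  then have r: "real (dyadic_ceil u n) = of_int \<lceil>2 ^ n * u\<rceil>"
    unfolding dyadic_ceil_def by (intro of_nat_nat) simp
  have c: "2 ^ n * u \<le> of_int \<lceil>2 ^ n * u\<rceil>" "of_int \<lceil>2 ^ n * u\<rceil> < 2 ^ n * u + 1"
    using ceiling_correct[of "2 ^ n * u"] by linarith+
  show "u \<le> dyadic_ceil u n / 2 ^ n" "dyadic_ceil u n / 2 ^ n < u + 1 / 2 ^ n"
    using c unfolding r by (auto simp: field_simps)
  have "2 ^ n * u \<le> 2 ^ n * 1" using assms by (intro mult_left_mono) auto
  then have "\<lceil>2 ^ n * u\<rceil> \<le> 2 ^ n" by (simp add: ceiling_le_iff)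
  then show "dyadic_ceil u n \<le> 2 ^ n" unfolding dyadic_ceil_def by (simp add: nat_le_iff)
qed

lemma dyadic_floor_bounds:
  assumes "0 \<le> u" "u \<le> 1"
  shows "dyadic_floor u n / 2 ^ n \<le> u" "u - 1 / 2 ^ n < dyadic_floor u n / 2 ^ n"
    "dyadic_floor u n \<le> 2 ^ n"
proof -
  have 0: "0 \<le> 2 ^ n * u" using assms by simp
  then have r: "real (dyadic_floor u n) = of_int \<lfloor>2 ^ n * u\<rfloor>"
    unfolding dyadic_floor_def by (intro of_nat_nat) simp
  have c: "of_int \<lfloor>2 ^ n * u\<rfloor> \<le> 2 ^ n * u" "2 ^ n * u < of_int \<lfloor>2 ^ n * u\<rfloor> + 1"
    using floor_correct[of "2 ^ n * u"] by linarith+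
  show *: "dyadic_floor u n / 2 ^ n \<le> u"
    using c(1) unfolding r by (simp add: field_simps)
  have "(2 ^ n * u - 1) / 2 ^ n < of_int \<lfloor>2 ^ n * u\<rfloor> / 2 ^ n"
    using c(2) by (intro divide_strict_right_mono) auto
  then show "u - 1 / 2 ^ n < dyadic_floor u n / 2 ^ n"
    unfolding r by (simp add: diff_divide_distrib)
  have "real (dyadic_floor u n) / 2 ^ n \<le> 1" using * assms(2) by (rule order_trans)
  then have "real (dyadic_floor u n) \<le> real (2 ^ n)" by (simp add: field_simps)
  then show "dyadic_floor u n \<le> 2 ^ n" unfolding of_nat_le_iff .
qed

text \<open>Doubling a number either doubles its ceiling or gives one less. In units of the finer
  level a refinement thus moves the approximation by at most one step, so consecutive approximations
  are equal or adjacent.\<close>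

lemma dyadic_ceil_Suc:
  assumes "0 \<le> u"
  shows "\<bar>int (dyadic_ceil u (Suc n)) - 2 * int (dyadic_ceil u n)\<bar> \<le> 1"
proof -
  have 0: "0 \<le> 2 ^ n * u" using assms by simp
  have e: "int (dyadic_ceil u k) = \<lceil>2 ^ k * u\<rceil>" for k
  proof -
    have "0 \<le> 2 ^ k * u" using assms by simp
    then have "0 \<le> \<lceil>2 ^ k * u\<rceil>" by simp
    then show ?thesis unfolding dyadic_ceil_def by simp
  qed
  show ?thesis unfolding e power_Suc by (simp add: mult.assoc) linarith
qed

lemma dyadic_floor_Suc:
  assumes "0 \<le> u"
  shows "\<bar>int (dyadic_floor u (Suc n)) - 2 * int (dyadic_floor u n)\<bar> \<le> 1"
proof -
  have e: "int (dyadic_floor u k) = \<lfloor>2 ^ k * u\<rfloor>" for k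
    unfolding dyadic_floor_def using assms by simp
  show ?thesis unfolding e power_Suc by (simp add: mult.assoc) linarith
qed

lemma inverse_power2_LIMSEQ: "(\<lambda>n. 1 / 2 ^ n :: real) \<longlonglongrightarrow> 0"
  using LIMSEQ_realpow_zero[of "1/2::real"] by (simp add: power_divide)

lemma dyadic_ceil_LIMSEQ:
  assumes "0 \<le> u" "u \<le> 1"
  shows "(\<lambda>n. dyadic_ceil u n / 2 ^ n) \<longlonglongrightarrow> u"
proof (rule tendsto_sandwich[of "\<lambda>_. u" _ _ "\<lambda>n. u + 1 / 2 ^ n"])
  show "(\<lambda>n. u + 1 / 2 ^ n) \<longlonglongrightarrow> u"
    using tendsto_add[OF tendsto_const[of u] inverse_power2_LIMSEQ] by simp
qed (use dyadic_ceil_bounds[OF assms] in \<open>auto intro!: always_eventually less_imp_le\<close>)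

lemma dyadic_floor_LIMSEQ:
  assumes "0 \<le> u" "u \<le> 1"
  shows "(\<lambda>n. dyadic_floor u n / 2 ^ n) \<longlonglongrightarrow> u"
proof (rule tendsto_sandwich[of "\<lambda>n. u - 1 / 2 ^ n" _ _ "\<lambda>_. u"])
  show "(\<lambda>n. u - 1 / 2 ^ n) \<longlonglongrightarrow> u"
    using tendsto_diff[OF tendsto_const[of u] inverse_power2_LIMSEQ] by simp
qed (use dyadic_floor_bounds[OF assms] in \<open>auto intro!: always_eventually less_imp_le\<close>)

lemma continuous_dyadic_LIMSEQ:
  fixes a :: "nat \<Rightarrow> nat"
  assumes "continuous_on {0..1} f" "u \<in> {0..1}" "\<And>n. a n \<le> 2 ^ n" "(\<lambda>n. a n / 2 ^ n) \<longlonglongrightarrow> u"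
  shows "(\<lambda>n. f (a n / 2 ^ n) :: real) \<longlonglongrightarrow> f u"
proof (rule continuous_on_tendsto_compose[OF assms(1,4,2)])
  have "real (a n) \<le> 2 ^ n" for n using assms(3)[of n] of_nat_le_iff[of "a n" "2 ^ n", where 'a=real] by simp
  then show "\<forall>\<^sub>F n in sequentially. a n / 2 ^ n \<in> {0..1::real}" by (auto simp: field_simps)
qed

text \<open>Rounding the left end up and the right end down never increases the distance, so
  monotonicity transfers the bound even if \<rho> jumps, while continuity of \<open>f\<close> takes
  care of the values. The conditions on the right are countably many, which is the source of
  measurability.\<close>

lemma osc_le_iff_dyadic:
  assumes cont: "continuous_on {0..1} f" and mono: "mono_on {0..1} \<rho>" and z: "\<rho> 0 = 0" and c: "0 \<le> c"
  shows "osc_le \<rho> f c h \<longleftrightarrow>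
    (\<forall>n a b. a \<le> b \<and> b \<le> 2 ^ n \<and> (real b - real a) / 2 ^ n \<le> h \<longrightarrow>
       \<bar>f (a / 2 ^ n) - f (b / 2 ^ n)\<bar> \<le> c * \<rho> ((real b - real a) / 2 ^ n))" (is "_ \<longleftrightarrow> ?R")
proof
  assume o: "osc_le \<rho> f c h"
  show ?R
  proof (intro allI impI)
    fix n a b :: nat assume ab: "a \<le> b \<and> b \<le> 2 ^ n \<and> (real b - real a) / 2 ^ n \<le> h"
    have b: "real b \<le> 2 ^ n" using ab of_nat_le_iff[of b "2 ^ n", where 'a=real] by simp
    have e: "\<bar>a / 2 ^ n - b / 2 ^ n\<bar> = (real b - real a) / 2 ^ n"
      using ab by (simp add: abs_if field_simps)
    have "real b / 2 ^ n \<le> 1" "real a / 2 ^ n \<le> 1" using ab b by (auto simp: field_simps)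
    then show "\<bar>f (a / 2 ^ n) - f (b / 2 ^ n)\<bar> \<le> c * \<rho> ((real b - real a) / 2 ^ n)"
      using o[unfolded osc_le_def, rule_format, of "a / 2 ^ n" "b / 2 ^ n"] e ab
      by auto
  qed
next
  assume R: ?R
  show "osc_le \<rho> f c h"
  proof (rule osc_leI[where \<rho>=\<rho>, OF z])
    fix u v :: real assume uv: "0 \<le> u" "u < v" "v \<le> 1" "v - u \<le> h"
    let ?a = "\<lambda>n. dyadic_ceil u n" and ?b = "\<lambda>n. dyadic_floor v n"
    have la: "(\<lambda>n. ?a n / 2 ^ n) \<longlonglongrightarrow> u" and lb: "(\<lambda>n. ?b n / 2 ^ n) \<longlonglongrightarrow> v"
      using uv by (auto intro!: dyadic_ceil_LIMSEQ dyadic_floor_LIMSEQ)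
    have fa: "(\<lambda>n. f (?a n / 2 ^ n)) \<longlonglongrightarrow> f u" and fb: "(\<lambda>n. f (?b n / 2 ^ n)) \<longlonglongrightarrow> f v"
      using uv by (auto intro!: continuous_dyadic_LIMSEQ[OF cont] la lb dyadic_ceil_bounds dyadic_floor_bounds)
    have "(\<lambda>n. \<bar>f (?a n / 2 ^ n) - f (?b n / 2 ^ n)\<bar>) \<longlonglongrightarrow> \<bar>f u - f v\<bar>"
      by (intro tendsto_intros fa fb)
    moreover have "\<forall>\<^sub>F n in sequentially. ?a n / 2 ^ n < (u + v) / 2" "\<forall>\<^sub>F n in sequentially. ?b n / 2 ^ n > (u + v) / 2"
      by (rule order_tendstoD[OF la] order_tendstoD[OF lb], use uv in simp)+
    then have "\<forall>\<^sub>F n in sequentially. \<bar>f (?a n / 2 ^ n) - f (?b n / 2 ^ n)\<bar> \<le> c * \<rho> (v - u)"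
    proof eventually_elim
      case (elim n)
      then have lt: "?a n / 2 ^ n < ?b n / 2 ^ n" by linarith
      then have lt': "?a n < ?b n" by (simp add: divide_less_cancel)
      have le: "(real (?b n) - real (?a n)) / 2 ^ n \<le> v - u"
        using dyadic_ceil_bounds(1)[of u n] dyadic_floor_bounds(1)[of v n] uv
        by (simp add: diff_divide_distrib)
      have "\<bar>f (?a n / 2 ^ n) - f (?b n / 2 ^ n)\<bar> \<le> c * \<rho> ((real (?b n) - real (?a n)) / 2 ^ n)"
        using R lt' dyadic_floor_bounds(3)[of v n] uv le by auto
      also have "\<dots> \<le> c * \<rho> (v - u)"
      proof (intro mult_left_mono c mono_onD[OF mono] le)
        have "0 \<le> (real (?b n) - real (?a n)) / 2 ^ n" using lt' by simp
        moreover have "(real (?b n) - real (?a n)) / 2 ^ n \<le> 1" using le uv by linarith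
        ultimately show "(real (?b n) - real (?a n)) / 2 ^ n \<in> {0..1}" by (simp only: atLeastAtMost_iff)
      qed (use uv in auto)
      finally show ?case .
    qed
    ultimately show "\<bar>f u - f v\<bar> \<le> c * \<rho> (v - u)"
      using tendsto_upperbound[of _ _ sequentially] by (metis trivial_limit_sequentially)
  qed
qed

section \<open>Measurability of increment bounds and of the seminorm\<close>

lemma sets_osc_le:
  assumes W: "C01_process M W" and mono: "mono_on {0..1} \<rho>" and z: "\<rho> 0 = 0" and c: "0 \<le> c"
  shows "{\<omega>\<in>space M. osc_le \<rho> (W \<omega>) c h} \<in> sets M"
proof -
  have "{\<omega>\<in>space M. osc_le \<rho> (W \<omega>) c h} = {\<omega>\<in>space M. \<forall>n a b. a \<le> b \<and> b \<le> 2 ^ n \<and> (real b - real a) / 2 ^ n \<le> h \<longrightarrow>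
       \<bar>W \<omega> (a / 2 ^ n) - W \<omega> (b / 2 ^ n)\<bar> \<le> c * \<rho> ((real b - real a) / 2 ^ n)}"
    by (intro Collect_cong conj_cong refl osc_le_iff_dyadic[OF _ mono z c]) (use W in \<open>simp add: C01_process_def\<close>)
  also have "\<dots> \<in> sets M"
  proof (intro sets.sets_Collect_countable_All)
    fix n a b :: nat
    show "{\<omega>\<in>space M. a \<le> b \<and> b \<le> 2 ^ n \<and> (real b - real a) / 2 ^ n \<le> h \<longrightarrow>
       \<bar>W \<omega> (a / 2 ^ n) - W \<omega> (b / 2 ^ n)\<bar> \<le> c * \<rho> ((real b - real a) / 2 ^ n)} \<in> sets M"
    proof (cases "a \<le> b \<and> b \<le> 2 ^ n")
      case True
      then have "real b \<le> 2 ^ n" using of_nat_le_iff[of b "2 ^ n", where 'a=real] by simp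
      then have [measurable]: "(\<lambda>\<omega>. W \<omega> (a / 2 ^ n)) \<in> borel_measurable M" "(\<lambda>\<omega>. W \<omega> (b / 2 ^ n)) \<in> borel_measurable M"
        using W True unfolding C01_process_def by (auto simp: field_simps)
      show ?thesis by measurable
    next
      case False
      then have "{\<omega>\<in>space M. a \<le> b \<and> b \<le> 2 ^ n \<and> (real b - real a) / 2 ^ n \<le> h \<longrightarrow>
       \<bar>W \<omega> (a / 2 ^ n) - W \<omega> (b / 2 ^ n)\<bar> \<le> c * \<rho> ((real b - real a) / 2 ^ n)} = space M" by blast
      then show ?thesis by (simp only: sets.top)
    qed
  qed
  finally show ?thesis .
qed

lemma sets_not_osc_le:
  assumes "C01_process M W" "mono_on {0..1} \<rho>" "\<rho> 0 = 0" "0 \<le> c"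
  shows "{\<omega>\<in>space M. \<not> osc_le \<rho> (W \<omega>) c h} \<in> sets M"
  using sets_osc_le[OF assms] by (rule sets.sets_Collect_neg)

text \<open>A level \<open>t \<ge> 0\<close> is exceeded exactly when \<open>osc_le\<close> with
  constant \<open>t\<close> fails; a negative level is always exceeded.\<close>

lemma borel_measurable_holder_seminorm:
  assumes W: "C01_process M W" and m: "modulus_of_continuity \<rho>"
  shows "(\<lambda>\<omega>. holder_seminorm \<rho> (W \<omega>)) \<in> borel_measurable M"
  unfolding borel_measurable_ereal_iff_Ioi
proof
  fix a :: ereal
  let ?S = "\<lambda>\<omega>. holder_seminorm \<rho> (W \<omega>)"
  have \<rho>: "\<rho> 0 = 0" "mono_on {0..1} \<rho>" using m unfolding modulus_of_continuity_def by blast+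
  have "{\<omega>\<in>space M. a < ?S \<omega>} \<in> sets M"
  proof (cases "a < 0")
    case True
    then have "a < ?S \<omega>" for \<omega>
      using sup_norm_le_holder_norm(1)[OF m] by (rule less_le_trans)
    then show ?thesis by simp
  next
    case False
    then consider t where "a = ereal t" "0 \<le> t" | "a = \<infinity>" by (cases a) auto
    then show ?thesis
    proof cases
      case 1
      have "{\<omega>\<in>space M. a < ?S \<omega>} = {\<omega>\<in>space M. \<not> osc_le \<rho> (W \<omega>) t 1}"
        by (simp only: 1(1) less_holder_seminorm_iff[where \<rho>=\<rho> and t=t, OF modulus_nonneg[OF m] \<rho>(1) 1(2)])
      also have "\<dots> \<in> sets M" by (rule sets_not_osc_le) fact+
      finally show ?thesis .
    qed simp
  qed
  moreover have "?S -` {a<..} \<inter> space M = {\<omega>\<in>space M. a < ?S \<omega>}" by auto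
  ultimately show "?S -` {a<..} \<inter> space M \<in> sets M" by simp
qed

section \<open>Chaining\<close>

text \<open>Telescoping along the path, then continuity at its end. The path is arbitrary up to the
  condition that a numerator differs from twice its predecessor by at most one, so that rounding up
  and rounding down are both instances.\<close>

lemma dyadic_path_bound:
  fixes f :: "real \<Rightarrow> real" and a :: "nat \<Rightarrow> nat"
  assumes cont: "continuous_on {0..1} f" and u: "u \<in> {0..1}"
    and a: "\<And>n. a n \<le> 2 ^ n" "\<And>n. \<bar>int (a (Suc n)) - 2 * int (a n)\<bar> \<le> 1" "(\<lambda>n. a n / 2 ^ n) \<longlonglongrightarrow> u"
    and step: "\<And>i c. c + 1 \<le> 2 ^ Suc (n + i) \<Longrightarrow>
      \<bar>f (real c / 2 ^ Suc (n + i)) - f (real (c + 1) / 2 ^ Suc (n + i))\<bar> \<le> e i"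
    and nonneg: "\<And>i. 0 \<le> e i" and sum: "\<And>k. (\<Sum>i<k. e i) \<le> E"
  shows "\<bar>f (a n / 2 ^ n) - f u\<bar> \<le> E"
proof -
  define g where "g k = f (a k / 2 ^ k)" for k
  have st: "\<bar>g (n + i) - g (Suc (n + i))\<bar> \<le> e i" for i
  proof -
    let ?k = "n + i"
    have e: "real (a ?k) / 2 ^ ?k = real (2 * a ?k) / 2 ^ Suc ?k" by simp
    consider "a (Suc ?k) = 2 * a ?k" | "a (Suc ?k) = 2 * a ?k + 1" | "2 * a ?k = a (Suc ?k) + 1"
      using a(2)[of ?k] by linarith
    then show ?thesis
    proof cases
      case 1 then show ?thesis using nonneg[of i] unfolding g_def e by simp
    next
      case 2 then show ?thesis using step[of "2 * a ?k" i] a(1)[of "Suc ?k"] unfolding g_def e by simp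
    next
      case 3
      have "2 * a ?k \<le> 2 ^ Suc ?k" using a(1)[of ?k] by simp
      then show ?thesis using step[of "a (Suc ?k)" i] 3 unfolding g_def e by (simp add: abs_minus_commute)
    qed
  qed
  have "\<bar>g n - g (n + k)\<bar> \<le> (\<Sum>i<k. e i)" for k
  proof (induction k)
    case (Suc k)
    then show ?case using st[of k] by simp
  qed simp
  then have "\<bar>g n - g (n + k)\<bar> \<le> E" for k using sum[of k] order_trans by blast
  moreover have "(\<lambda>k. g (n + k)) \<longlonglongrightarrow> f u"
    using LIMSEQ_ignore_initial_segment[OF continuous_dyadic_LIMSEQ[OF cont u a(1,3)], of n]
    unfolding g_def by (simp add: add.commute)
  then have "(\<lambda>k. \<bar>g n - g (n + k)\<bar>) \<longlonglongrightarrow> \<bar>g n - f u\<bar>" by (intro tendsto_intros)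
  ultimately show ?thesis unfolding g_def[symmetric] by (intro LIMSEQ_le_const2) auto
qed

text \<open>The good event at scale \<open>1 / 2 ^ m\<close>. It serves two purposes: general
  \<open>d\<close> controls the pair found between two given points, and \<open>d = 1\<close>
  controls the links of the chaining paths at level \<open>m + L\<close>.\<close>

definition dyadic_good :: "(real \<Rightarrow> real) \<Rightarrow> (real \<Rightarrow> real) \<Rightarrow> real \<Rightarrow> nat \<Rightarrow> nat \<Rightarrow> bool" where
  "dyadic_good \<rho> f s L m \<longleftrightarrow> (\<forall>a d. 1 \<le> d \<and> d \<le> 2 ^ L \<and> a + d \<le> 2 ^ (m + L) \<longrightarrow>
     \<bar>f (real a / 2 ^ (m + L)) - f (real (a + d) / 2 ^ (m + L))\<bar> \<le> s * \<rho> (real d / 2 ^ (m + L)))"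

lemma ex_dyadic_scale:
  fixes r :: real
  assumes "0 < r" "r \<le> 1 / 2 ^ m0"
  obtains m where "m0 \<le> m" "1 / 2 ^ Suc m < r" "r \<le> 1 / 2 ^ m"
proof -
  have "\<exists>m. 1 / 2 ^ m < r"
    using order_tendstoD(2)[OF inverse_power2_LIMSEQ assms(1)] by (auto simp: eventually_sequentially)
  then obtain k where k: "1 / 2 ^ k < r" by blast
  define m where "m = (LEAST m. 1 / 2 ^ m < r)"
  have m: "1 / 2 ^ m < r" unfolding m_def by (rule LeastI[of _ k]) (rule k)
  have "1 / 2 ^ m < (1 / 2 ^ m0 :: real)" using m assms(2) by linarith
  then have "(2::real) ^ m0 < 2 ^ m" by (simp add: field_simps)
  then have "m0 < m" by simp
  then obtain l where l: "m = Suc l" "m0 \<le> l" by (cases m) auto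
  then have "\<not> 1 / 2 ^ l < r" using not_less_Least[of l "\<lambda>m. 1 / 2 ^ m < r"] unfolding m_def by simp
  then show ?thesis using that[of l] l m by simp
qed

lemma power_powr_commute:
  fixes x :: real
  assumes "0 \<le> x"
  shows "(x ^ k) powr p = (x powr p) ^ k"
proof (induction k)
  case (Suc k)
  then show ?case using assms by (simp only: power_Suc powr_mult)
qed (simp only: power_0 powr_one_eq_one)

text \<open>The dyadic length is \<open>z * r\<close> with \<open>z \<le> (1/2) ^ k\<close>, because
  \<open>r\<close> exceeds \<open>1 / 2 ^ Suc m\<close>; the growth condition turns this into the
  factor \<open>((1/2) powr p) ^ k\<close>.\<close>

lemma growth_dyadic:
  fixes \<rho> :: "real \<Rightarrow> real"
  assumes growth: "\<And>h z. h \<in> {0..1} \<Longrightarrow> z \<in> {0..1} \<Longrightarrow> \<rho> (z * h) \<le> K * z powr p * \<rho> h"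
    and "0 < p" "0 < K" and r: "1 / 2 ^ Suc m < r" "r \<le> 1" "0 \<le> \<rho> r"
  shows "\<rho> (1 / 2 ^ Suc (m + k)) \<le> K * ((1/2) powr p) ^ k * \<rho> r"
proof -
  define z where "z = 1 / 2 ^ Suc (m + k) / r"
  have r0: "0 < r" using r(1) by (rule less_trans[rotated]) simp
  have "z * 2 ^ k = (1 / 2 ^ Suc m) / r" unfolding z_def by (simp add: power_add)
  also have "\<dots> \<le> 1" using r(1) r0 by (subst divide_le_eq_1) simp
  finally have z: "z \<le> (1/2) ^ k" by (simp add: power_divide field_simps)
  have z0: "0 \<le> z" unfolding z_def using r0 by simp
  have z1: "z \<le> 1" using z by (rule order_trans) (simp add: power_le_one)
  have "\<rho> (z * r) \<le> K * z powr p * \<rho> r" using growth[of r z] r r0 z0 z1 by simp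
  also have "z * r = 1 / 2 ^ Suc (m + k)" unfolding z_def using r0 by simp
  also have "z powr p \<le> ((1/2) ^ k) powr p" using z z0 \<open>0 < p\<close> by (intro powr_mono2) auto
  then have "K * z powr p * \<rho> r \<le> K * ((1/2) ^ k) powr p * \<rho> r"
    using \<open>0 < K\<close> r(3) by (intro mult_right_mono mult_left_mono) auto
  also have "((1/2::real) ^ k) powr p = ((1/2) powr p) ^ k" by (rule power_powr_commute) simp
  finally show ?thesis .
qed

text \<open>A pair at distance about \<open>2\<^sup>-\<^sup>m\<close> is compared with a pair of level \<open>m + L\<close> lying between
  its two points. Since the distance of that pair is not larger, no constant is lost there, and
  for large \<open>L\<close> the chaining errors from level \<open>m + L\<close> on are a small multiple of \<open>\<rho>\<close>.\<close>

lemma osc_le_if_dyadic_good: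
  assumes cont: "continuous_on {0..1} f"
    and \<rho>: "\<And>h. h \<in> {0..1} \<Longrightarrow> 0 \<le> \<rho> h" "mono_on {0..1} \<rho>" "\<rho> 0 = 0"
    and growth: "\<And>h z. h \<in> {0..1} \<Longrightarrow> z \<in> {0..1} \<Longrightarrow> \<rho> (z * h) \<le> K * z powr p * \<rho> h"
    and pK: "0 < p" "0 < K" and s: "0 \<le> s" and L: "2 \<le> L"
    and q: "q = (1/2) powr p" and t: "s * (1 + 2 * (K * q ^ L / (1 - q))) \<le> t"
    and good: "\<And>m. m0 \<le> m \<Longrightarrow> dyadic_good \<rho> f s L m"
  shows "osc_le \<rho> f t (1 / 2 ^ m0)"
proof (rule osc_leI[where \<rho>=\<rho>, OF \<rho>(3)])
  fix u v :: real assume uv: "0 \<le> u" "u < v" "v \<le> 1" "v - u \<le> 1 / 2 ^ m0"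
  define r where "r = v - u"
  have r: "0 < r" "r \<le> 1" using uv(1-3) unfolding r_def by linarith+
  obtain m where m: "m0 \<le> m" "1 / 2 ^ Suc m < r" "r \<le> 1 / 2 ^ m"
    by (rule ex_dyadic_scale[OF r(1)]) (use uv(4) r_def in simp)
  have \<rho>r: "0 \<le> \<rho> r" using \<rho>(1)[of r] r by simp
  define n where "n = m + L"
  \<comment> \<open>Bound for a link at level \<open>Suc (n + i)\<close>: its length
    \<open>1 / 2 ^ Suc (m + (L + i))\<close> is compared with \<open>r > 1 / 2 ^ Suc m\<close>,
    whence the power \<open>q ^ (L + i)\<close>. \<open>E\<close> is the full geometric sum.\<close>
  define e where "e i = s * (K * q ^ (L + i) * \<rho> r)" for i
  define E where "E = s * (K * q ^ L / (1 - q) * \<rho> r)"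
  have q01: "0 < q" "q < 1"
    using powr_less_mono2[of p "1/2" 1] pK unfolding q by auto
  have step: "\<bar>f (real c / 2 ^ Suc (n + i)) - f (real (c + 1) / 2 ^ Suc (n + i))\<bar> \<le> e i"
    if "c + 1 \<le> 2 ^ Suc (n + i)" for i c
  proof -
    \<comment> \<open>The link is the case \<open>d = 1\<close> of the good event at the finer scale
      \<open>Suc (m + i)\<close>.\<close>
    have eq: "Suc (m + i) + L = Suc (n + i)" by (simp add: n_def)
    have "\<bar>f (real c / 2 ^ Suc (n + i)) - f (real (c + 1) / 2 ^ Suc (n + i))\<bar> \<le> s * \<rho> (1 / 2 ^ Suc (n + i))"
    proof -
      have "dyadic_good \<rho> f s L (Suc (m + i))" by (rule good) (use m(1) in simp)
      note this[unfolded dyadic_good_def eq, rule_format, of 1 c]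
      then show ?thesis using that by simp
    qed
    also have "\<dots> \<le> e i"
      unfolding e_def q n_def add.assoc using s
      by (intro mult_left_mono growth_dyadic[OF growth pK m(2) r(2) \<rho>r]) auto
    finally show ?thesis .
  qed
  have e0: "0 \<le> e i" for i unfolding e_def using s pK q01 \<rho>r by simp
  have eE: "(\<Sum>i<k. e i) \<le> E" for k
  proof -
    have "(\<Sum>i<k. q ^ i) \<le> 1 / (1 - q)"
      using q01 by (subst sum_gp_strict) (auto intro!: divide_right_mono)
    then have "(s * K * q ^ L * \<rho> r) * (\<Sum>i<k. q ^ i) \<le> (s * K * q ^ L * \<rho> r) * (1 / (1 - q))"
      using s pK q01 \<rho>r by (intro mult_left_mono) auto
    then show ?thesis unfolding e_def E_def by (simp add: power_add sum_distrib_left mult_ac)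
  qed
  define a where "a = dyadic_ceil u n"
  define b where "b = dyadic_floor v n"
  have ua: "\<bar>f (a / 2 ^ n) - f u\<bar> \<le> E" unfolding a_def
    using uv by (intro dyadic_path_bound[OF cont _ _ _ _ step e0 eE] dyadic_ceil_bounds dyadic_ceil_Suc dyadic_ceil_LIMSEQ) auto
  have vb: "\<bar>f (b / 2 ^ n) - f v\<bar> \<le> E" unfolding b_def
    using uv by (intro dyadic_path_bound[OF cont _ _ _ _ step e0 eE] dyadic_floor_bounds dyadic_floor_Suc dyadic_floor_LIMSEQ) auto
  have a: "u \<le> a / 2 ^ n" "a / 2 ^ n < u + 1 / 2 ^ n" and b: "b / 2 ^ n \<le> v" "v - 1 / 2 ^ n < b / 2 ^ n" "b \<le> 2 ^ n"
    using dyadic_ceil_bounds[of u n] dyadic_floor_bounds[of v n] uv unfolding a_def b_def by auto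
  \<comment> \<open>Each rounding moves a point by less than \<open>1 / 2 ^ n\<close>. With
    \<open>L \<ge> 2\<close> the two together stay within \<open>1 / 2 ^ Suc m < r\<close>, so the
    rounded points keep their order and \<open>d \<ge> 1\<close>.\<close>
  have "(2::real) ^ 2 \<le> 2 ^ L" using L by (intro power_increasing) auto
  then have "2 * (1 / 2 ^ n) \<le> (1 / 2 ^ Suc m :: real)" unfolding n_def by (simp add: power_add field_simps)
  then have "a / 2 ^ n < b / 2 ^ n" using a b m(2) unfolding r_def by linarith
  then have ab: "a < b" by (simp add: divide_less_cancel)
  define d where "d = b - a"
  have bd: "b = a + d" "1 \<le> d" using ab unfolding d_def by auto
  have dr: "real d / 2 ^ n \<le> r" using a b unfolding bd r_def by (simp add: add_divide_distrib)
  then have "real d / 2 ^ n \<le> 1 / 2 ^ m" using m(3) by linarith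
  then have "real d \<le> 2 ^ L" unfolding n_def by (simp add: power_add field_simps)
  then have "real d \<le> real (2 ^ L)" by simp
  then have "d \<le> 2 ^ L" unfolding of_nat_le_iff .
  then have "\<bar>f (a / 2 ^ n) - f (b / 2 ^ n)\<bar> \<le> s * \<rho> (real d / 2 ^ n)"
    using good[OF m(1)] b(3) bd unfolding dyadic_good_def n_def by blast
  also have "\<dots> \<le> s * \<rho> r" 
  proof (intro mult_left_mono mono_onD[OF \<rho>(2)] dr s)
    show "real d / 2 ^ n \<in> {0..1}" using order_trans[OF dr r(2)] by (simp only: atLeastAtMost_iff) simp
  qed (use r in simp)
  finally have "\<bar>f u - f v\<bar> \<le> s * \<rho> r + 2 * E" using ua vb by linarith
  also have "\<dots> = s * (1 + 2 * (K * q ^ L / (1 - q))) * \<rho> r" unfolding E_def by (simp add: algebra_simps)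
  also have "\<dots> \<le> t * \<rho> r" using t \<rho>r by (rule mult_right_mono)
  finally show "\<bar>f u - f v\<bar> \<le> t * \<rho> (v - u)" unfolding r_def .
qed

lemma C01_process_measurable:
  "C01_process M W \<Longrightarrow> u \<in> {0..1} \<Longrightarrow> (\<lambda>\<omega>. W \<omega> u) \<in> borel_measurable M"
  by (simp add: C01_process_def)

lemma sets_incr_gt:
  assumes "C01_process M W" "u \<in> {0..1}" "v \<in> {0..1}"
  shows "{\<omega>\<in>space M. \<bar>W \<omega> u - W \<omega> v\<bar> > (c::real)} \<in> sets M"
proof -
  note [measurable] = C01_process_measurable[OF assms(1,2)] C01_process_measurable[OF assms(1,3)]
  show ?thesis by measurable
qed

lemma real_nat_le_power2: "(a::nat) \<le> 2 ^ n \<Longrightarrow> real a \<le> 2 ^ n"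
  using of_nat_le_iff[of a "2 ^ n", where 'a=real] by simp

text \<open>Union bound over at most \<open>2 ^ (m + L) * 2 ^ L\<close> pairs, each at distance at
  most \<open>(1/2) ^ m\<close> and therefore failing with probability at most
  \<open>K * ((1/2) powr \<kappa>) ^ m\<close>. The factor \<open>4 ^ L\<close> does not grow with
  \<open>m\<close>.\<close>

lemma prob_not_dyadic_good:
  assumes W: "C01_process M W" and K: "0 \<le> K" and k: "0 \<le> \<kappa>"
    and tail: "\<And>u v. u \<in> {0..1} \<Longrightarrow> v \<in> {0..1} \<Longrightarrow> u \<noteq> v \<Longrightarrow>
      measure M {\<omega>\<in>space M. \<bar>W \<omega> u - W \<omega> v\<bar> > s * \<rho> \<bar>u - v\<bar>} \<le> K * \<bar>u - v\<bar> powr \<kappa>"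
  shows "{\<omega>\<in>space M. \<not> dyadic_good \<rho> (W \<omega>) s L m} \<in> sets M"
    "measure M {\<omega>\<in>space M. \<not> dyadic_good \<rho> (W \<omega>) s L m} \<le> K * 4 ^ L * (2 * (1/2) powr \<kappa>) ^ m"
proof -
  let ?n = "m + L"
  interpret prob_space M using W by (simp add: C01_process_def)
  define F where "F = {(a, d). a < 2 ^ ?n \<and> 1 \<le> d \<and> d \<le> 2 ^ L \<and> a + d \<le> (2::nat) ^ ?n}"
  define B where "B = (\<lambda>(a, d). {\<omega>\<in>space M.
     \<bar>W \<omega> (real a / 2 ^ ?n) - W \<omega> (real (a + d) / 2 ^ ?n)\<bar> > s * \<rho> (real d / 2 ^ ?n)})"
  have sub: "F \<subseteq> {..<2 ^ ?n} \<times> {1..2 ^ L}" unfolding F_def by auto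
  then have fin: "finite F" by (rule finite_subset) auto
  have card: "card F \<le> 2 ^ ?n * 2 ^ L" using card_mono[OF _ sub] by simp
  have eq: "{\<omega>\<in>space M. \<not> dyadic_good \<rho> (W \<omega>) s L m} = (\<Union>x\<in>F. B x)"
  proof (intro set_eqI iffI)
    fix \<omega> assume "\<omega> \<in> {\<omega>\<in>space M. \<not> dyadic_good \<rho> (W \<omega>) s L m}"
    then obtain a d where \<omega>: "\<omega> \<in> space M" and ad: "1 \<le> d" "d \<le> 2 ^ L" "a + d \<le> 2 ^ ?n"
      "s * \<rho> (real d / 2 ^ ?n) < \<bar>W \<omega> (real a / 2 ^ ?n) - W \<omega> (real (a + d) / 2 ^ ?n)\<bar>"
      unfolding dyadic_good_def not_all not_imp not_le mem_Collect_eq by blast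
    have "a < 2 ^ ?n" using ad(1,3) by linarith
    then have "(a, d) \<in> F" using ad unfolding F_def by blast
    then show "\<omega> \<in> (\<Union>x\<in>F. B x)" by (rule UN_I) (simp only: B_def prod.case mem_Collect_eq \<omega> ad)
  next
    fix \<omega> assume "\<omega> \<in> (\<Union>x\<in>F. B x)"
    then obtain a d where "(a, d) \<in> F" "\<omega> \<in> B (a, d)" by (metis UN_E surj_pair)
    then show "\<omega> \<in> {\<omega>\<in>space M. \<not> dyadic_good \<rho> (W \<omega>) s L m}"
      unfolding F_def B_def dyadic_good_def not_all not_imp not_le mem_Collect_eq prod.case by blast
  qed
  have B: "B x \<in> sets M \<and> measure M (B x) \<le> K * ((1/2) powr \<kappa>) ^ m" if "x \<in> F" for x
  proof -
    obtain a d where x: "x = (a, d)" by (cases x)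
    have ad: "1 \<le> d" "d \<le> 2 ^ L" "a + d \<le> 2 ^ ?n" "a \<le> 2 ^ ?n"
      using that unfolding F_def x by auto
    let ?u = "real a / 2 ^ ?n" and ?v = "real (a + d) / 2 ^ ?n"
    have uv: "?u \<in> {0..1}" "?v \<in> {0..1}" using ad(3,4)[THEN real_nat_le_power2] by (auto simp: field_simps)
    have diff: "\<bar>?u - ?v\<bar> = real d / 2 ^ ?n" by (simp add: add_divide_distrib)
    have "real d / 2 ^ ?n \<le> 2 ^ L / 2 ^ ?n" using real_nat_le_power2[OF ad(2)] by (intro divide_right_mono) auto
    also have "\<dots> = (1/2) ^ m" by (simp add: power_add power_divide)
    finally have d: "real d / 2 ^ ?n \<le> (1/2) ^ m" .
    have "0 < \<bar>?u - ?v\<bar>" unfolding diff using ad by simp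
    then have ne: "?u \<noteq> ?v" by force
    have "measure M (B x) \<le> K * (real d / 2 ^ ?n) powr \<kappa>"
      using tail[OF uv ne] unfolding B_def x diff by simp
    also have "\<dots> \<le> K * ((1/2) ^ m) powr \<kappa>" using d K k by (intro mult_left_mono powr_mono2) auto
    also have "((1/2::real) ^ m) powr \<kappa> = ((1/2) powr \<kappa>) ^ m" by (rule power_powr_commute) simp
    finally have "measure M (B x) \<le> K * ((1/2) powr \<kappa>) ^ m" .
    moreover have "B x \<in> sets M" unfolding B_def x using sets_incr_gt[OF W uv] by simp
    ultimately show ?thesis by blast
  qed
  show "{\<omega>\<in>space M. \<not> dyadic_good \<rho> (W \<omega>) s L m} \<in> sets M"
    unfolding eq using B fin by (intro sets.finite_UN) auto
  have "measure M (\<Union>x\<in>F. B x) \<le> (\<Sum>x\<in>F. measure M (B x))"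
    using B fin by (intro measure_UNION_le) auto
  also have "\<dots> \<le> (\<Sum>x\<in>F. K * ((1/2) powr \<kappa>) ^ m)" using B by (intro sum_mono) auto
  also have "\<dots> = real (card F) * (K * ((1/2) powr \<kappa>) ^ m)" by simp
  also have "\<dots> \<le> real (2 ^ ?n * 2 ^ L) * (K * ((1/2) powr \<kappa>) ^ m)"
    using card K by (intro mult_right_mono) (auto simp only: of_nat_le_iff intro!: mult_nonneg_nonneg zero_le_power powr_ge_zero)
  also have "\<dots> = K * 4 ^ L * (2 * (1/2) powr \<kappa>) ^ m"
    using power_mult_distrib[of "2::real" 2 L] by (simp add: power_add power_mult_distrib)
  finally show "measure M {\<omega>\<in>space M. \<not> dyadic_good \<rho> (W \<omega>) s L m} \<le> K * 4 ^ L * (2 * (1/2) powr \<kappa>) ^ m"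
    unfolding eq .
qed

text \<open>\<open>L\<close> is fixed before the scale: it makes the chaining error fit between
  \<open>s\<close> and \<open>t\<close>. Then \<open>m0\<close> is taken so large that the failure
  bounds of all scales from \<open>m0\<close> on sum to at most \<open>e\<close>. Neither choice
  involves \<open>n\<close>, which gives the uniformity.\<close>

lemma prob_not_osc_le_small:
  fixes M :: "nat \<Rightarrow> 'a measure"
  assumes W: "\<And>n. C01_process (M n) (W n)"
    and \<rho>: "\<And>h. h \<in> {0..1} \<Longrightarrow> 0 \<le> \<rho> h" "mono_on {0..1} \<rho>" "\<rho> 0 = 0"
    and growth: "\<And>h z. h \<in> {0..1} \<Longrightarrow> z \<in> {0..1} \<Longrightarrow> \<rho> (z * h) \<le> K * z powr p * \<rho> h"
    and pK: "0 < p" "0 < K" and st: "0 \<le> s" "s < t" and kK: "1 < \<kappa>" "0 \<le> K'" and e: "0 < e"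
    and tail: "\<And>n u v. u \<in> {0..1} \<Longrightarrow> v \<in> {0..1} \<Longrightarrow> u \<noteq> v \<Longrightarrow>
      measure (M n) {\<omega>\<in>space (M n). \<bar>W n \<omega> u - W n \<omega> v\<bar> > s * \<rho> \<bar>u - v\<bar>} \<le> K' * \<bar>u - v\<bar> powr \<kappa>"
  shows "\<exists>h>0. \<forall>n. measure (M n) {\<omega>\<in>space (M n). \<not> osc_le \<rho> (W n \<omega>) t h} \<le> e"
proof -
  define q :: real where "q = (1/2) powr p"
  have q01: "0 < q" "q < 1"
    using powr_less_mono2[of p "1/2" 1] pK unfolding q_def by auto
  have "(\<lambda>L. s * (1 + 2 * (K * q ^ L / (1 - q)))) \<longlonglongrightarrow> s * (1 + 2 * (K * 0 / (1 - q)))"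
    using q01 by (intro tendsto_intros LIMSEQ_realpow_zero) auto
  then have "\<forall>\<^sub>F L in sequentially. s * (1 + 2 * (K * q ^ L / (1 - q))) < t"
    using st(2) by (intro order_tendstoD) auto
  moreover have "\<forall>\<^sub>F L in sequentially. 2 \<le> L" by (rule eventually_ge_at_top)
  ultimately have "\<forall>\<^sub>F L in sequentially. s * (1 + 2 * (K * q ^ L / (1 - q))) < t \<and> 2 \<le> L"
    by (rule eventually_conj)
  then obtain L where L: "s * (1 + 2 * (K * q ^ L / (1 - q))) \<le> t" "2 \<le> L"
    by (auto simp: eventually_sequentially intro: less_imp_le)
  \<comment> \<open>Ratio of the failure bounds at successive scales: the number of pairs doubles
    and each probability shrinks by \<open>(1/2) powr \<kappa>\<close>. It is below 1 because
    \<open>1 < \<kappa>\<close>.\<close>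
  define x :: real where "x = 2 * (1/2) powr \<kappa>"
  have "(1/2::real) powr \<kappa> < (1/2) powr 1" using kK by (intro powr_less_mono') auto
  then have x: "0 < x" "x < 1" unfolding x_def by auto
  have "(\<lambda>m. K' * 4 ^ L * (x ^ m / (1 - x))) \<longlonglongrightarrow> K' * 4 ^ L * (0 / (1 - x))"
    using x by (intro tendsto_intros LIMSEQ_realpow_zero) auto
  then have "\<forall>\<^sub>F m in sequentially. K' * 4 ^ L * (x ^ m / (1 - x)) < e"
    using e by (intro order_tendstoD) auto
  then obtain m0 where m0: "K' * 4 ^ L * (x ^ m0 / (1 - x)) \<le> e"
    by (auto simp: eventually_sequentially intro: less_imp_le)
  have "measure (M n) {\<omega>\<in>space (M n). \<not> osc_le \<rho> (W n \<omega>) t (1 / 2 ^ m0)} \<le> e" for n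
  proof -
    interpret prob_space "M n" using W by (simp add: C01_process_def)
    define B where "B i = {\<omega>\<in>space (M n). \<not> dyadic_good \<rho> (W n \<omega>) s L (m0 + i)}" for i
    have "0 \<le> \<kappa>" using kK by simp
    have B: "B i \<in> sets (M n)" "measure (M n) (B i) \<le> K' * 4 ^ L * x ^ (m0 + i)" for i
      unfolding B_def x_def by (rule prob_not_dyadic_good[OF W kK(2) \<open>0 \<le> \<kappa>\<close> tail]; assumption)+
    have sums: "(\<lambda>i. K' * 4 ^ L * x ^ (m0 + i)) sums (K' * 4 ^ L * (x ^ m0 / (1 - x)))"
      using sums_mult[OF geometric_sums[of x], of "K' * 4 ^ L * x ^ m0"] x by (simp add: power_add mult_ac)
    have sumB: "summable (\<lambda>i. measure (M n) (B i))"
      by (rule summable_comparison_test'[OF sums_summable[OF sums], of 0]) (use B in auto)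
    have "{\<omega>\<in>space (M n). \<not> osc_le \<rho> (W n \<omega>) t (1 / 2 ^ m0)} \<subseteq> (\<Union>i. B i)"
    proof
      fix \<omega> assume "\<omega> \<in> {\<omega>\<in>space (M n). \<not> osc_le \<rho> (W n \<omega>) t (1 / 2 ^ m0)}"
      then have \<omega>: "\<omega> \<in> space (M n)" "\<not> osc_le \<rho> (W n \<omega>) t (1 / 2 ^ m0)" by auto
      have cont: "continuous_on {0..1} (W n \<omega>)" using W[of n] \<omega>(1) by (simp add: C01_process_def)
      have "\<not> (\<forall>m\<ge>m0. dyadic_good \<rho> (W n \<omega>) s L m)"
        using osc_le_if_dyadic_good[OF cont \<rho> growth pK st(1) L(2) q_def L(1)] \<omega>(2) by blast
      then show "\<omega> \<in> (\<Union>i. B i)" using \<omega>(1) unfolding B_def by (auto simp: le_iff_add)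
    qed
    then have "measure (M n) {\<omega>\<in>space (M n). \<not> osc_le \<rho> (W n \<omega>) t (1 / 2 ^ m0)} \<le> measure (M n) (\<Union>i. B i)"
      using B(1) by (intro finite_measure_mono) auto
    also have "\<dots> \<le> (\<Sum>i. measure (M n) (B i))"
      using B(1) sumB by (intro finite_measure_subadditive_countably) auto
    also have "\<dots> \<le> (\<Sum>i. K' * 4 ^ L * x ^ (m0 + i))" by (rule suminf_le[OF B(2) sumB sums_summable[OF sums]])
    also have "\<dots> = K' * 4 ^ L * (x ^ m0 / (1 - x))" using sums by (rule sums_unique[symmetric])
    finally show ?thesis using m0 by linarith
  qed
  then show ?thesis by (intro exI[of _ "1 / 2 ^ m0"]) auto
qed

section \<open>From small to large increments\<close>

lemma osc_le_rescale:
  assumes small: "\<And>x. 0 < x \<Longrightarrow> x < \<delta> \<Longrightarrow> c * \<rho> x \<le> c' * \<rho>' x" and z: "\<rho> 0 = 0" "\<rho>' 0 = 0"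
    and h: "h' < \<delta>" "h' \<le> h" and o: "osc_le \<rho> f c h"
  shows "osc_le \<rho>' f c' h'"
proof (rule osc_leI[where \<rho>=\<rho>', OF z(2)])
  fix u v :: real assume uv: "0 \<le> u" "u < v" "v \<le> 1" "v - u \<le> h'"
  have "\<bar>f u - f v\<bar> \<le> c * \<rho> \<bar>u - v\<bar>" using uv h by (intro o[unfolded osc_le_def, rule_format]) auto
  also have "\<bar>u - v\<bar> = v - u" using uv by simp
  also have "c * \<rho> (v - u) \<le> c' * \<rho>' (v - u)" by (rule small) (use uv h in linarith)+
  finally show "\<bar>f u - f v\<bar> \<le> c' * \<rho>' (v - u)" .
qed

text \<open>The segment from \<open>u\<close> to \<open>v\<close> is cut into \<open>N\<close> equal
  pieces, of length at most \<open>h\<close> since the whole has length at most 1. A piece is also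
  no longer than \<open>v - u\<close>, so it costs at most \<open>c * \<rho> (v - u)\<close>, and
  the sum is again a multiple of \<rho> at the distance of the pair.\<close>

lemma osc_le_global:
  assumes mono: "mono_on {0..1} \<rho>" and z: "\<rho> 0 = 0" and c: "0 \<le> c"
    and N: "0 < N" "1 \<le> real N * h" and o: "osc_le \<rho> f c h"
  shows "osc_le \<rho> f (c * N) 1"
proof (rule osc_leI[where \<rho>=\<rho>, OF z])
  fix u v :: real assume uv: "0 \<le> u" "u < v" "v \<le> 1" "v - u \<le> 1"
  define r where "r = v - u"
  have r: "0 < r" "r \<le> 1" "u + r \<le> 1" using uv by (auto simp: r_def)
  define x where "x i = u + real i / N * r" for i :: nat
  have x01: "x i \<in> {0..1}" if "i \<le> N" for i
  proof -
    have "real i / N * r \<le> 1 * r" using that N r by (intro mult_right_mono) auto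
    moreover have "0 \<le> real i / N * r" using r by simp
    ultimately show ?thesis unfolding x_def atLeastAtMost_iff using r(3) uv(1) by linarith
  qed
  have rN: "r / N \<le> r" using N(1) r(1) by (simp add: field_simps)
  have "r / N \<le> 1 / N" using r(2) by (intro divide_right_mono) auto
  also have "\<dots> \<le> h" using N by (simp add: field_simps)
  finally have rh: "r / N \<le> h" .
  have step: "\<bar>f (x i) - f (x (Suc i))\<bar> \<le> c * \<rho> r" if "i < N" for i
  proof -
    have d: "\<bar>x i - x (Suc i)\<bar> = r / N" unfolding x_def using r N(1) by (simp add: field_simps)
    have "\<bar>f (x i) - f (x (Suc i))\<bar> \<le> c * \<rho> \<bar>x i - x (Suc i)\<bar>"
      by (rule o[unfolded osc_le_def, rule_format]) (use x01[of i] x01[of "Suc i"] that d rh in \<open>simp_all only: less_imp_le Suc_leI\<close>)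
    also have "\<dots> \<le> c * \<rho> r" unfolding d
    proof (intro mult_left_mono mono_onD[OF mono] c rN)
      have "0 \<le> r / N" using r by simp
      then show "r / N \<in> {0..1}" using order_trans[OF rN r(2)] by (simp only: atLeastAtMost_iff)
    qed (use r in simp)
    finally show ?thesis .
  qed
  have "\<bar>f (x 0) - f (x k)\<bar> \<le> real k * (c * \<rho> r)" if "k \<le> N" for k
    using that
  proof (induction k)
    case (Suc k)
    then have "\<bar>f (x 0) - f (x k)\<bar> \<le> real k * (c * \<rho> r)" "\<bar>f (x k) - f (x (Suc k))\<bar> \<le> c * \<rho> r"
      using step[of k] by auto
    then show ?case by (simp add: algebra_simps)
  qed simp
  from this[of N] show "\<bar>f u - f v\<bar> \<le> c * N * \<rho> (v - u)"
    unfolding x_def r_def[symmetric] using N(1) by (simp add: r_def mult_ac)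
qed

text \<open>Treats the limits 1 and infinity at once. Zeros of \<open>\<rho>\<^sub>0\<close> are
  handled apart, the bound there being the non-negativity of \<rho>.\<close>

lemma ratio_tendsto_scale:
  assumes m: "modulus_of_continuity \<rho>" and \<rho>0: "\<And>h. h \<in> {0..1} \<Longrightarrow> 0 \<le> \<rho>\<^sub>0 h"
    and lim: "((\<lambda>h. ereal (\<rho> h) / ereal (\<rho>\<^sub>0 h)) \<longlongrightarrow> l) (at_right 0)" and c: "0 \<le> c" "ereal c < l"
  shows "\<exists>\<delta>>0. \<delta> \<le> 1 \<and> (\<forall>x. 0 < x \<longrightarrow> x < \<delta> \<longrightarrow> c * \<rho>\<^sub>0 x \<le> \<rho> x)"
proof -
  have "\<forall>\<^sub>F h in at_right 0. ereal c < ereal (\<rho> h) / ereal (\<rho>\<^sub>0 h)"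
    using lim c(2) by (rule order_tendstoD)
  then obtain b where b: "b > 0" "\<And>x. 0 < x \<Longrightarrow> x < b \<Longrightarrow> ereal c < ereal (\<rho> x) / ereal (\<rho>\<^sub>0 x)"
    unfolding eventually_at_right_field by blast
  have "c * \<rho>\<^sub>0 x \<le> \<rho> x" if x: "0 < x" "x < b" "x < 1" for x
  proof (cases "\<rho>\<^sub>0 x = 0")
    case True
    have "x \<in> {0..1}" using x by simp
    then show ?thesis using modulus_nonneg[OF m] True by simp
  next
    case False
    have "0 \<le> \<rho>\<^sub>0 x" by (rule \<rho>0) (use x in simp)
    then have p: "0 < \<rho>\<^sub>0 x" using False by simp
    have "ereal c < ereal (\<rho> x / \<rho>\<^sub>0 x)" using b(2)[OF x(1,2)] p by simp
    then show ?thesis using p by (simp add: field_simps)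
  qed
  then show ?thesis using b(1) by (intro exI[of _ "min b 1"]) auto
qed

section \<open>Convergence of finite-dimensional marginals\<close>

text \<open>Where \<open>X\<close> leaves the space the integrand is set to zero, so measurability
  on the restricted space extends to the whole one.\<close>

lemma random_element_compose:
  assumes X: "random_element M T X" and \<phi>: "continuous_map T euclideanreal \<phi>"
  shows "(\<lambda>\<omega>. indicator {\<omega>\<in>space M. X \<omega> \<in> topspace T} \<omega> *\<^sub>R \<phi> (X \<omega>)) \<in> borel_measurable M"
proof -
  let ?S = "{\<omega>\<in>space M. X \<omega> \<in> topspace T}"
  have "\<phi> \<in> measurable (borel_of_topology T) borel"
  proof (rule borel_measurableI)
    fix U :: "real set" assume "open U"
    then have "openin T {x \<in> topspace T. \<phi> x \<in> U}"
      using openin_continuous_map_preimage[OF \<phi>] by simp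
    moreover have "{U. openin T U} \<subseteq> Pow (topspace T)" by (auto dest: openin_subset)
    moreover have "\<phi> -` U \<inter> space (borel_of_topology T) = {x \<in> topspace T. \<phi> x \<in> U}"
      unfolding borel_of_topology_def using \<open>_ \<subseteq> Pow (topspace T)\<close> by (auto simp: space_measure_of)
    ultimately show "\<phi> -` U \<inter> space (borel_of_topology T) \<in> sets (borel_of_topology T)"
      unfolding borel_of_topology_def by (simp add: sets_measure_of)
  qed
  moreover have "X \<in> measurable (restrict_space M ?S) (borel_of_topology T)"
    using X by (simp add: random_element_def)
  ultimately have "(\<lambda>\<omega>. \<phi> (X \<omega>)) \<in> borel_measurable (restrict_space M ?S)"
    by (rule measurable_compose[rotated])
  moreover have "?S \<inter> space M \<in> sets M" using X by (simp add: random_element_def Int_absorb2)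
  ultimately show ?thesis by (subst (asm) borel_measurable_restrict_space_iff)
qed

text \<open>A path restricted to \<open>J\<close> always lies in the product space, so the set
  integrals in the definition of weak convergence are integrals over the whole probability
  space.\<close>

lemma fidi_tendsto:
  assumes fidi: "fidi_converges M X N Y" and J: "finite J" "J \<subseteq> {0..1}"
    and \<psi>: "continuous_map (product_topology (\<lambda>_. euclideanreal) J) euclideanreal \<psi>"
    and B: "\<And>x. \<bar>\<psi> x\<bar> \<le> B"
  shows "(\<lambda>n. LINT \<omega>|M n. \<psi> (restrict (X n \<omega>) J)) \<longlonglongrightarrow> (LINT \<omega>|N. \<psi> (restrict (Y \<omega>) J))"
    "(\<lambda>\<omega>. \<psi> (restrict (X n \<omega>) J)) \<in> borel_measurable (M n)"
    "(\<lambda>\<omega>. \<psi> (restrict (Y \<omega>) J)) \<in> borel_measurable N"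
proof -
  let ?T = "product_topology (\<lambda>_. euclideanreal) J"
  have w: "weakly_converges ?T M (\<lambda>n \<omega>. restrict (X n \<omega>) J) N (\<lambda>\<omega>. restrict (Y \<omega>) J)"
    using fidi J unfolding fidi_converges_def by blast
  have top: "restrict f J \<in> topspace ?T" for f :: "real \<Rightarrow> real" by simp
  have bd: "bounded (\<psi> ` topspace ?T)"
    unfolding bounded_iff using B by (intro exI[of _ B]) auto
  have ind: "(\<lambda>\<omega>. indicator {\<omega>\<in>space P. restrict (Z \<omega>) J \<in> topspace ?T} \<omega> *\<^sub>R \<psi> (restrict (Z \<omega>) J)) \<in> borel_measurable P
    \<longleftrightarrow> (\<lambda>\<omega>. \<psi> (restrict (Z \<omega>) J)) \<in> borel_measurable P" for P :: "'z measure" and Z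
    by (intro measurable_cong) simp
  have int: "(LINT \<omega>:{\<omega>\<in>space P. restrict (Z \<omega>) J \<in> topspace ?T}|P. \<psi> (restrict (Z \<omega>) J))
     = (LINT \<omega>|P. \<psi> (restrict (Z \<omega>) J))" for P :: "'z measure" and Z
    unfolding set_lebesgue_integral_def by (intro Bochner_Integration.integral_cong) simp_all
  show "(\<lambda>n. LINT \<omega>|M n. \<psi> (restrict (X n \<omega>) J)) \<longlonglongrightarrow> (LINT \<omega>|N. \<psi> (restrict (Y \<omega>) J))"
    using w \<psi> bd unfolding weakly_converges_def int[symmetric] by blast
  show "(\<lambda>\<omega>. \<psi> (restrict (X n \<omega>) J)) \<in> borel_measurable (M n)"
    unfolding ind[symmetric] using w \<psi> unfolding weakly_converges_def by (intro random_element_compose) blast+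
  show "(\<lambda>\<omega>. \<psi> (restrict (Y \<omega>) J)) \<in> borel_measurable N"
    unfolding ind[symmetric] using w \<psi> unfolding weakly_converges_def by (intro random_element_compose) blast+
qed

section \<open>Exceedance of levels at finitely many pairs of points\<close>

definition incr_exceeds :: "(real \<times> real) set \<Rightarrow> (real \<times> real \<Rightarrow> real) \<Rightarrow> (real \<Rightarrow> real) \<Rightarrow> bool" where
  "incr_exceeds F a f \<longleftrightarrow> (\<exists>p\<in>F. a p < \<bar>f (fst p) - f (snd p)\<bar>)"

lemma sets_incr_exceeds:
  assumes "C01_process M W" "finite F" "F \<subseteq> {0..1} \<times> {0..1}"
  shows "{\<omega>\<in>space M. incr_exceeds F a (W \<omega>)} \<in> sets M"
  unfolding incr_exceeds_def
proof (rule sets.sets_Collect_finite_Ex[OF _ assms(2)])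
  fix p assume "p \<in> F"
  then have "fst p \<in> {0..1}" "snd p \<in> {0..1}" using assms(3) by (auto simp del: atLeastAtMost_iff)
  then show "{\<omega>\<in>space M. a p < \<bar>W \<omega> (fst p) - W \<omega> (snd p)\<bar>} \<in> sets M" by (rule sets_incr_gt[OF assms(1)])
qed

lemma prob_le_integral_le:
  assumes W: "C01_process M W" and F: "finite F" "F \<subseteq> {0..1} \<times> {0..1}"
    and g: "g \<in> borel_measurable M" "\<And>\<omega>. 0 \<le> g \<omega>" "\<And>\<omega>. g \<omega> \<le> 1"
    and b: "\<And>\<omega>. incr_exceeds F b (W \<omega>) \<Longrightarrow> g \<omega> = 1"
    and a: "\<And>\<omega>. \<not> incr_exceeds F a (W \<omega>) \<Longrightarrow> g \<omega> = 0"
  shows "measure M {\<omega>\<in>space M. incr_exceeds F b (W \<omega>)} \<le> (LINT \<omega>|M. g \<omega>)"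
    "(LINT \<omega>|M. g \<omega>) \<le> measure M {\<omega>\<in>space M. incr_exceeds F a (W \<omega>)}"
proof -
  interpret prob_space M using W by (simp add: C01_process_def)
  have int: "integrable M g" using g by (intro integrable_const_bound[of _ 1]) auto
  have indS: "integrable M (indicat_real {\<omega>\<in>space M. incr_exceeds F c (W \<omega>)})"
    "(LINT \<omega>|M. indicat_real {\<omega>\<in>space M. incr_exceeds F c (W \<omega>)} \<omega>) = measure M {\<omega>\<in>space M. incr_exceeds F c (W \<omega>)}" for c
    using sets_incr_exceeds[OF W F] by (auto simp: integrable_indicator_iff less_top[symmetric] Int_absorb2 subset_iff)
  show "measure M {\<omega>\<in>space M. incr_exceeds F b (W \<omega>)} \<le> (LINT \<omega>|M. g \<omega>)"
    unfolding indS(2)[symmetric] using indS(1) int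
    by (rule integral_mono) (use b g(2) in \<open>auto simp: indicator_def\<close>)
  show "(LINT \<omega>|M. g \<omega>) \<le> measure M {\<omega>\<in>space M. incr_exceeds F a (W \<omega>)}"
    unfolding indS(2)[symmetric] using int indS(1)
    by (rule integral_mono) (use a g(3) in \<open>auto simp: indicator_def\<close>)
qed

text \<open>Indicators of exceedance are not continuous, so a continuous function of the finitely
  many values is put between the indicators for the levels \<open>b\<close> and \<open>a\<close>.
  The price is the strict gap between the levels.\<close>

lemma fidi_incr_exceeds:
  assumes fidi: "fidi_converges M X N Y" and X: "\<And>n. C01_process (M n) (X n)" and Y: "C01_process N Y"
    and F: "finite F" "F \<subseteq> {0..1} \<times> {0..1}" and ab: "\<And>p. p \<in> F \<Longrightarrow> a p < b p" and e: "0 < e"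
  shows "\<forall>\<^sub>F n in sequentially. measure (M n) {\<omega>\<in>space (M n). incr_exceeds F b (X n \<omega>)}
      \<le> measure N {\<omega>\<in>space N. incr_exceeds F a (Y \<omega>)} + e" (is ?upper)
    and "\<forall>\<^sub>F n in sequentially. measure N {\<omega>\<in>space N. incr_exceeds F b (Y \<omega>)}
      \<le> measure (M n) {\<omega>\<in>space (M n). incr_exceeds F a (X n \<omega>)} + e" (is ?lower)
proof -
  define J where "J = fst ` F \<union> snd ` F"
  have J: "finite J" "J \<subseteq> {0..1}" using F unfolding J_def by auto
  have inJ: "fst p \<in> J" "snd p \<in> J" if "p \<in> F" for p using that unfolding J_def by auto
  \<comment> \<open>A ramp that vanishes for increments up to \<open>a p\<close> and reaches 1 at
    \<open>b p\<close>. A single pair beyond its level \<open>b p\<close> already brings the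
    truncated sum to 1.\<close>
  define \<theta> where "\<theta> x p = max 0 ((\<bar>x (fst p) - x (snd p)\<bar> - a p) * (1 / (b p - a p)))" for x :: "real \<Rightarrow> real" and p
  define \<psi> where "\<psi> x = min 1 (\<Sum>p\<in>F. \<theta> x p)" for x :: "real \<Rightarrow> real"
  have \<theta>0: "0 \<le> \<theta> x p" for x p unfolding \<theta>_def by simp
  have sum0: "0 \<le> (\<Sum>p\<in>F. \<theta> x p)" for x using \<theta>0 by (intro sum_nonneg)
  have \<psi>01: "0 \<le> \<psi> x" "\<psi> x \<le> 1" for x unfolding \<psi>_def using sum0 by auto
  have cont: "continuous_map (product_topology (\<lambda>_. euclideanreal) J) euclideanreal \<psi>"
    unfolding \<psi>_def \<theta>_def
    by (intro continuous_map_real_min continuous_map_sum continuous_map_real_max continuous_map_real_mult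
        continuous_map_diff continuous_map_real_abs continuous_map_product_projection inJ F(1)) auto
  have one: "\<psi> (restrict f J) = 1" if f: "incr_exceeds F b f" for f
  proof -
    obtain p where p: "p \<in> F" "b p < \<bar>f (fst p) - f (snd p)\<bar>" using f unfolding incr_exceeds_def by blast
    have "1 \<le> (\<bar>f (fst p) - f (snd p)\<bar> - a p) * (1 / (b p - a p))" using p ab[OF p(1)] by (simp add: field_simps)
    then have "1 \<le> \<theta> (restrict f J) p" unfolding \<theta>_def using inJ[OF p(1)] by simp
    also have "\<dots> \<le> (\<Sum>p\<in>F. \<theta> (restrict f J) p)" using p(1) F(1) \<theta>0 by (intro member_le_sum) auto
    finally show ?thesis unfolding \<psi>_def by simp
  qed
  have zero: "\<psi> (restrict f J) = 0" if "\<not> incr_exceeds F a f" for f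
  proof -
    have "\<theta> (restrict f J) p = 0" if p: "p \<in> F" for p
    proof -
      have "\<bar>f (fst p) - f (snd p)\<bar> - a p \<le> 0" using \<open>\<not> incr_exceeds F a f\<close> p unfolding incr_exceeds_def by force
      then have "(\<bar>f (fst p) - f (snd p)\<bar> - a p) * (1 / (b p - a p)) \<le> 0"
        using ab[OF p] by (intro mult_nonpos_nonneg) auto
      then show ?thesis unfolding \<theta>_def using inJ[OF p] by simp
    qed
    then show ?thesis unfolding \<psi>_def by simp
  qed
  have abs: "\<bar>\<psi> x\<bar> \<le> 1" for x using \<psi>01 by simp
  note lim = fidi_tendsto[OF fidi J cont abs]
  have pX: "measure (M n) {\<omega>\<in>space (M n). incr_exceeds F b (X n \<omega>)} \<le> (LINT \<omega>|M n. \<psi> (restrict (X n \<omega>) J))"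
    "(LINT \<omega>|M n. \<psi> (restrict (X n \<omega>) J)) \<le> measure (M n) {\<omega>\<in>space (M n). incr_exceeds F a (X n \<omega>)}" for n
    by (rule prob_le_integral_le[OF X F lim(2) \<psi>01 one zero]; assumption)+
  have pY: "measure N {\<omega>\<in>space N. incr_exceeds F b (Y \<omega>)} \<le> (LINT \<omega>|N. \<psi> (restrict (Y \<omega>) J))"
    "(LINT \<omega>|N. \<psi> (restrict (Y \<omega>) J)) \<le> measure N {\<omega>\<in>space N. incr_exceeds F a (Y \<omega>)}"
    by (rule prob_le_integral_le[OF Y F lim(3) \<psi>01 one zero]; assumption)+
  have ev: "\<forall>\<^sub>F n in sequentially. dist (LINT \<omega>|M n. \<psi> (restrict (X n \<omega>) J)) (LINT \<omega>|N. \<psi> (restrict (Y \<omega>) J)) < e"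
    using tendstoD[OF lim(1) e] .
  show ?upper using ev
  proof eventually_elim
    case (elim n) then show ?case using pX(1)[of n] pY(2) unfolding dist_real_def by linarith
  qed
  show ?lower using ev
  proof eventually_elim
    case (elim n) then show ?case using pX(2)[of n] pY(1) unfolding dist_real_def by linarith
  qed
qed

text \<open>The open-set half of the portmanteau theorem: strict exceedance is an open condition.
  The raised levels \<open>a p + 1 / real (Suc j)\<close> provide the gap, and continuity of the
  limit measure from below removes it as they decrease to \<open>a p\<close>.\<close>

lemma fidi_incr_exceeds_lower:
  assumes fidi: "fidi_converges M X N Y" and X: "\<And>n. C01_process (M n) (X n)" and Y: "C01_process N Y"
    and F: "finite F" "F \<subseteq> {0..1} \<times> {0..1}" and e: "0 < e"
  shows "\<forall>\<^sub>F n in sequentially. measure N {\<omega>\<in>space N. incr_exceeds F a (Y \<omega>)}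
      \<le> measure (M n) {\<omega>\<in>space (M n). incr_exceeds F a (X n \<omega>)} + e"
proof -
  interpret prob_space N using Y by (simp add: C01_process_def)
  define A where "A j = {\<omega>\<in>space N. incr_exceeds F (\<lambda>p. a p + 1 / real (Suc j)) (Y \<omega>)}" for j
  have "incseq A"
  proof (rule incseq_SucI)
    fix j
    have "1 / real (Suc (Suc j)) \<le> 1 / real (Suc j)" by (simp add: field_simps)
    then have "a p + 1 / real (Suc (Suc j)) < y" if "a p + 1 / real (Suc j) < y" for p y
      using that by linarith
    then show "A j \<subseteq> A (Suc j)" unfolding A_def incr_exceeds_def by blast
  qed
  moreover have "A j \<in> sets N" for j unfolding A_def by (rule sets_incr_exceeds[OF Y F])
  ultimately have "(\<lambda>j. measure N (A j)) \<longlonglongrightarrow> measure N (\<Union>j. A j)"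
    by (intro finite_Lim_measure_incseq) auto
  moreover have "(\<Union>j. A j) = {\<omega>\<in>space N. incr_exceeds F a (Y \<omega>)}"
  proof (intro equalityI subsetI)
    fix \<omega> assume "\<omega> \<in> (\<Union>j. A j)"
    then obtain j p where p: "\<omega> \<in> space N" "p \<in> F" "a p + 1 / real (Suc j) < \<bar>Y \<omega> (fst p) - Y \<omega> (snd p)\<bar>"
      unfolding A_def incr_exceeds_def by blast
    have "0 < 1 / real (Suc j)" by simp
    then have "a p < \<bar>Y \<omega> (fst p) - Y \<omega> (snd p)\<bar>" using p(3) by linarith
    then show "\<omega> \<in> {\<omega>\<in>space N. incr_exceeds F a (Y \<omega>)}" using p unfolding incr_exceeds_def by blast
  next
    fix \<omega> assume "\<omega> \<in> {\<omega>\<in>space N. incr_exceeds F a (Y \<omega>)}"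
    then obtain p where p: "\<omega> \<in> space N" "p \<in> F" "a p < \<bar>Y \<omega> (fst p) - Y \<omega> (snd p)\<bar>"
      unfolding incr_exceeds_def by blast
    obtain j where "inverse (real (Suc j)) < \<bar>Y \<omega> (fst p) - Y \<omega> (snd p)\<bar> - a p"
      using reals_Archimedean[of "\<bar>Y \<omega> (fst p) - Y \<omega> (snd p)\<bar> - a p"] p(3) by auto
    then have "a p + 1 / real (Suc j) < \<bar>Y \<omega> (fst p) - Y \<omega> (snd p)\<bar>" unfolding inverse_eq_divide by linarith
    then show "\<omega> \<in> (\<Union>j. A j)" using p unfolding A_def incr_exceeds_def by blast
  qed
  ultimately have "\<forall>\<^sub>F j in sequentially. measure N {\<omega>\<in>space N. incr_exceeds F a (Y \<omega>)} - e / 2 < measure N (A j)"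
    using e by (intro order_tendstoD(1)) auto
  then obtain j where j: "measure N {\<omega>\<in>space N. incr_exceeds F a (Y \<omega>)} - e / 2 < measure N (A j)"
    by (auto simp: eventually_sequentially)
  have "\<forall>\<^sub>F n in sequentially. measure N (A j) \<le> measure (M n) {\<omega>\<in>space (M n). incr_exceeds F a (X n \<omega>)} + e / 2"
    unfolding A_def using e by (intro fidi_incr_exceeds(2)[OF fidi X Y F]) auto
  then show ?thesis
  proof eventually_elim
    case (elim n) then show ?case using j by linarith
  qed
qed

text \<open>The level \<open>c\<close> and the bound \<open>B\<close> pass to the limit unchanged
  because exceedance is an open condition; for each \<open>e\<close> a single large index
  suffices.\<close>

lemma fidi_tail:
  assumes fidi: "fidi_converges M X N Y" and X: "\<And>n. C01_process (M n) (X n)" and Y: "C01_process N Y"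
    and uv: "u \<in> {0..1}" "v \<in> {0..1}"
    and tail: "\<And>n. measure (M n) {\<omega>\<in>space (M n). \<bar>X n \<omega> u - X n \<omega> v\<bar> > c} \<le> B"
  shows "measure N {\<omega>\<in>space N. \<bar>Y \<omega> u - Y \<omega> v\<bar> > c} \<le> B"
proof (rule field_le_epsilon)
  fix e :: real assume e: "0 < e"
  have eq: "incr_exceeds {(u, v)} (\<lambda>_. c) f \<longleftrightarrow> \<bar>f u - f v\<bar> > c" for f
    by (simp add: incr_exceeds_def)
  have "\<forall>\<^sub>F n in sequentially. measure N {\<omega>\<in>space N. \<bar>Y \<omega> u - Y \<omega> v\<bar> > c}
     \<le> measure (M n) {\<omega>\<in>space (M n). \<bar>X n \<omega> u - X n \<omega> v\<bar> > c} + e"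
    using fidi_incr_exceeds_lower[OF fidi X Y _ _ e, of "{(u, v)}" "\<lambda>_. c"] uv unfolding eq by simp
  then obtain n where "measure N {\<omega>\<in>space N. \<bar>Y \<omega> u - Y \<omega> v\<bar> > c}
     \<le> measure (M n) {\<omega>\<in>space (M n). \<bar>X n \<omega> u - X n \<omega> v\<bar> > c} + e"
    by (auto simp: eventually_sequentially)
  then show "measure N {\<omega>\<in>space N. \<bar>Y \<omega> u - Y \<omega> v\<bar> > c} \<le> B + e" using tail[of n] by linarith
qed

section \<open>Sequences of processes with uniform increment tails\<close>

text \<open>The tail assumption is in product form. It passes to the constant sequence of the limit
  process, so the results for \<open>W\<close> can be used for the limit as well.\<close>

locale chained_processes =
  fixes M :: "nat \<Rightarrow> 'a measure" and W :: "nat \<Rightarrow> 'a \<Rightarrow> real \<Rightarrow> real"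
    and \<rho>\<^sub>0 :: "real \<Rightarrow> real" and C :: real
  assumes W: "\<And>n. C01_process (M n) (W n)"
    and \<rho>0_nonneg: "\<And>h. h \<in> {0..1} \<Longrightarrow> 0 \<le> \<rho>\<^sub>0 h"
    and \<rho>0_mono: "mono_on {0..1} \<rho>\<^sub>0" and \<rho>0_zero: "\<rho>\<^sub>0 0 = 0" and C: "0 < C"
    and tail: "\<And>t. C < t \<Longrightarrow> \<exists>\<kappa>>1. \<exists>K>0. \<forall>n. \<forall>u\<in>{0..1}. \<forall>v\<in>{0..1}. u \<noteq> v \<longrightarrow>
      measure (M n) {\<omega>\<in>space (M n). \<bar>W n \<omega> u - W n \<omega> v\<bar> > t * \<rho>\<^sub>0 \<bar>u - v\<bar>} \<le> K * \<bar>u - v\<bar> powr \<kappa>"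
    and growth: "\<exists>p>0. \<exists>K>0. \<forall>h\<in>{0..1}. \<forall>z\<in>{0..1}. \<rho>\<^sub>0 (z * h) \<le> K * z powr p * \<rho>\<^sub>0 h"
begin

lemma small_osc:
  assumes "C < t" "0 < e"
  shows "\<exists>h>0. \<forall>n. measure (M n) {\<omega>\<in>space (M n). \<not> osc_le \<rho>\<^sub>0 (W n \<omega>) t h} \<le> e"
proof -
  \<comment> \<open>The tail bound requires \<open>C < s\<close>, the room for chaining errors
    requires \<open>s < t\<close>; the midpoint satisfies both.\<close>
  define s where "s = (C + t) / 2"
  have s: "C < s" "s < t" "0 \<le> s" using assms(1) C by (auto simp: s_def)
  obtain \<kappa> K' where k: "1 < \<kappa>" "0 < K'" "\<forall>n. \<forall>u\<in>{0..1}. \<forall>v\<in>{0..1}. u \<noteq> v \<longrightarrow>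
      measure (M n) {\<omega>\<in>space (M n). \<bar>W n \<omega> u - W n \<omega> v\<bar> > s * \<rho>\<^sub>0 \<bar>u - v\<bar>} \<le> K' * \<bar>u - v\<bar> powr \<kappa>"
    using tail[OF s(1)] by blast
  obtain p K where p: "0 < p" "0 < K" "\<forall>h\<in>{0..1}. \<forall>z\<in>{0..1}. \<rho>\<^sub>0 (z * h) \<le> K * z powr p * \<rho>\<^sub>0 h"
    using growth by blast
  show ?thesis
  proof (rule prob_not_osc_le_small[OF W \<rho>0_nonneg \<rho>0_mono \<rho>0_zero _ p(1,2) s(3,2) k(1) less_imp_le[OF k(2)] assms(2)])
    show "\<rho>\<^sub>0 (z * h) \<le> K * z powr p * \<rho>\<^sub>0 h" if "h \<in> {0..1}" "z \<in> {0..1}" for h z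
      using p(3) that by blast
    show "measure (M n) {\<omega>\<in>space (M n). \<bar>W n \<omega> u - W n \<omega> v\<bar> > s * \<rho>\<^sub>0 \<bar>u - v\<bar>} \<le> K' * \<bar>u - v\<bar> powr \<kappa>"
      if "u \<in> {0..1}" "v \<in> {0..1}" "u \<noteq> v" for n u v using k(3) that by blast
  qed
qed

text \<open>Both regimes in one: if the quotient tends to infinity every \<open>t > 0\<close>
  qualifies, if it tends to 1 every \<open>t > C\<close> does. A number \<open>r\<close> between
  \<open>C / t\<close> and the limit gives \<open>t * r > C\<close>, and at small distances a bound
  by \<open>t * r * \<rho>\<^sub>0\<close> is one by \<open>t * \<rho>\<close>.\<close>

lemma small_osc_modulus:
  assumes m: "modulus_of_continuity \<rho>"
    and lim: "((\<lambda>h. ereal (\<rho> h) / ereal (\<rho>\<^sub>0 h)) \<longlongrightarrow> l) (at_right 0)"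
    and t: "0 < t" "ereal (C / t) < l" and e: "0 < e"
  shows "\<exists>h>0. h \<le> 1 \<and> (\<forall>n. measure (M n) {\<omega>\<in>space (M n). \<not> osc_le \<rho> (W n \<omega>) t h} \<le> e)"
proof -
  obtain r where r: "C / t < r" "ereal r < l" using ereal_dense2[OF t(2)] by auto
  have z: "\<rho> 0 = 0" and mono: "mono_on {0..1} \<rho>" using m unfolding modulus_of_continuity_def by blast+
  have r0: "0 < r" using r(1) C t(1) by (meson divide_pos_pos less_trans)
  have "C < t * r" using r(1) t(1) by (simp add: field_simps)
  then obtain h where h: "0 < h" "\<And>n. measure (M n) {\<omega>\<in>space (M n). \<not> osc_le \<rho>\<^sub>0 (W n \<omega>) (t * r) h} \<le> e"
    using small_osc[OF _ e] by blast
  obtain \<delta> where \<delta>: "0 < \<delta>" "\<delta> \<le> 1" "\<And>x. 0 < x \<Longrightarrow> x < \<delta> \<Longrightarrow> r * \<rho>\<^sub>0 x \<le> \<rho> x"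
    using ratio_tendsto_scale[OF m \<rho>0_nonneg lim less_imp_le[OF r0] r(2)] by blast
  define h' where "h' = min h (\<delta> / 2)"
  have h': "0 < h'" "h' \<le> h" "h' < \<delta>" "h' \<le> 1" unfolding h'_def using h(1) \<delta>(1,2) by auto
  have imp: "osc_le \<rho> f t h'" if "osc_le \<rho>\<^sub>0 f (t * r) h" for f
  proof (rule osc_le_rescale[where \<rho>=\<rho>\<^sub>0 and \<rho>'=\<rho> and c="t * r" and c'=t and \<delta>=\<delta>, OF _ \<rho>0_zero z h'(3,2) that])
    fix x :: real assume "0 < x" "x < \<delta>"
    from \<delta>(3)[OF this] show "t * r * \<rho>\<^sub>0 x \<le> t * \<rho> x" unfolding mult.assoc by (rule mult_left_mono) (use t in simp)
  qed
  have "measure (M n) {\<omega>\<in>space (M n). \<not> osc_le \<rho> (W n \<omega>) t h'} \<le> e" for n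
  proof -
    interpret prob_space "M n" using W by (simp add: C01_process_def)
    have "0 \<le> t * r" using t r0 by simp
    have "measure (M n) {\<omega>\<in>space (M n). \<not> osc_le \<rho> (W n \<omega>) t h'}
      \<le> measure (M n) {\<omega>\<in>space (M n). \<not> osc_le \<rho>\<^sub>0 (W n \<omega>) (t * r) h}"
      using imp by (intro finite_measure_mono sets_not_osc_le[OF W \<rho>0_mono \<rho>0_zero \<open>0 \<le> t * r\<close>]) blast
    then show ?thesis using h(2)[of n] by linarith
  qed
  then show ?thesis using h' by blast
qed

lemma stochastically_bounded_holder_seminorm:
  assumes m: "modulus_of_continuity \<rho>"
    and lim: "((\<lambda>h. ereal (\<rho> h) / ereal (\<rho>\<^sub>0 h)) \<longlongrightarrow> \<infinity>) (at_right 0)"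
  shows "stochastically_bounded M (\<lambda>n \<omega>. holder_seminorm \<rho> (W n \<omega>))"
  unfolding stochastically_bounded_def
proof (intro conjI allI impI)
  show "(\<lambda>\<omega>. holder_seminorm \<rho> (W n \<omega>)) \<in> borel_measurable (M n)" for n
    by (rule borel_measurable_holder_seminorm[OF W m])
  fix e :: real assume e: "0 < e"
  have z: "\<rho> 0 = 0" and mono: "mono_on {0..1} \<rho>" using m unfolding modulus_of_continuity_def by blast+
  obtain h where h: "0 < h" "\<And>n. measure (M n) {\<omega>\<in>space (M n). \<not> osc_le \<rho> (W n \<omega>) 1 h} \<le> e"
    using small_osc_modulus[OF m lim, of 1] e by auto
  \<comment> \<open>At least \<open>1 / h\<close> pieces: the constant 1 at scale \<open>h\<close>
    becomes the constant \<open>N\<close> at all distances. \<open>N\<close> depends on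
    \<open>e\<close> but not on the index of the process.\<close>
  obtain N where "1 / h < real N" using reals_Archimedean2 by blast
  moreover have "0 < 1 / h" using h(1) by simp
  ultimately have "0 < real N" by linarith
  then have N: "0 < N" "1 \<le> real N * h" using \<open>1 / h < real N\<close> h(1) by (simp_all add: field_simps)
  have "measure (M n) {\<omega>\<in>space (M n). \<bar>holder_seminorm \<rho> (W n \<omega>)\<bar> > ereal (1 * real N)} \<le> e" for n
  proof -
    interpret prob_space "M n" using W by (simp add: C01_process_def)
    have "\<not> osc_le \<rho> f 1 h" if "\<bar>holder_seminorm \<rho> f\<bar> > ereal (1 * real N)" for f
    proof
      assume "osc_le \<rho> f 1 h"
      then have "osc_le \<rho> f (1 * real N) 1" by (rule osc_le_global[OF mono z _ N, rotated]) simp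
      moreover have "0 \<le> 1 * real N" by simp
      ultimately have "\<not> holder_seminorm \<rho> f > ereal (1 * real N)"
        using less_holder_seminorm_iff[where \<rho>=\<rho> and f=f, OF modulus_nonneg[OF m] z] by blast
      moreover have "\<bar>holder_seminorm \<rho> f\<bar> = holder_seminorm \<rho> f"
        using sup_norm_le_holder_norm(1)[OF m] by simp
      ultimately show False using that by simp
    qed
    then have "measure (M n) {\<omega>\<in>space (M n). \<bar>holder_seminorm \<rho> (W n \<omega>)\<bar> > ereal (1 * real N)}
      \<le> measure (M n) {\<omega>\<in>space (M n). \<not> osc_le \<rho> (W n \<omega>) 1 h}"
      by (intro finite_measure_mono sets_not_osc_le[OF W mono z zero_le_one]) blast
    then show ?thesis using h(2)[of n] by linarith
  qed
  then show "\<exists>t::real. \<forall>n. measure (M n) {\<omega>\<in>space (M n). \<bar>holder_seminorm \<rho> (W n \<omega>)\<bar> > ereal t} \<le> e" by blast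
qed

lemma limit_chained_processes:
  assumes fidi: "fidi_converges M W N V" and V: "C01_process N V"
  shows "chained_processes (\<lambda>_. N) (\<lambda>_. V) \<rho>\<^sub>0 C"
proof
  fix t assume "C < t"
  then obtain \<kappa> K where k: "1 < \<kappa>" "0 < K" "\<forall>n. \<forall>u\<in>{0..1}. \<forall>v\<in>{0..1}. u \<noteq> v \<longrightarrow>
      measure (M n) {\<omega>\<in>space (M n). \<bar>W n \<omega> u - W n \<omega> v\<bar> > t * \<rho>\<^sub>0 \<bar>u - v\<bar>} \<le> K * \<bar>u - v\<bar> powr \<kappa>"
    using tail by blast
  have "measure N {\<omega>\<in>space N. \<bar>V \<omega> u - V \<omega> v\<bar> > t * \<rho>\<^sub>0 \<bar>u - v\<bar>} \<le> K * \<bar>u - v\<bar> powr \<kappa>"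
    if "u \<in> {0..1}" "v \<in> {0..1}" "u \<noteq> v" for u v
    using that k(3) by (intro fidi_tail[OF fidi W V]) blast+
  then show "\<exists>\<kappa>>1. \<exists>K>0. \<forall>n::nat. \<forall>u\<in>{0..1}. \<forall>v\<in>{0..1}. u \<noteq> v \<longrightarrow>
      measure N {\<omega>\<in>space N. \<bar>V \<omega> u - V \<omega> v\<bar> > t * \<rho>\<^sub>0 \<bar>u - v\<bar>} \<le> K * \<bar>u - v\<bar> powr \<kappa>"
    using k(1,2) by blast
qed (fact V \<rho>0_nonneg \<rho>0_mono \<rho>0_zero C growth)+

end

section \<open>Thresholded convergence\<close>

definition dyadic_pairs :: "nat \<Rightarrow> (real \<times> real) set" where
  "dyadic_pairs k = (\<lambda>(a, b). (real a / 2 ^ k, real b / 2 ^ k)) ` ({..2 ^ k} \<times> {..2 ^ k})"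

lemma dyadic_pairsI: "a \<le> 2 ^ k \<Longrightarrow> b \<le> 2 ^ k \<Longrightarrow> (real a / 2 ^ k, real b / 2 ^ k) \<in> dyadic_pairs k"
  unfolding dyadic_pairs_def by (rule image_eqI[of _ _ "(a, b)"]) auto

lemma finite_dyadic_pairs: "finite (dyadic_pairs k)"
  unfolding dyadic_pairs_def by (intro finite_imageI finite_cartesian_product) auto

lemma dyadic_pairs_subset: "dyadic_pairs k \<subseteq> {0..1} \<times> {0..1}"
proof
  fix p assume "p \<in> dyadic_pairs k"
  then obtain a b where p: "p = (real a / 2 ^ k, real b / 2 ^ k)" "a \<le> 2 ^ k" "b \<le> 2 ^ k"
    unfolding dyadic_pairs_def by auto
  then show "p \<in> {0..1} \<times> {0..1}" using real_nat_le_power2[of a k] real_nat_le_power2[of b k] by simp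
qed

lemma dyadic_pairs_Suc: "dyadic_pairs k \<subseteq> dyadic_pairs (Suc k)"
proof
  fix p assume "p \<in> dyadic_pairs k"
  then obtain a b where p: "p = (real a / 2 ^ k, real b / 2 ^ k)" "a \<le> 2 ^ k" "b \<le> 2 ^ k"
    unfolding dyadic_pairs_def by auto
  then have "p = (real (2 * a) / 2 ^ Suc k, real (2 * b) / 2 ^ Suc k)" by simp
  then show "p \<in> dyadic_pairs (Suc k)" using p(2,3) by (simp only:) (rule dyadic_pairsI, simp_all)
qed

lemma incr_exceeds_imp_not_osc_le:
  assumes "F \<subseteq> {0..1} \<times> {0..1}" "incr_exceeds F (\<lambda>p. t * \<rho> \<bar>fst p - snd p\<bar>) f"
  shows "\<not> osc_le \<rho> f t 1"
proof
  assume o: "osc_le \<rho> f t 1"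
  obtain u v where uv: "(u, v) \<in> F" "t * \<rho> \<bar>u - v\<bar> < \<bar>f u - f v\<bar>"
    using assms(2) unfolding incr_exceeds_def by auto
  have "u \<in> {0..1}" "v \<in> {0..1}" using assms(1) uv(1) by (auto simp del: atLeastAtMost_iff)
  moreover from this have "\<bar>u - v\<bar> \<le> 1" by auto
  ultimately have "\<bar>f u - f v\<bar> \<le> t * \<rho> \<bar>u - v\<bar>" using o unfolding osc_le_def by blast
  then show False using uv(2) by simp
qed

lemma not_osc_le_iff_dyadic_pairs:
  assumes cont: "continuous_on {0..1} f" and mono: "mono_on {0..1} \<rho>" and z: "\<rho> 0 = 0" and c: "0 \<le> t"
  shows "\<not> osc_le \<rho> f t 1 \<longleftrightarrow> (\<exists>k. incr_exceeds (dyadic_pairs k) (\<lambda>p. t * \<rho> \<bar>fst p - snd p\<bar>) f)"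
proof
  assume "\<not> osc_le \<rho> f t 1"
  then obtain k a b where ab: "a \<le> b" "b \<le> 2 ^ k" "t * \<rho> ((real b - real a) / 2 ^ k) < \<bar>f (a / 2 ^ k) - f (b / 2 ^ k)\<bar>"
    unfolding osc_le_iff_dyadic[OF assms] not_all not_imp not_le by blast
  have "(real a / 2 ^ k, real b / 2 ^ k) \<in> dyadic_pairs k" using ab by (intro dyadic_pairsI) auto
  moreover have "\<bar>real a / 2 ^ k - real b / 2 ^ k\<bar> = (real b - real a) / 2 ^ k"
    using ab(1) by (simp add: abs_if field_simps)
  ultimately show "\<exists>k. incr_exceeds (dyadic_pairs k) (\<lambda>p. t * \<rho> \<bar>fst p - snd p\<bar>) f"
    unfolding incr_exceeds_def using ab(3) by (intro exI[of _ k] bexI) (auto simp only: fst_conv snd_conv)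
qed (use incr_exceeds_imp_not_osc_le[OF dyadic_pairs_subset] in blast)

text \<open>Lower semicontinuity of the seminorm: exceedance at some pair is the increasing union of
  exceedances on dyadic grids, and continuity from below reduces it to one finite grid. Tail bounds
  and continuity points enter only in the opposite estimate.\<close>

lemma fidi_not_osc_le_lower:
  assumes fidi: "fidi_converges M X N Y" and X: "\<And>n. C01_process (M n) (X n)" and Y: "C01_process N Y"
    and mono: "mono_on {0..1} \<rho>" and z: "\<rho> 0 = 0" and t: "0 \<le> t" and e: "0 < e"
  shows "\<forall>\<^sub>F n in sequentially. measure N {\<omega>\<in>space N. \<not> osc_le \<rho> (Y \<omega>) t 1}
      \<le> measure (M n) {\<omega>\<in>space (M n). \<not> osc_le \<rho> (X n \<omega>) t 1} + e"
proof -
  interpret prob_space N using Y by (simp add: C01_process_def)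
  let ?a = "\<lambda>p. t * \<rho> \<bar>fst p - snd p\<bar>"
  define A where "A k = {\<omega>\<in>space N. incr_exceeds (dyadic_pairs k) ?a (Y \<omega>)}" for k
  have "incseq A"
    by (rule incseq_SucI) (use dyadic_pairs_Suc in \<open>unfold A_def incr_exceeds_def, blast\<close>)
  moreover have "A k \<in> sets N" for k
    unfolding A_def by (rule sets_incr_exceeds[OF Y finite_dyadic_pairs dyadic_pairs_subset])
  ultimately have "(\<lambda>k. measure N (A k)) \<longlonglongrightarrow> measure N (\<Union>k. A k)"
    by (intro finite_Lim_measure_incseq) auto
  moreover have "(\<Union>k. A k) = {\<omega>\<in>space N. \<not> osc_le \<rho> (Y \<omega>) t 1}"
  proof -
    have "\<not> osc_le \<rho> (Y \<omega>) t 1 \<longleftrightarrow> (\<exists>k. incr_exceeds (dyadic_pairs k) ?a (Y \<omega>))" if "\<omega> \<in> space N" for \<omega>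
      using Y that by (intro not_osc_le_iff_dyadic_pairs mono z t) (simp add: C01_process_def)
    then show ?thesis unfolding A_def by blast
  qed
  ultimately have "\<forall>\<^sub>F k in sequentially. measure N {\<omega>\<in>space N. \<not> osc_le \<rho> (Y \<omega>) t 1} - e / 2 < measure N (A k)"
    using e by (intro order_tendstoD(1)) auto
  then obtain k where k: "measure N {\<omega>\<in>space N. \<not> osc_le \<rho> (Y \<omega>) t 1} - e / 2 < measure N (A k)"
    by (auto simp: eventually_sequentially)
  have "\<forall>\<^sub>F n in sequentially. measure N (A k) \<le> measure (M n) {\<omega>\<in>space (M n). incr_exceeds (dyadic_pairs k) ?a (X n \<omega>)} + e / 2"
    unfolding A_def by (rule fidi_incr_exceeds_lower[OF fidi X Y finite_dyadic_pairs dyadic_pairs_subset]) (use e in simp)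
  then show ?thesis
  proof eventually_elim
    case (elim n)
    interpret Mn: prob_space "M n" using X by (simp add: C01_process_def)
    have "measure (M n) {\<omega>\<in>space (M n). incr_exceeds (dyadic_pairs k) ?a (X n \<omega>)}
      \<le> measure (M n) {\<omega>\<in>space (M n). \<not> osc_le \<rho> (X n \<omega>) t 1}"
      using incr_exceeds_imp_not_osc_le[OF dyadic_pairs_subset]
      by (intro Mn.finite_measure_mono sets_not_osc_le[OF X mono z t]) blast
    then show ?case using elim k by linarith
  qed
qed

text \<open>Increments exceeding \<open>t\<close> only at distances above \<open>h\<close> are visible on a finite dyadic grid,
  after lowering the threshold to \<open>t'\<close>.\<close>

lemma ex_dyadic_pairs_exceeding:
  assumes m: "modulus_of_continuity \<rho>" and t: "0 < t'" "t' < t" and h: "0 < h" "h \<le> 1"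
  shows "\<exists>k. \<forall>f. osc_le \<rho> f t h \<longrightarrow> \<not> osc_le \<rho> f t 1 \<longrightarrow>
    incr_exceeds {p \<in> dyadic_pairs k. h / 2 \<le> \<bar>fst p - snd p\<bar>} (\<lambda>p. t' * \<rho> \<bar>fst p - snd p\<bar>) f"
proof -
  have z: "\<rho> 0 = 0" and mono: "mono_on {0..1} \<rho>" and cont: "continuous_on {0..1} \<rho>"
    using m unfolding modulus_of_continuity_def by blast+
  have r: "0 < \<rho> (h / 2)" using m h unfolding modulus_of_continuity_def by simp
  \<comment> \<open>Half of the gap between the levels \<open>t\<close> and \<open>t'\<close> at
    distance \<open>h / 2\<close>. Moving one end of a pair to the grid costs at most \<eta>, so
    moving both uses up the gap.\<close>
  define \<eta> where "\<eta> = (t - t') * \<rho> (h / 2) / 2"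
  have \<eta>: "0 < \<eta>" unfolding \<eta>_def using t r by simp
  have "(\<lambda>k. \<rho> (1 / 2 ^ k)) \<longlonglongrightarrow> \<rho> 0"
    by (rule continuous_on_tendsto_compose[OF cont inverse_power2_LIMSEQ]) (auto simp: field_simps)
  then have "(\<lambda>k. t * \<rho> (1 / 2 ^ k)) \<longlonglongrightarrow> t * 0" unfolding z by (intro tendsto_intros)
  then have "\<forall>\<^sub>F k in sequentially. t * \<rho> (1 / 2 ^ k) < \<eta>" using \<eta> by (intro order_tendstoD) auto
  \<comment> \<open>Moving both ends inward by less than \<open>h / 4\<close> leaves more than
    \<open>h / 2\<close> of a distance above \<open>h\<close>.\<close>
  moreover have "\<forall>\<^sub>F k in sequentially. 1 / 2 ^ k < h / 4" using h by (intro order_tendstoD(2)[OF inverse_power2_LIMSEQ]) simp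
  ultimately have "\<forall>\<^sub>F k in sequentially. t * \<rho> (1 / 2 ^ k) < \<eta> \<and> 1 / 2 ^ k < h / 4" by (rule eventually_conj)
  then obtain k where k: "t * \<rho> (1 / 2 ^ k) < \<eta>" "1 / 2 ^ k < h / 4" by (auto simp: eventually_sequentially)
  have "incr_exceeds {p \<in> dyadic_pairs k. h / 2 \<le> \<bar>fst p - snd p\<bar>} (\<lambda>p. t' * \<rho> \<bar>fst p - snd p\<bar>) f"
    if o: "osc_le \<rho> f t h" and no: "\<not> osc_le \<rho> f t 1" for f
  proof -
    have near: "\<bar>f x - f y\<bar> \<le> \<eta>" if "x \<in> {0..1}" "y \<in> {0..1}" "\<bar>x - y\<bar> \<le> 1 / 2 ^ k" for x y
    proof -
      have "\<bar>x - y\<bar> \<le> h" using that(3) k(2) h(1) by linarith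
      then have "\<bar>f x - f y\<bar> \<le> t * \<rho> \<bar>x - y\<bar>" using o that(1,2) unfolding osc_le_def by blast
      also have "\<dots> \<le> t * \<rho> (1 / 2 ^ k)"
        using that h t k(2) by (intro mult_left_mono mono_onD[OF mono]) auto
      finally show ?thesis using k(1) by linarith
    qed
    have "\<exists>u v. 0 \<le> u \<and> u < v \<and> v \<le> 1 \<and> v - u \<le> 1 \<and> \<not> \<bar>f u - f v\<bar> \<le> t * \<rho> (v - u)"
      using osc_leI[of \<rho> 1 f t, OF z] no by blast
    then obtain u v where uv: "0 \<le> u" "u < v" "v \<le> 1" "t * \<rho> (v - u) < \<bar>f u - f v\<bar>"
      unfolding not_le by blast
    have far: "h < v - u"
    proof (rule ccontr)
      assume "\<not> h < v - u"
      then have "\<bar>u - v\<bar> \<le> h" using uv by simp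
      moreover have "u \<in> {0..1}" "v \<in> {0..1}" using uv by auto
      ultimately have "\<bar>f u - f v\<bar> \<le> t * \<rho> \<bar>u - v\<bar>" using o unfolding osc_le_def by blast
      then show False using uv by simp
    qed
    define a where "a = dyadic_ceil u k"
    define b where "b = dyadic_floor v k"
    let ?x = "real a / 2 ^ k" and ?y = "real b / 2 ^ k"
    have a: "u \<le> ?x" "?x < u + 1 / 2 ^ k" "a \<le> 2 ^ k" and b: "?y \<le> v" "v - 1 / 2 ^ k < ?y" "b \<le> 2 ^ k"
      using dyadic_ceil_bounds[of u k] dyadic_floor_bounds[of v k] uv unfolding a_def b_def by auto
    have far': "h / 2 \<le> ?y - ?x" using a b far k(2) by linarith
    then have d: "\<bar>?x - ?y\<bar> = ?y - ?x" using h(1) by simp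
    have xy01: "?x \<in> {0..1}" "?y \<in> {0..1}" "?y - ?x \<in> {0..1}" "v - u \<in> {0..1}" "h / 2 \<in> {0..1}"
      using a(1) b(1) uv h far' unfolding atLeastAtMost_iff by linarith+
    have "\<bar>f u - f ?x\<bar> \<le> \<eta>" "\<bar>f v - f ?y\<bar> \<le> \<eta>"
      using a b uv xy01(1,2) by (auto intro!: near simp del: atLeastAtMost_iff) auto
    then have "t * \<rho> (v - u) - 2 * \<eta> < \<bar>f ?x - f ?y\<bar>" using uv(4) by linarith
    moreover have "t * \<rho> (?y - ?x) \<le> t * \<rho> (v - u)"
      using t a b by (intro mult_left_mono mono_onD[OF mono] xy01) linarith+
    moreover have "(t - t') * \<rho> (h / 2) \<le> (t - t') * \<rho> (?y - ?x)"
      using t far' by (intro mult_left_mono mono_onD[OF mono] xy01) linarith+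
    moreover have "2 * \<eta> = (t - t') * \<rho> (h / 2)" unfolding \<eta>_def by simp
    ultimately have "t' * \<rho> (?y - ?x) < \<bar>f ?x - f ?y\<bar>" unfolding left_diff_distrib by linarith
    then show ?thesis unfolding incr_exceeds_def
      using dyadic_pairsI[OF a(3) b(3)] far' d by (intro bexI[of _ "(?x, ?y)"]) auto
  qed
  then show ?thesis by blast
qed

context chained_processes
begin

text \<open>For the upper estimate, \<open>W n\<close> exceeds \<open>t\<close> either at a distance
  up to \<open>h\<close>, which is improbable because \<open>t > C\<close>, or on a finite grid at a
  slightly lower level, which passes to the limit. Continuity of the distribution function at
  \<open>t\<close> pays for the lowering.\<close>

lemma thresholded_holder_seminorm:
  assumes V: "C01_process N V" and fidi: "fidi_converges M W N V" and m: "modulus_of_continuity \<rho>"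
    and lim: "((\<lambda>h. ereal (\<rho> h) / ereal (\<rho>\<^sub>0 h)) \<longlongrightarrow> 1) (at_right 0)"
  shows "thresholded_weakly_converges C M (\<lambda>n \<omega>. holder_seminorm \<rho> (W n \<omega>))
               N (\<lambda>\<omega>. holder_seminorm \<rho> (V \<omega>))"
  unfolding thresholded_weakly_converges_def
proof (intro conjI allI impI)
  show "(\<lambda>\<omega>. holder_seminorm \<rho> (W n \<omega>)) \<in> borel_measurable (M n)" for n
    by (rule borel_measurable_holder_seminorm[OF W m])
  show Vm: "(\<lambda>\<omega>. holder_seminorm \<rho> (V \<omega>)) \<in> borel_measurable N"
    by (rule borel_measurable_holder_seminorm[OF V m])
  fix t assume t: "C < t" and cont: "isCont (\<lambda>s. measure N {\<omega>\<in>space N. holder_seminorm \<rho> (V \<omega>) \<le> ereal s}) t"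
  interpret N: prob_space N using V by (simp add: C01_process_def)
  have z: "\<rho> 0 = 0" and mono: "mono_on {0..1} \<rho>" using m unfolding modulus_of_continuity_def by blast+
  have t0: "0 < t" using t C by linarith
  define P where "P n = measure (M n) {\<omega>\<in>space (M n). \<not> osc_le \<rho> (W n \<omega>) t 1}" for n
  define G where "G s = measure N {\<omega>\<in>space N. \<not> osc_le \<rho> (V \<omega>) s 1}" for s
  have iff: "ereal s < holder_seminorm \<rho> f \<longleftrightarrow> \<not> osc_le \<rho> f s 1" if "0 \<le> s" for s f
    by (rule less_holder_seminorm_iff[where \<rho>=\<rho>, OF modulus_nonneg[OF m] z that])
  have G: "measure N {\<omega>\<in>space N. holder_seminorm \<rho> (V \<omega>) \<le> ereal s} = 1 - G s" if "0 \<le> s" for s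
  proof -
    have "{\<omega>\<in>space N. holder_seminorm \<rho> (V \<omega>) \<le> ereal s} = {\<omega>\<in>space N. \<not> (\<not> osc_le \<rho> (V \<omega>) s 1)}"
      unfolding iff[OF that, symmetric] not_less ..
    then show ?thesis unfolding G_def using N.prob_neg[OF sets_not_osc_le[OF V mono z that]] by simp
  qed
  have "P \<longlonglongrightarrow> G t"
  proof (rule tendstoI)
    fix e :: real assume "0 < e"
    define \<epsilon> where "\<epsilon> = e / 4"
    have \<epsilon>: "0 < \<epsilon>" using \<open>0 < e\<close> by (simp add: \<epsilon>_def)
    have "\<forall>\<^sub>F n in sequentially. G t \<le> P n + \<epsilon>"
      unfolding G_def P_def by (rule fidi_not_osc_le_lower[OF fidi W V mono z less_imp_le[OF t0] \<epsilon>])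
    \<comment> \<open>One \<epsilon> each for the small distances, for the passage to the limit and
      for the return from level \<open>t2\<close> to \<open>t\<close>.\<close>
    moreover have "\<forall>\<^sub>F n in sequentially. P n \<le> G t + 3 * \<epsilon>"
    proof -
      obtain d where d: "0 < d" "\<And>s. \<bar>s - t\<bar> < d \<Longrightarrow>
          \<bar>measure N {\<omega>\<in>space N. holder_seminorm \<rho> (V \<omega>) \<le> ereal s} - measure N {\<omega>\<in>space N. holder_seminorm \<rho> (V \<omega>) \<le> ereal t}\<bar> < \<epsilon>"
        using cont \<epsilon> unfolding continuous_at_eps_delta dist_real_def by blast
      \<comment> \<open>Two lowerings of the level are ahead: from \<open>t\<close> to
        \<open>t1\<close> when the grid replaces arbitrary pairs, and from \<open>t1\<close> to
        \<open>t2\<close> for the continuous cut-off. \<open>t2\<close> lies within \<open>d\<close>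
        of \<open>t\<close>, where the distribution function varies by less than \<epsilon>.\<close>
      define t2 where "t2 = max ((C + t) / 2) (t - d / 2)"
      define t1 where "t1 = (t2 + t) / 2"
      have t2: "C < t2" "t2 < t" "0 < t2" "\<bar>t2 - t\<bar> < d" unfolding t2_def using t d(1) C by (auto simp: max_def field_simps)
      have t1: "0 < t1" "t1 < t" "t2 < t1" unfolding t1_def using t2 by auto
      have Gt2: "G t2 \<le> G t + \<epsilon>" using d(2)[OF t2(4)] G[of t2] G[of t] t2 t0 by simp
      have "ereal (C / t) < 1" using t t0 by simp
      then obtain h where h: "0 < h" "h \<le> 1" "\<And>n. measure (M n) {\<omega>\<in>space (M n). \<not> osc_le \<rho> (W n \<omega>) t h} \<le> \<epsilon>"
        using small_osc_modulus[OF m lim t0 _ \<epsilon>] by blast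
      obtain k where k: "\<And>f. osc_le \<rho> f t h \<Longrightarrow> \<not> osc_le \<rho> f t 1 \<Longrightarrow>
          incr_exceeds {p \<in> dyadic_pairs k. h / 2 \<le> \<bar>fst p - snd p\<bar>} (\<lambda>p. t1 * \<rho> \<bar>fst p - snd p\<bar>) f"
        using ex_dyadic_pairs_exceeding[OF m t1(1,2) h(1,2)] by blast
      define F where "F = {p \<in> dyadic_pairs k. h / 2 \<le> \<bar>fst p - snd p\<bar>}"
      have F: "finite F" "F \<subseteq> {0..1} \<times> {0..1}"
        unfolding F_def using finite_dyadic_pairs dyadic_pairs_subset by (auto simp del: atLeastAtMost_iff)
      \<comment> \<open>Here it matters that the grid pairs have distance at least
        \<open>h / 2\<close>: \<rho> is positive there, so the two levels are strictly
        separated.\<close>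
      have less: "t2 * \<rho> \<bar>fst p - snd p\<bar> < t1 * \<rho> \<bar>fst p - snd p\<bar>" if p: "p \<in> F" for p
      proof -
        have "fst p \<in> {0..1}" "snd p \<in> {0..1}" using F(2) p by (auto simp del: atLeastAtMost_iff)
        moreover have "h / 2 \<le> \<bar>fst p - snd p\<bar>" using p unfolding F_def by blast
        ultimately have "\<bar>fst p - snd p\<bar> \<in> {0<..1}" using h(1) by auto
        then have "0 < \<rho> \<bar>fst p - snd p\<bar>" using m unfolding modulus_of_continuity_def by blast
        then show ?thesis using t1(3) by (rule mult_strict_right_mono[rotated])
      qed
      have "\<forall>\<^sub>F n in sequentially. measure (M n) {\<omega>\<in>space (M n). incr_exceeds F (\<lambda>p. t1 * \<rho> \<bar>fst p - snd p\<bar>) (W n \<omega>)}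
          \<le> measure N {\<omega>\<in>space N. incr_exceeds F (\<lambda>p. t2 * \<rho> \<bar>fst p - snd p\<bar>) (V \<omega>)} + \<epsilon>"
        by (rule fidi_incr_exceeds(1)[OF fidi W V F less \<epsilon>])
      then show ?thesis
      proof eventually_elim
        case (elim n)
        interpret Mn: prob_space "M n" using W by (simp add: C01_process_def)
        let ?A = "{\<omega>\<in>space (M n). \<not> osc_le \<rho> (W n \<omega>) t h}"
        let ?B = "{\<omega>\<in>space (M n). incr_exceeds F (\<lambda>p. t1 * \<rho> \<bar>fst p - snd p\<bar>) (W n \<omega>)}"
        have AB: "?A \<in> sets (M n)" "?B \<in> sets (M n)"
          using sets_not_osc_le[OF W mono z less_imp_le[OF t0]] sets_incr_exceeds[OF W F] by blast+
        have "P n \<le> measure (M n) (?A \<union> ?B)" unfolding P_def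
          using k unfolding F_def[symmetric] by (intro Mn.finite_measure_mono sets.Un AB) blast
        also have "\<dots> \<le> measure (M n) ?A + measure (M n) ?B" by (rule measure_Un_le[OF AB])
        finally have "P n \<le> \<epsilon> + measure (M n) ?B" using h(3)[of n] by linarith
        moreover have "measure N {\<omega>\<in>space N. incr_exceeds F (\<lambda>p. t2 * \<rho> \<bar>fst p - snd p\<bar>) (V \<omega>)} \<le> G t2"
          unfolding G_def using incr_exceeds_imp_not_osc_le[OF F(2)]
          by (intro N.finite_measure_mono sets_not_osc_le[OF V mono z less_imp_le[OF t2(3)]]) blast
        ultimately show ?case using elim Gt2 by linarith
      qed
    qed
    ultimately show "\<forall>\<^sub>F n in sequentially. dist (P n) (G t) < e"
    proof eventually_elim
      case (elim n)
      then show ?case using \<epsilon> unfolding \<epsilon>_def dist_real_def by linarith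
    qed
  qed
  then show "(\<lambda>n. measure (M n) {\<omega>\<in>space (M n). holder_seminorm \<rho> (W n \<omega>) > ereal t})
          \<longlonglongrightarrow> measure N {\<omega>\<in>space N. holder_seminorm \<rho> (V \<omega>) > ereal t}"
    unfolding P_def G_def iff[OF less_imp_le[OF t0]] .
qed

end

section \<open>The space of little Hoelder functions\<close>

lemma osc_le_restrict [simp]: "osc_le \<rho> (restrict f {0..1}) c h \<longleftrightarrow> osc_le \<rho> f c h"
  unfolding osc_le_def by simp

lemma ex_inverse_Suc_le:
  fixes x :: real
  assumes "0 < x"
  shows "\<exists>k. 1 / real (Suc k) \<le> x"
  using reals_Archimedean[OF assms] unfolding inverse_eq_divide by (blast intro: less_imp_le)

text \<open>The limit becomes a countable family of increment bounds, from which measurability can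
  be read off. In the converse direction finiteness of the norm is automatic: \<open>f\<close> is
  bounded by compactness, and a bound at one small scale extends to all distances.\<close>

lemma C0_rho_iff:
  assumes m: "modulus_of_continuity \<rho>" and f: "f \<in> extensional {0..1}" "continuous_on {0..1} f"
  shows "f \<in> C0_rho \<rho> \<longleftrightarrow> (\<forall>j. \<exists>k. osc_le \<rho> f (1 / real (Suc j)) (1 / real (Suc k)))"
proof -
  have z: "\<rho> 0 = 0" and mono: "mono_on {0..1} \<rho>" using m unfolding modulus_of_continuity_def by blast+
  define g where "g = (\<lambda>\<delta>. SUP (u, v)\<in>{(u, v). u \<in> {0..1} \<and> v \<in> {0..1} \<and> 0 < \<bar>u - v\<bar> \<and> \<bar>u - v\<bar> < \<delta>}. incr_ratio \<rho> f u v)"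
  show ?thesis
  proof
    assume "f \<in> C0_rho \<rho>"
    then have lim: "(g \<longlongrightarrow> 0) (at_right 0)" unfolding C0_rho_def g_def by simp
    show "\<forall>j. \<exists>k. osc_le \<rho> f (1 / real (Suc j)) (1 / real (Suc k))"
    proof
      fix j
      define c where "c = 1 / real (Suc j)"
      have c: "0 < c" by (simp add: c_def)
      then have "\<forall>\<^sub>F \<delta> in at_right 0. g \<delta> < ereal c" by (intro order_tendstoD[OF lim]) simp
      then obtain b where b: "0 < b" "\<And>\<delta>. 0 < \<delta> \<Longrightarrow> \<delta> < b \<Longrightarrow> g \<delta> < ereal c"
        unfolding eventually_at_right_field by blast
      \<comment> \<open>Pairs in \<open>g\<close> have distance strictly below its argument, pairs
        in \<open>osc_le\<close> may attain the scale; \<open>b / 4\<close> against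
        \<open>b / 2\<close> leaves room for this.\<close>
      obtain k where k: "1 / real (Suc k) \<le> b / 4" using ex_inverse_Suc_le[of "b / 4"] b(1) by auto
      have gb: "g (b / 2) < ereal c" using b by simp
      have "osc_le \<rho> f c (1 / real (Suc k))"
        unfolding osc_le_def
      proof (intro ballI impI)
        fix u v :: real assume uv: "u \<in> {0..1}" "v \<in> {0..1}" "\<bar>u - v\<bar> \<le> 1 / real (Suc k)"
        show "\<bar>f u - f v\<bar> \<le> c * \<rho> \<bar>u - v\<bar>"
        proof (cases "u = v")
          case False
          then have "0 < \<bar>u - v\<bar>" "\<bar>u - v\<bar> < b / 2" using uv(3) k b(1) by linarith+
          then have "incr_ratio \<rho> f u v \<le> g (b / 2)"
            unfolding g_def using uv(1,2) by (intro SUP_upper2[of "(u, v)"]) simp_all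
          then have "incr_ratio \<rho> f u v < ereal c" using gb by (rule le_less_trans)
          moreover have "0 \<le> \<rho> \<bar>u - v\<bar>" using incr_ratio_modulus(1)[OF m uv(1,2) False] by simp
          ultimately show ?thesis using incr_ratio_gt_iff[of c \<rho> u v f] c by (metis less_imp_le not_le order_less_asym)
        qed (simp add: z)
      qed
      then show "\<exists>k. osc_le \<rho> f (1 / real (Suc j)) (1 / real (Suc k))" unfolding c_def by blast
    qed
  next
    assume osc: "\<forall>j. \<exists>k. osc_le \<rho> f (1 / real (Suc j)) (1 / real (Suc k))"
    have "holder_norm \<rho> f < \<infinity>"
    proof -
      obtain B where "\<forall>y\<in>f ` {0..1}. norm y \<le> B"
        using compact_imp_bounded[OF compact_continuous_image[OF f(2) compact_Icc]]
        unfolding bounded_iff by blast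
      then have B: "\<And>u. u \<in> {0..1} \<Longrightarrow> \<bar>f u\<bar> \<le> B" by simp
      have "(SUP u\<in>{0..1}. ereal \<bar>f u\<bar>) \<le> ereal B"
        by (rule SUP_least) (use B in simp)
      then have 1: "(SUP u\<in>{0..1}. ereal \<bar>f u\<bar>) < \<infinity>" by (rule le_less_trans) simp
      obtain k where "osc_le \<rho> f (1 / real (Suc 0)) (1 / real (Suc k))" using osc by blast
      then have "osc_le \<rho> f (1 / real (Suc 0) * real (Suc k)) 1"
        by (rule osc_le_global[OF mono z, rotated 3]) auto
      moreover have "0 \<le> 1 / real (Suc 0) * real (Suc k)" by simp
      ultimately have "\<not> ereal (1 / real (Suc 0) * real (Suc k)) < holder_seminorm \<rho> f"
        using less_holder_seminorm_iff[where \<rho>=\<rho> and f=f, OF modulus_nonneg[OF m] z] by blast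
      then have 2: "holder_seminorm \<rho> f < \<infinity>" by (auto simp: not_less intro: le_less_trans)
      show ?thesis unfolding holder_norm_def using 1 2 by simp
    qed
    then have "f \<in> C_rho \<rho>" unfolding C_rho_def using f by blast
    moreover have "(g \<longlongrightarrow> 0) (at_right 0)"
    proof (rule order_tendstoI)
      fix a :: ereal assume a: "a < 0"
      \<comment> \<open>An empty supremum would be minus infinity. The pair of \<open>0\<close> and
        \<open>\<delta> / 2\<close> shows that \<open>g \<delta>\<close> is non-negative.\<close>
      have "a < g \<delta>" if \<delta>: "0 < \<delta>" "\<delta> < 1" for \<delta>
      proof -
        have "0 \<le> incr_ratio \<rho> f 0 (\<delta> / 2)"
          using incr_ratio_modulus[OF m, of 0 "\<delta> / 2"] \<delta> by simp
        also have "\<dots> \<le> g \<delta>" unfolding g_def using \<delta> by (intro SUP_upper2[of "(0, \<delta> / 2)"]) auto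
        finally show ?thesis using a by (rule less_le_trans[rotated])
      qed
      then show "\<forall>\<^sub>F \<delta> in at_right 0. a < g \<delta>"
        unfolding eventually_at_right_field by (intro exI[of _ 1]) simp
    next
      fix a :: ereal assume a: "0 < a"
      then obtain r where r: "0 < ereal r" "ereal r < a" using ereal_dense2 by blast
      obtain j where j: "1 / real (Suc j) \<le> r" using ex_inverse_Suc_le[of r] r(1) by auto
      obtain k where k: "osc_le \<rho> f (1 / real (Suc j)) (1 / real (Suc k))" using osc by blast
      have "g \<delta> < a" if \<delta>: "0 < \<delta>" "\<delta> < 1 / real (Suc k)" for \<delta>
      proof -
        have "g \<delta> \<le> ereal (1 / real (Suc j))"
          unfolding g_def
        proof (rule SUP_least, clarify)
          fix u v :: real assume uv: "u \<in> {0..1}" "v \<in> {0..1}" "0 < \<bar>u - v\<bar>" "\<bar>u - v\<bar> < \<delta>"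
          have ne: "u \<noteq> v" using uv(3) by auto
          have "\<bar>u - v\<bar> \<le> 1 / real (Suc k)" using uv(4) \<delta>(2) by linarith
          then have "\<bar>f u - f v\<bar> \<le> 1 / real (Suc j) * \<rho> \<bar>u - v\<bar>"
            using k uv(1,2) unfolding osc_le_def by blast
          moreover have "0 \<le> \<rho> \<bar>u - v\<bar>" using incr_ratio_modulus(1)[OF m uv(1,2) ne] by simp
          moreover have "0 \<le> 1 / real (Suc j)" by simp
          ultimately show "incr_ratio \<rho> f u v \<le> ereal (1 / real (Suc j))"
            using incr_ratio_gt_iff[of "1 / real (Suc j)" \<rho> u v f] by (simp only: not_less[symmetric] simp_thms)
        qed
        also have "\<dots> \<le> ereal r" using j by simp
        finally show ?thesis using r(2) by (rule le_less_trans)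
      qed
      moreover have "0 < 1 / real (Suc k)" by simp
      ultimately show "\<forall>\<^sub>F \<delta> in at_right 0. g \<delta> < a"
        unfolding eventually_at_right_field by blast
    qed
    ultimately show "f \<in> C0_rho \<rho>" unfolding C0_rho_def g_def by simp
  qed
qed

lemma restrict_in_C0_rho_iff:
  assumes "modulus_of_continuity \<rho>" "continuous_on {0..1} f"
  shows "restrict f {0..1} \<in> C0_rho \<rho> \<longleftrightarrow> (\<forall>j. \<exists>k. osc_le \<rho> f (1 / real (Suc j)) (1 / real (Suc k)))"
proof -
  have "continuous_on {0..1} (restrict f {0..1})"
    using assms(2) by (rule continuous_on_eq) simp
  then show ?thesis using C0_rho_iff[OF assms(1), of "restrict f {0..1}"] by simp
qed

text \<open>On functions with uniformly small increments at scale \<open>1 / k\<close>, the distance is controlled by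
  finitely many values. This replaces both the separability of the space and the tightness
  criterion.\<close>

lemma holder_norm_grid_bound:
  assumes m: "modulus_of_continuity \<rho>" and k: "0 < k" and \<epsilon>: "0 \<le> \<epsilon>"
    and f: "osc_le \<rho> f \<epsilon> (1 / real k)" and g: "osc_le \<rho> g \<epsilon> (1 / real k)"
    and D: "\<And>i. i \<le> k \<Longrightarrow> \<bar>f (real i / k) - g (real i / k)\<bar> \<le> D"
  shows "holder_norm \<rho> (\<lambda>u. f u - g u) \<le> ereal (D * (1 + 2 / \<rho> (1 / k)) + \<epsilon> * (4 + 2 * \<rho> 1))"
proof -
  have z: "\<rho> 0 = 0" and mono: "mono_on {0..1} \<rho>" using m unfolding modulus_of_continuity_def by blast+
  have k01: "1 / real k \<in> {0<..1}" using k by simp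
  have r: "0 < \<rho> (1 / k)" using m k01 unfolding modulus_of_continuity_def by blast
  have r1: "\<rho> (1 / k) \<le> \<rho> 1" using k01 by (intro mono_onD[OF mono]) auto
  have D0: "0 \<le> D" using D[of 0] by linarith
  \<comment> \<open>Bound for the supremum norm: the deviation at the nearest grid point on the
    left, plus one increment of \<open>f\<close> and one of \<open>g\<close> over a distance of at
    most \<open>1 / k\<close>.\<close>
  define S where "S = D + 2 * (\<epsilon> * \<rho> (1 / k))"
  have S: "\<bar>f u - g u\<bar> \<le> S" if u: "u \<in> {0..1}" for u
  proof -
    define i where "i = nat \<lfloor>real k * u\<rfloor>"
    have i: "real i = of_int \<lfloor>real k * u\<rfloor>" unfolding i_def using u by simp
    have "real i \<le> real k * u" "real k * u < real i + 1"
      unfolding i using floor_correct[of "real k * u"] by linarith+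
    moreover have "real k * u \<le> real k * 1" using u by (intro mult_left_mono) auto
    ultimately have b: "real i / k \<le> u" "u \<le> real i / k + 1 / k" and "real i \<le> real k * 1"
      using k by (simp_all add: field_simps, linarith)
    then have b3: "real i \<le> real k" by simp
    then have ik: "i \<le> k" by simp
    have i01: "real i / k \<in> {0..1}" using b3 k by simp
    have d: "\<bar>u - real i / k\<bar> \<le> 1 / k" using b by linarith
    have e: "\<epsilon> * \<rho> \<bar>u - real i / k\<bar> \<le> \<epsilon> * \<rho> (1 / k)"
    proof (intro mult_left_mono mono_onD[OF mono] d \<epsilon>)
      show "\<bar>u - real i / k\<bar> \<in> {0..1}" using d k01 unfolding atLeastAtMost_iff greaterThanAtMost_iff by linarith
      show "1 / real k \<in> {0..1}" using k01 by simp
    qed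
    have "\<bar>f u - f (real i / k)\<bar> \<le> \<epsilon> * \<rho> \<bar>u - real i / k\<bar>" using f u i01 d unfolding osc_le_def by blast
    moreover have "\<bar>g u - g (real i / k)\<bar> \<le> \<epsilon> * \<rho> \<bar>u - real i / k\<bar>" using g u i01 d unfolding osc_le_def by blast
    ultimately show ?thesis using D[OF ik] e unfolding S_def by linarith
  qed
  \<comment> \<open>Solves \<open>t * \<rho> (1 / k) = 2 * S\<close>: pairs farther apart than
    \<open>1 / k\<close> are controlled by the supremum norm, nearer ones by
    \<open>2 * \<epsilon> \<le> t\<close>.\<close>
  define t where "t = 4 * \<epsilon> + 2 * D / \<rho> (1 / k)"
  have t0: "0 \<le> t" unfolding t_def using \<epsilon> D0 r by simp
  have "osc_le \<rho> (\<lambda>u. f u - g u) t 1"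
    unfolding osc_le_def
  proof (intro ballI impI)
    fix u v :: real assume uv: "u \<in> {0..1}" "v \<in> {0..1}" "\<bar>u - v\<bar> \<le> 1"
    have \<rho>uv: "0 \<le> \<rho> \<bar>u - v\<bar>" by (rule modulus_nonneg[OF m]) (use uv(3) in simp)
    show "\<bar>(f u - g u) - (f v - g v)\<bar> \<le> t * \<rho> \<bar>u - v\<bar>"
    proof (cases "\<bar>u - v\<bar> \<le> 1 / k")
      case True
      have "\<bar>f u - f v\<bar> \<le> \<epsilon> * \<rho> \<bar>u - v\<bar>" "\<bar>g u - g v\<bar> \<le> \<epsilon> * \<rho> \<bar>u - v\<bar>"
        using f g uv(1,2) True unfolding osc_le_def by blast+
      then have "\<bar>(f u - g u) - (f v - g v)\<bar> \<le> 2 * \<epsilon> * \<rho> \<bar>u - v\<bar>" by linarith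
      also have "\<dots> \<le> t * \<rho> \<bar>u - v\<bar>"
      proof (rule mult_right_mono[OF _ \<rho>uv])
        have "0 \<le> 2 * D / \<rho> (1 / k)" using D0 r by simp
        then show "2 * \<epsilon> \<le> t" unfolding t_def using \<epsilon> by linarith
      qed
      finally show ?thesis .
    next
      case False
      have "\<bar>(f u - g u) - (f v - g v)\<bar> \<le> 2 * S" using S[OF uv(1)] S[OF uv(2)] by linarith
      also have "\<dots> = t * \<rho> (1 / k)" unfolding S_def t_def using r by (simp add: field_simps)
      also have "\<dots> \<le> t * \<rho> \<bar>u - v\<bar>"
        using False uv(3) k01 by (intro mult_left_mono mono_onD[OF mono] t0) auto
      finally show ?thesis .
    qed
  qed
  then have 1: "holder_seminorm \<rho> (\<lambda>u. f u - g u) \<le> ereal t"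
    using less_holder_seminorm_iff[where \<rho>=\<rho> and f="\<lambda>u. f u - g u", OF modulus_nonneg[OF m] z t0]
    unfolding not_less[symmetric] by blast
  have 2: "(SUP u\<in>{0..1}. ereal \<bar>f u - g u\<bar>) \<le> ereal S" by (rule SUP_least) (use S in simp)
  have "holder_norm \<rho> (\<lambda>u. f u - g u) \<le> ereal (S + t)"
    unfolding holder_norm_def using add_mono[OF 2 1] by simp
  also have "S + t \<le> D * (1 + 2 / \<rho> (1 / k)) + \<epsilon> * (4 + 2 * \<rho> 1)"
  proof -
    have "\<epsilon> * \<rho> (1 / k) \<le> \<epsilon> * \<rho> 1" using r1 \<epsilon> by (rule mult_left_mono)
    moreover have "D * (1 + 2 / \<rho> (1 / k)) = D + 2 * D / \<rho> (1 / k)" by (simp add: distrib_left mult_ac)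
    moreover have "\<epsilon> * (4 + 2 * \<rho> 1) = 4 * \<epsilon> + 2 * (\<epsilon> * \<rho> 1)" by (simp add: distrib_left mult_ac)
    ultimately show ?thesis unfolding S_def t_def by linarith
  qed
  finally show ?thesis by simp
qed

lemma holder_dist_grid_bound:
  assumes m: "modulus_of_continuity \<rho>" and k: "0 < k" and \<epsilon>: "0 \<le> \<epsilon>"
    and f: "osc_le \<rho> f \<epsilon> (1 / real k)" and g: "osc_le \<rho> g \<epsilon> (1 / real k)"
    and D: "\<And>i. i \<le> k \<Longrightarrow> \<bar>f (real i / k) - g (real i / k)\<bar> \<le> D"
  shows "holder_dist \<rho> f g \<le> D * (1 + 2 / \<rho> (1 / k)) + \<epsilon> * (4 + 2 * \<rho> 1)"
  unfolding holder_dist_def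
  using holder_norm_grid_bound[OF assms] holder_norm_nonneg[OF m, of "\<lambda>u. f u - g u"]
  by (cases "holder_norm \<rho> (\<lambda>u. f u - g u)") auto

section \<open>Borel measurability in the little Hoelder space\<close>

lemma sets_restrict_in_C0_rho:
  assumes X: "C01_process M X" and m: "modulus_of_continuity \<rho>"
  shows "{\<omega>\<in>space M. restrict (X \<omega>) {0..1} \<in> C0_rho \<rho>} \<in> sets M"
proof -
  have z: "\<rho> 0 = 0" and mono: "mono_on {0..1} \<rho>" using m unfolding modulus_of_continuity_def by blast+
  have "restrict (X \<omega>) {0..1} \<in> C0_rho \<rho> \<longleftrightarrow> (\<forall>j. \<exists>k. osc_le \<rho> (X \<omega>) (1 / real (Suc j)) (1 / real (Suc k)))"
    if "\<omega> \<in> space M" for \<omega>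
    using X that by (intro restrict_in_C0_rho_iff m) (simp add: C01_process_def)
  then have "{\<omega>\<in>space M. restrict (X \<omega>) {0..1} \<in> C0_rho \<rho>}
     = {\<omega>\<in>space M. \<forall>j. \<exists>k. osc_le \<rho> (X \<omega>) (1 / real (Suc j)) (1 / real (Suc k))}" by blast
  also have "\<dots> \<in> sets M"
    by (intro sets.sets_Collect_countable_All sets.sets_Collect_countable_Ex sets_osc_le[OF X mono z]) simp
  finally show ?thesis .
qed

text \<open>For fixed \<open>j\<close>, failure at every scale is contained in failure at any single
  scale, whose probability can be made arbitrarily small. This leaves a null set for each of
  countably many \<open>j\<close>.\<close>

lemma AE_restrict_in_C0_rho:
  assumes X: "C01_process M X" and m: "modulus_of_continuity \<rho>"
    and small: "\<And>\<epsilon> e. 0 < \<epsilon> \<Longrightarrow> 0 < e \<Longrightarrow> \<exists>h>0. measure M {\<omega>\<in>space M. \<not> osc_le \<rho> (X \<omega>) \<epsilon> h} \<le> e"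
  shows "AE \<omega> in M. restrict (X \<omega>) {0..1} \<in> C0_rho \<rho>"
proof -
  interpret prob_space M using X by (simp add: C01_process_def)
  have z: "\<rho> 0 = 0" and mono: "mono_on {0..1} \<rho>" using m unfolding modulus_of_continuity_def by blast+
  have "AE \<omega> in M. \<exists>k. osc_le \<rho> (X \<omega>) (1 / real (Suc j)) (1 / real (Suc k))" for j
  proof -
    let ?\<epsilon> = "1 / real (Suc j)"
    define B where "B = {\<omega>\<in>space M. \<forall>k. \<not> osc_le \<rho> (X \<omega>) ?\<epsilon> (1 / real (Suc k))}"
    have \<epsilon>: "0 < ?\<epsilon>" by simp
    have B: "B \<in> sets M" unfolding B_def
      by (intro sets.sets_Collect_countable_All sets_not_osc_le[OF X mono z]) simp
    have "measure M B \<le> 0 + e" if e: "0 < e" for e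
    proof -
      obtain h where h: "0 < h" "measure M {\<omega>\<in>space M. \<not> osc_le \<rho> (X \<omega>) ?\<epsilon> h} \<le> e" using small[OF \<epsilon> e] by blast
      obtain k where k: "1 / real (Suc k) \<le> h" using ex_inverse_Suc_le[OF h(1)] by blast
      have "measure M B \<le> measure M {\<omega>\<in>space M. \<not> osc_le \<rho> (X \<omega>) ?\<epsilon> h}"
        unfolding B_def using osc_le_anti[OF _ k]
        by (intro finite_measure_mono sets_not_osc_le[OF X mono z less_imp_le[OF \<epsilon>]]) blast
      then show ?thesis using h(2) by linarith
    qed
    then have "measure M B \<le> 0" by (rule field_le_epsilon)
    then have "emeasure M B = 0" by (simp add: emeasure_eq_measure measure_le_0_iff)
    then show ?thesis using AE_iff_measurable[OF B, of "\<lambda>\<omega>. \<exists>k. osc_le \<rho> (X \<omega>) ?\<epsilon> (1 / real (Suc k))"]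
      unfolding B_def by simp
  qed
  then have "AE \<omega> in M. \<forall>j. \<exists>k. osc_le \<rho> (X \<omega>) (1 / real (Suc j)) (1 / real (Suc k))"
    unfolding AE_all_countable by blast
  then show ?thesis
  proof (rule AE_mp, intro AE_I2 impI)
    fix \<omega> assume "\<omega> \<in> space M" "\<forall>j. \<exists>k. osc_le \<rho> (X \<omega>) (1 / real (Suc j)) (1 / real (Suc k))"
    then show "restrict (X \<omega>) {0..1} \<in> C0_rho \<rho>"
      using X by (subst restrict_in_C0_rho_iff[OF m]) (auto simp: C01_process_def)
  qed
qed

lemma topspace_C0_rho_topology: "modulus_of_continuity \<rho> \<Longrightarrow> topspace (C0_rho_topology \<rho>) = C0_rho \<rho>"
  unfolding C0_rho_topology_def by (simp add: Metric_space.topspace_mtopology[OF Metric_space_C0_rho])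

text \<open>The cells are indexed by a countable type, and every open set is a union of cells, because the
  diameter of a cell is at most a constant multiple of \<open>1 / Suc j\<close>.\<close>

definition C0_cell :: "(real \<Rightarrow> real) \<Rightarrow> nat \<Rightarrow> nat \<Rightarrow> int list \<Rightarrow> (real \<Rightarrow> real) set" where
  "C0_cell \<rho> j k zs = {f. osc_le \<rho> f (1 / real (Suc j)) (1 / real (Suc k)) \<and>
     (\<forall>i\<le>Suc k. \<lfloor>f (real i / real (Suc k)) / (1 / real (Suc j) * \<rho> (1 / real (Suc k)))\<rfloor> = zs ! i)}"

text \<open>The mesh for the grid values is proportional to
  \<open>\<rho> (1 / real (Suc k))\<close>, which cancels the factor
  \<open>2 / \<rho> (1 / real (Suc k))\<close> of the grid bound; so the estimate does not depend on
  \<open>k\<close>. The constant is the sum of \<open>\<rho> 1 + 2\<close> and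
  \<open>4 + 2 * \<rho> 1\<close>.\<close>

lemma C0_cell_diameter:
  assumes m: "modulus_of_continuity \<rho>" and fg: "f \<in> C0_cell \<rho> j k zs" "g \<in> C0_cell \<rho> j k zs"
  shows "holder_dist \<rho> f g \<le> 1 / real (Suc j) * (6 + 3 * \<rho> 1)"
proof -
  let ?\<epsilon> = "1 / real (Suc j)" and ?r = "\<rho> (1 / real (Suc k))"
  have mono: "mono_on {0..1} \<rho>" using m unfolding modulus_of_continuity_def by blast
  have k01: "1 / real (Suc k) \<in> {0<..1}" by simp
  have r: "0 < ?r" using m k01 unfolding modulus_of_continuity_def by blast
  have r1: "?r \<le> \<rho> 1" by (rule mono_onD[OF mono]) auto
  have \<eta>: "0 < ?\<epsilon> * ?r" using r by simp
  have close: "\<bar>f (real i / real (Suc k)) - g (real i / real (Suc k))\<bar> \<le> ?\<epsilon> * ?r" if "i \<le> Suc k" for i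
  proof -
    let ?x = "f (real i / real (Suc k))" and ?y = "g (real i / real (Suc k))"
    have "\<lfloor>?x / (?\<epsilon> * ?r)\<rfloor> = \<lfloor>?y / (?\<epsilon> * ?r)\<rfloor>" using fg that unfolding C0_cell_def by simp
    then have "\<bar>?x / (?\<epsilon> * ?r) - ?y / (?\<epsilon> * ?r)\<bar> \<le> 1" by linarith
    then have "\<bar>(?x - ?y) / (?\<epsilon> * ?r)\<bar> \<le> 1" unfolding diff_divide_distrib .
    then have "\<bar>?x - ?y\<bar> / (?\<epsilon> * ?r) \<le> 1" using \<eta> by (simp only: abs_divide abs_of_pos)
    then show ?thesis using \<eta> by (simp only: divide_le_eq_1_pos)
  qed
  have "holder_dist \<rho> f g \<le> ?\<epsilon> * ?r * (1 + 2 / ?r) + ?\<epsilon> * (4 + 2 * \<rho> 1)"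
  proof (rule holder_dist_grid_bound[OF m])
    show "osc_le \<rho> f ?\<epsilon> (1 / real (Suc k))" "osc_le \<rho> g ?\<epsilon> (1 / real (Suc k))"
      using fg unfolding C0_cell_def by blast+
  qed (simp_all only: close zero_less_Suc, simp)
  moreover have "?\<epsilon> * ?r * (1 + 2 / ?r) = ?\<epsilon> * (?r + 2)"
  proof -
    have "?r * (1 + 2 / ?r) = ?r + 2" using r by (simp add: distrib_left)
    then show ?thesis by (simp only: mult.assoc)
  qed
  moreover have "?\<epsilon> * (?r + 2) \<le> ?\<epsilon> * (\<rho> 1 + 2)" using r1 by (intro mult_left_mono) auto
  moreover have "?\<epsilon> * (\<rho> 1 + 2) + ?\<epsilon> * (4 + 2 * \<rho> 1) = ?\<epsilon> * (6 + 3 * \<rho> 1)"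
    unfolding distrib_left[symmetric] by simp
  ultimately show ?thesis by linarith
qed

text \<open>The radius of a ball around \<open>f\<close> inside \<open>U\<close> determines
  \<open>j\<close>; then \<open>k\<close> comes from the membership of \<open>f\<close> in the
  space, and \<open>zs\<close> records the rounded grid values of \<open>f\<close>.\<close>

lemma openin_C0_rho_cell:
  assumes m: "modulus_of_continuity \<rho>" and U: "openin (C0_rho_topology \<rho>) U" and f: "f \<in> U"
  shows "\<exists>j k zs. f \<in> C0_cell \<rho> j k zs \<and> C0_cell \<rho> j k zs \<inter> C0_rho \<rho> \<subseteq> U"
proof -
  interpret Metric_space "C0_rho \<rho>" "holder_dist \<rho>" by (rule Metric_space_C0_rho[OF m])
  have f0: "f \<in> C0_rho \<rho>" using U f topspace_C0_rho_topology[OF m] openin_subset by blast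
  obtain r where r: "0 < r" "mball f r \<subseteq> U" using U f unfolding C0_rho_topology_def openin_mtopology by blast
  have c: "0 < 6 + 3 * \<rho> 1" using modulus_nonneg[OF m, of 1] by simp
  define q where "q = r / (6 + 3 * \<rho> 1)"
  have q: "0 < q / 2" "q / 2 < q" using divide_pos_pos[OF r(1) c] unfolding q_def[symmetric] by simp_all
  obtain j where "1 / real (Suc j) \<le> q / 2" using ex_inverse_Suc_le[OF q(1)] by blast
  then have "1 / real (Suc j) < r / (6 + 3 * \<rho> 1)" unfolding q_def[symmetric] using q(2) by (rule le_less_trans)
  then have j: "1 / real (Suc j) * (6 + 3 * \<rho> 1) < r" using c by (simp only: pos_less_divide_eq)
  have "f \<in> extensional {0..1}" "continuous_on {0..1} f" using f0 unfolding C0_rho_def C_rho_def by blast+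
  then obtain k where k: "osc_le \<rho> f (1 / real (Suc j)) (1 / real (Suc k))"
    using C0_rho_iff[OF m] f0 by blast
  \<comment> \<open>The indices run from 0 to \<open>Suc k\<close> inclusive, hence a list of
    \<open>k + 2\<close> entries.\<close>
  define zs where "zs = map (\<lambda>i. \<lfloor>f (real i / real (Suc k)) / (1 / real (Suc j) * \<rho> (1 / real (Suc k)))\<rfloor>) [0..<Suc (Suc k)]"
  have nth: "zs ! i = \<lfloor>f (real i / real (Suc k)) / (1 / real (Suc j) * \<rho> (1 / real (Suc k)))\<rfloor>" if "i \<le> Suc k" for i
  proof -
    have i: "i < Suc (Suc k)" using that by simp
    show ?thesis unfolding zs_def by (subst nth_map_upt) (use i in \<open>simp_all only: diff_zero add_0\<close>)
  qed
  have fc: "f \<in> C0_cell \<rho> j k zs" unfolding C0_cell_def using k nth by simp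
  moreover have "C0_cell \<rho> j k zs \<inter> C0_rho \<rho> \<subseteq> U"
  proof
    fix g assume g: "g \<in> C0_cell \<rho> j k zs \<inter> C0_rho \<rho>"
    have "holder_dist \<rho> f g < r" using C0_cell_diameter[OF m fc, of g] g j by (blast intro: le_less_trans)
    then show "g \<in> U" using r(2) g f0 by auto
  qed
  ultimately show ?thesis by blast
qed

text \<open>Open sets generate the Borel sets, and within the space each is a union of cells with
  indices in the countable type \<open>nat \<times> nat \<times> int list\<close>. The preimage of a
  cell involves one increment bound and finitely many values of the process.\<close>

lemma random_element_C0_rho:
  assumes X: "C01_process M X" and m: "modulus_of_continuity \<rho>"
    and small: "\<And>\<epsilon> e. 0 < \<epsilon> \<Longrightarrow> 0 < e \<Longrightarrow> \<exists>h>0. measure M {\<omega>\<in>space M. \<not> osc_le \<rho> (X \<omega>) \<epsilon> h} \<le> e"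
  shows "random_element M (C0_rho_topology \<rho>) (\<lambda>\<omega>. restrict (X \<omega>) {0..1})"
proof -
  have z: "\<rho> 0 = 0" and mono: "mono_on {0..1} \<rho>" using m unfolding modulus_of_continuity_def by blast+
  define S where "S = {\<omega>\<in>space M. restrict (X \<omega>) {0..1} \<in> C0_rho \<rho>}"
  have S: "S \<in> sets M" unfolding S_def by (rule sets_restrict_in_C0_rho[OF X m])
  have cell: "{\<omega>\<in>space M. restrict (X \<omega>) {0..1} \<in> C0_cell \<rho> j k zs} \<in> sets M" for j k zs
  proof -
    let ?c = "1 / real (Suc j) * \<rho> (1 / real (Suc k))"
    have grid: "{\<omega>\<in>space M. \<lfloor>restrict (X \<omega>) {0..1} (real i / real (Suc k)) / ?c\<rfloor> = zs ! i} \<in> sets M"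
      if "i \<in> {..Suc k}" for i
    proof -
      have i: "real i / real (Suc k) \<in> {0..1}" using that by simp
      note [measurable] = C01_process_measurable[OF X i]
      show ?thesis using i by (simp only: restrict_apply' ) measurable
    qed
    have "{\<omega>\<in>space M. restrict (X \<omega>) {0..1} \<in> C0_cell \<rho> j k zs} = {\<omega>\<in>space M. osc_le \<rho> (X \<omega>) (1 / real (Suc j)) (1 / real (Suc k)) \<and>
       (\<forall>i\<in>{..Suc k}. \<lfloor>restrict (X \<omega>) {0..1} (real i / real (Suc k)) / ?c\<rfloor> = zs ! i)}"
      unfolding C0_cell_def mem_Collect_eq osc_le_restrict by blast
    also have "\<dots> \<in> sets M"
      by (intro sets.sets_Collect_conj sets_osc_le[OF X mono z] sets.sets_Collect_finite_All grid) simp_all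
    finally show ?thesis .
  qed
  have "(\<lambda>\<omega>. restrict (X \<omega>) {0..1}) \<in> measurable (restrict_space M S) (borel_of_topology (C0_rho_topology \<rho>))"
    unfolding borel_of_topology_def topspace_C0_rho_topology[OF m]
  proof (rule measurable_measure_of)
    show "{U. openin (C0_rho_topology \<rho>) U} \<subseteq> Pow (C0_rho \<rho>)"
      using openin_subset topspace_C0_rho_topology[OF m] by blast
    show "(\<lambda>\<omega>. restrict (X \<omega>) {0..1}) \<in> space (restrict_space M S) \<rightarrow> C0_rho \<rho>"
      by (auto simp: space_restrict_space S_def)
    fix U assume "U \<in> {U. openin (C0_rho_topology \<rho>) U}"
    then have U: "openin (C0_rho_topology \<rho>) U" by simp
    define Q where "Q = {(j, k, zs). C0_cell \<rho> j k zs \<inter> C0_rho \<rho> \<subseteq> U}"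
    have "(\<lambda>\<omega>. restrict (X \<omega>) {0..1}) -` U \<inter> space (restrict_space M S)
      = S \<inter> (\<Union>(j, k, zs)\<in>Q. {\<omega>\<in>space M. restrict (X \<omega>) {0..1} \<in> C0_cell \<rho> j k zs})" (is "?L = ?R")
    proof (intro equalityI subsetI)
      fix \<omega> assume "\<omega> \<in> ?L"
      then have \<omega>: "restrict (X \<omega>) {0..1} \<in> U" "\<omega> \<in> S" "\<omega> \<in> space M" by (auto simp: space_restrict_space)
      obtain j k zs where "restrict (X \<omega>) {0..1} \<in> C0_cell \<rho> j k zs" "C0_cell \<rho> j k zs \<inter> C0_rho \<rho> \<subseteq> U"
        using openin_C0_rho_cell[OF m U \<omega>(1)] by blast
      then show "\<omega> \<in> ?R" using \<omega> unfolding Q_def by blast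
    next
      fix \<omega> assume "\<omega> \<in> ?R"
      then show "\<omega> \<in> ?L" unfolding Q_def S_def by (auto simp: space_restrict_space)
    qed
    moreover have "(\<Union>(j, k, zs)\<in>Q. {\<omega>\<in>space M. restrict (X \<omega>) {0..1} \<in> C0_cell \<rho> j k zs}) \<in> sets M"
      by (rule sets.countable_UN'') (auto intro: cell)
    ultimately show "(\<lambda>\<omega>. restrict (X \<omega>) {0..1}) -` U \<inter> space (restrict_space M S) \<in> sets (restrict_space M S)"
      using S by (subst sets_restrict_space_iff) auto
  qed
  then show ?thesis
    unfolding random_element_def topspace_C0_rho_topology[OF m]
    using S AE_restrict_in_C0_rho[OF X m small] unfolding S_def by blast
qed

section \<open>Weak convergence from Lipschitz functions\<close>

text \<open>Infimal convolution. With \<open>w\<close> a multiple of a metric it is the usual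
  Lipschitz regularization of \<phi>; with \<open>w\<close> a weighted distance of finitely many
  coordinates it is McShane's extension from \<open>A\<close>.\<close>

definition inf_conv :: "('c \<Rightarrow> real) \<Rightarrow> 'c set \<Rightarrow> ('d \<Rightarrow> 'c \<Rightarrow> real) \<Rightarrow> 'd \<Rightarrow> real" where
  "inf_conv \<phi> A w x = (INF g\<in>A. \<phi> g + w x g)"

lemma inf_conv_greatest: "A \<noteq> {} \<Longrightarrow> (\<And>g. g \<in> A \<Longrightarrow> c \<le> \<phi> g + w x g) \<Longrightarrow> c \<le> inf_conv \<phi> A w x"
  unfolding inf_conv_def by (rule cINF_greatest)

text \<open>The explicit bound \<open>c\<close> ensures that the infimum of reals is taken over a
  set bounded below.\<close>

lemma inf_conv_lower:
  assumes "\<And>g. g \<in> A \<Longrightarrow> c \<le> \<phi> g + w x g" "g \<in> A"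
  shows "inf_conv \<phi> A w x \<le> \<phi> g + w x g"
  unfolding inf_conv_def using assms by (intro cINF_lower bdd_belowI2[where m=c]) auto

lemma inf_conv_mono:
  assumes "A \<noteq> {}" "\<And>g. g \<in> A \<Longrightarrow> c \<le> \<phi> g + w x g" "\<And>g. g \<in> A \<Longrightarrow> w x g \<le> w y g + r"
  shows "inf_conv \<phi> A w x \<le> inf_conv \<phi> A w y + r"
proof -
  have "inf_conv \<phi> A w x - r \<le> \<phi> g + w y g" if g: "g \<in> A" for g
    using inf_conv_lower[of A c \<phi> w x, OF assms(2) g] assms(3)[OF g] by linarith
  then have "inf_conv \<phi> A w x - r \<le> inf_conv \<phi> A w y" using assms(1) by (intro inf_conv_greatest)
  then show ?thesis by linarith
qed

definition expectation_on :: "'a measure \<Rightarrow> 'c topology \<Rightarrow> ('a \<Rightarrow> 'c) \<Rightarrow> ('c \<Rightarrow> real) \<Rightarrow> real" where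
  "expectation_on M T X \<phi> = (LINT \<omega>:{\<omega>\<in>space M. X \<omega> \<in> topspace T}|M. \<phi> (X \<omega>))"

lemma integrable_random_element:
  assumes "prob_space M" "random_element M T X" "continuous_map T euclideanreal \<phi>"
    and B: "\<And>x. x \<in> topspace T \<Longrightarrow> \<bar>\<phi> x\<bar> \<le> B"
  shows "integrable M (\<lambda>\<omega>. indicator {\<omega>\<in>space M. X \<omega> \<in> topspace T} \<omega> *\<^sub>R \<phi> (X \<omega>))"
proof -
  interpret prob_space M by fact
  have "norm (indicator {\<omega>\<in>space M. X \<omega> \<in> topspace T} \<omega> *\<^sub>R \<phi> (X \<omega>)) \<le> \<bar>B\<bar>" for \<omega>
    using B[of "X \<omega>"] by (auto simp: indicator_def)
  then show ?thesis
    by (intro integrable_const_bound[of _ "\<bar>B\<bar>"] random_element_compose[OF assms(2,3)]) simp_all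
qed

lemma expectation_on_mono:
  assumes P: "prob_space M" "random_element M T X" and c: "continuous_map T euclideanreal \<phi>" "continuous_map T euclideanreal \<psi>"
    and B: "\<And>x. x \<in> topspace T \<Longrightarrow> \<bar>\<phi> x\<bar> \<le> B" "\<And>x. x \<in> topspace T \<Longrightarrow> \<bar>\<psi> x\<bar> \<le> B"
    and le: "\<And>x. x \<in> topspace T \<Longrightarrow> \<phi> x \<le> \<psi> x"
  shows "expectation_on M T X \<phi> \<le> expectation_on M T X \<psi>"
  unfolding expectation_on_def set_lebesgue_integral_def
  by (rule integral_mono[OF integrable_random_element[OF P c(1) B(1)] integrable_random_element[OF P c(2) B(2)]])
    (use le in \<open>simp_all add: indicator_def\<close>)

context Metric_space
begin

lemma Lipschitz_continuous_map_real:
  assumes "\<And>x y. x \<in> M \<Longrightarrow> y \<in> M \<Longrightarrow> \<bar>\<phi> x - \<phi> y\<bar> \<le> L * d x y"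
  shows "continuous_map mtopology euclideanreal \<phi>"
  unfolding continuous_map_def
proof (intro conjI allI impI)
  fix U :: "real set" assume "openin euclideanreal U"
  then have U: "open U" by simp
  show "openin mtopology {x \<in> topspace mtopology. \<phi> x \<in> U}"
    unfolding openin_mtopology
  proof (intro conjI allI impI)
    fix x assume "x \<in> {x \<in> topspace mtopology. \<phi> x \<in> U}"
    then have x: "x \<in> M" "\<phi> x \<in> U" by auto
    obtain e where e: "0 < e" "\<And>y. dist y (\<phi> x) < e \<Longrightarrow> y \<in> U" using U x(2) unfolding open_dist by blast
    have "mball x (e / (\<bar>L\<bar> + 1)) \<subseteq> {x \<in> topspace mtopology. \<phi> x \<in> U}"
    proof
      fix y assume "y \<in> mball x (e / (\<bar>L\<bar> + 1))"
      then have y: "y \<in> M" "d x y < e / (\<bar>L\<bar> + 1)" by auto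
      have "\<bar>\<phi> x - \<phi> y\<bar> \<le> L * d x y" by (rule assms[OF x(1) y(1)])
      also have "\<dots> \<le> (\<bar>L\<bar> + 1) * d x y" by (intro mult_right_mono) auto
      also have "\<dots> < e" using y(2) by (simp add: field_simps)
      finally have "\<phi> y \<in> U" by (intro e(2)) (simp add: dist_real_def abs_minus_commute)
      then show "y \<in> {x \<in> topspace mtopology. \<phi> x \<in> U}" using y by simp
    qed
    moreover have "0 < e / (\<bar>L\<bar> + 1)" using e(1) by simp
    ultimately show "\<exists>r>0. mball x r \<subseteq> {x \<in> topspace mtopology. \<phi> x \<in> U}" by blast
  qed auto
qed simp

lemma continuous_map_real_eps_delta:
  assumes \<phi>: "continuous_map mtopology euclideanreal \<phi>" and x: "x \<in> M" and e: "0 < e"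
  shows "\<exists>r>0. \<forall>y\<in>M. d x y < r \<longrightarrow> \<bar>\<phi> y - \<phi> x\<bar> < e"
proof -
  have "openin mtopology {y \<in> topspace mtopology. \<phi> y \<in> ball (\<phi> x) e}"
    by (rule openin_continuous_map_preimage[OF \<phi>]) simp
  moreover have "x \<in> {y \<in> topspace mtopology. \<phi> y \<in> ball (\<phi> x) e}" using x e by simp
  ultimately obtain r where r: "0 < r" "mball x r \<subseteq> {y \<in> topspace mtopology. \<phi> y \<in> ball (\<phi> x) e}"
    unfolding openin_mtopology by blast
  have "\<bar>\<phi> y - \<phi> x\<bar> < e" if "y \<in> M" "d x y < r" for y
  proof -
    have "y \<in> mball x r" using that x by simp
    then have "\<phi> y \<in> ball (\<phi> x) e" using r(2) by blast
    then show ?thesis by (simp add: dist_real_def abs_minus_commute)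
  qed
  then show ?thesis using r(1) by blast
qed

lemma inf_conv_properties:
  fixes m :: nat
  assumes ne: "M \<noteq> {}" and B: "\<And>x. x \<in> M \<Longrightarrow> \<bar>\<phi> x\<bar> \<le> B"
  defines "F \<equiv> inf_conv \<phi> M (\<lambda>x y. real m * d x y)"
  shows inf_conv_Lipschitz: "\<And>x y. x \<in> M \<Longrightarrow> y \<in> M \<Longrightarrow> \<bar>F x - F y\<bar> \<le> real m * d x y"
    and inf_conv_le: "\<And>x. x \<in> M \<Longrightarrow> F x \<le> \<phi> x"
    and inf_conv_abs_le: "\<And>x. x \<in> M \<Longrightarrow> \<bar>F x\<bar> \<le> B"
proof -
  have lb: "- B \<le> \<phi> g + real m * d x g" if "g \<in> M" for g x
  proof -
    have "0 \<le> real m * d x g" by simp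
    then show ?thesis using B[OF that] by linarith
  qed
  have half: "F x \<le> F y + real m * d x y" if "x \<in> M" "y \<in> M" for x y
    unfolding F_def
  proof (rule inf_conv_mono[where A=M and c="- B" and \<phi>=\<phi> and w="\<lambda>x y. real m * d x y", OF ne lb])
    fix g assume "g \<in> M"
    then have "real m * d x g \<le> real m * (d x y + d y g)" using that by (intro mult_left_mono triangle) auto
    then show "real m * d x g \<le> real m * d y g + real m * d x y" by (simp add: distrib_left)
  qed
  show "\<bar>F x - F y\<bar> \<le> real m * d x y" if "x \<in> M" "y \<in> M" for x y
    using half[OF that] half[OF that(2,1)] unfolding commute[of y x] by linarith
  show le: "F x \<le> \<phi> x" if "x \<in> M" for x
    using inf_conv_lower[of M "- B" \<phi> "\<lambda>x y. real m * d x y" x x, OF lb that] that unfolding F_def by simp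
  show "\<bar>F x\<bar> \<le> B" if x: "x \<in> M" for x
  proof -
    have "- B \<le> F x" unfolding F_def by (rule inf_conv_greatest[where A=M and c="- B" and \<phi>=\<phi> and w="\<lambda>x y. real m * d x y", OF ne lb])
    then show ?thesis using le[OF x] B[OF x] by linarith
  qed
qed

text \<open>Points at distance at least \<open>r\<close> from \<open>x\<close> pay a penalty of at
  least \<open>m * r\<close>, which for large \<open>m\<close> outweighs the largest possible drop
  \<open>2 * B\<close> of \<phi>; nearer points are controlled by continuity.\<close>

lemma inf_conv_LIMSEQ:
  assumes ne: "M \<noteq> {}" and B: "\<And>x. x \<in> M \<Longrightarrow> \<bar>\<phi> x\<bar> \<le> B"
    and \<phi>: "continuous_map mtopology euclideanreal \<phi>" and x: "x \<in> M"
  shows "(\<lambda>m. inf_conv \<phi> M (\<lambda>x y. real m * d x y) x) \<longlonglongrightarrow> \<phi> x"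
proof (rule tendstoI)
  fix e :: real assume e: "0 < e"
  obtain r where r: "0 < r" "\<And>y. y \<in> M \<Longrightarrow> d x y < r \<Longrightarrow> \<bar>\<phi> y - \<phi> x\<bar> < e / 2"
    using continuous_map_real_eps_delta[OF \<phi> x, of "e / 2"] e by auto
  obtain m0 where m0: "2 * B / r < real m0" using reals_Archimedean2 by blast
  have "dist (inf_conv \<phi> M (\<lambda>x y. real m * d x y) x) (\<phi> x) < e" if m: "m0 \<le> m" for m
  proof -
    have "\<phi> x - e / 2 \<le> inf_conv \<phi> M (\<lambda>x y. real m * d x y) x"
    proof (rule inf_conv_greatest[OF ne])
      fix y assume y: "y \<in> M"
      show "\<phi> x - e / 2 \<le> \<phi> y + real m * d x y"
      proof (cases "d x y < r")
        case True
        have "0 \<le> real m * d x y" by simp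
        then show ?thesis using r(2)[OF y True] by linarith
      next
        case False
        have "2 * B \<le> real m0 * r" using m0 r(1) by (simp add: field_simps)
        also have "\<dots> \<le> real m * d x y" using m False r(1) by (intro mult_mono) auto
        finally show ?thesis using B[OF x] B[OF y] e by linarith
      qed
    qed
    then show ?thesis using inf_conv_le[where m=m and \<phi>=\<phi>, OF ne B x] e unfolding dist_real_def by linarith
  qed
  then show "\<forall>\<^sub>F m in sequentially. dist (inf_conv \<phi> M (\<lambda>x y. real m * d x y) x) (\<phi> x) < e"
    unfolding eventually_sequentially by blast
qed

text \<open>A one-sided estimate suffices, since it applies to the negative of \<phi> too. Below
  \<phi> lies a Lipschitz function whose expectation under the limit law is almost that of \<phi>;
  dominated convergence is applied to the limit law alone, so no uniformity in \<open>n\<close> is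
  at stake.\<close>

lemma weakly_convergesI_Lipschitz:
  assumes ne: "M \<noteq> {}" and P: "\<And>n. prob_space (P n)" and N: "prob_space N"
    and X: "\<And>n. random_element (P n) mtopology (X n)" and Y: "random_element N mtopology Y"
    and lip: "\<And>\<phi> L B. 0 \<le> L \<Longrightarrow> (\<And>x y. x \<in> M \<Longrightarrow> y \<in> M \<Longrightarrow> \<bar>\<phi> x - \<phi> y\<bar> \<le> L * d x y) \<Longrightarrow>
      (\<And>x. x \<in> M \<Longrightarrow> \<bar>\<phi> x\<bar> \<le> B) \<Longrightarrow>
      (\<lambda>n. expectation_on (P n) mtopology (X n) \<phi>) \<longlonglongrightarrow> expectation_on N mtopology Y \<phi>"
  shows "weakly_converges mtopology P X N Y"
proof -
  have lower: "\<forall>\<^sub>F n in sequentially. expectation_on N mtopology Y \<phi> - e < expectation_on (P n) mtopology (X n) \<phi>"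
    if \<phi>: "continuous_map mtopology euclideanreal \<phi>" and B: "\<And>x. x \<in> M \<Longrightarrow> \<bar>\<phi> x\<bar> \<le> B" and e: "0 < e" for \<phi> B e
  proof -
    define F where "F m = inf_conv \<phi> M (\<lambda>x y. real m * d x y)" for m
    have FB: "\<bar>F m x\<bar> \<le> B" if "x \<in> M" for m x
      using inf_conv_abs_le[where \<phi>=\<phi>, OF ne B that] unfolding F_def .
    have Fle: "F m x \<le> \<phi> x" if "x \<in> M" for m x
      using inf_conv_le[where \<phi>=\<phi>, OF ne B that] unfolding F_def .
    have FL: "\<bar>F m x - F m y\<bar> \<le> real m * d x y" if "x \<in> M" "y \<in> M" for m x y
      using inf_conv_Lipschitz[where \<phi>=\<phi>, OF ne B that] unfolding F_def .
    have Fc: "continuous_map mtopology euclideanreal (F m)" for m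
      by (rule Lipschitz_continuous_map_real[OF FL])
    let ?S = "{\<omega>\<in>space N. Y \<omega> \<in> topspace mtopology}"
    interpret N: prob_space N by (rule N)
    have "(\<lambda>m. expectation_on N mtopology Y (F m)) \<longlonglongrightarrow> expectation_on N mtopology Y \<phi>"
      unfolding expectation_on_def set_lebesgue_integral_def
    proof (rule integral_dominated_convergence[where w="\<lambda>_. \<bar>B\<bar>"])
      show "(\<lambda>\<omega>. indicator ?S \<omega> *\<^sub>R \<phi> (Y \<omega>)) \<in> borel_measurable N"
        by (rule random_element_compose[OF Y \<phi>])
      show "(\<lambda>\<omega>. indicator ?S \<omega> *\<^sub>R F m (Y \<omega>)) \<in> borel_measurable N" for m
        by (rule random_element_compose[OF Y Fc])
      show "AE \<omega> in N. (\<lambda>m. indicator ?S \<omega> *\<^sub>R F m (Y \<omega>)) \<longlonglongrightarrow> indicator ?S \<omega> *\<^sub>R \<phi> (Y \<omega>)"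
      proof (rule AE_I2)
        fix \<omega> assume "\<omega> \<in> space N"
        show "(\<lambda>m. indicator ?S \<omega> *\<^sub>R F m (Y \<omega>)) \<longlonglongrightarrow> indicator ?S \<omega> *\<^sub>R \<phi> (Y \<omega>)"
        proof (cases "\<omega> \<in> ?S")
          case True
          then have "Y \<omega> \<in> M" by simp
          then show ?thesis unfolding F_def by (intro tendsto_intros inf_conv_LIMSEQ[OF ne B \<phi>])
        qed simp
      qed
      show "AE \<omega> in N. norm (indicator ?S \<omega> *\<^sub>R F m (Y \<omega>)) \<le> \<bar>B\<bar>" for m
      proof (rule AE_I2)
        fix \<omega>
        show "norm (indicator ?S \<omega> *\<^sub>R F m (Y \<omega>)) \<le> \<bar>B\<bar>"
          using FB[of "Y \<omega>" m] by (cases "\<omega> \<in> ?S") auto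
      qed
    qed simp
    then have "\<forall>\<^sub>F m in sequentially. expectation_on N mtopology Y \<phi> - e / 2 < expectation_on N mtopology Y (F m)"
      using e by (intro order_tendstoD(1)) auto
    then obtain m where m: "expectation_on N mtopology Y \<phi> - e / 2 < expectation_on N mtopology Y (F m)"
      by (auto simp: eventually_sequentially)
    have "(\<lambda>n. expectation_on (P n) mtopology (X n) (F m)) \<longlonglongrightarrow> expectation_on N mtopology Y (F m)"
      by (rule lip[OF _ FL FB]) simp
    then have "\<forall>\<^sub>F n in sequentially. expectation_on N mtopology Y (F m) - e / 2 < expectation_on (P n) mtopology (X n) (F m)"
      using e by (intro order_tendstoD(1)) auto
    then show ?thesis
    proof eventually_elim
      case (elim n)
      have "expectation_on (P n) mtopology (X n) (F m) \<le> expectation_on (P n) mtopology (X n) \<phi>"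
        by (rule expectation_on_mono[OF P X Fc \<phi>, of _ B]) (simp_all add: FB Fle B)
      then show ?case using elim m by linarith
    qed
  qed
  have "(\<lambda>n. expectation_on (P n) mtopology (X n) \<phi>) \<longlonglongrightarrow> expectation_on N mtopology Y \<phi>"
    if \<phi>: "continuous_map mtopology euclideanreal \<phi>" and b: "bounded (\<phi> ` topspace mtopology)" for \<phi>
  proof (rule tendstoI)
    fix e :: real assume e: "0 < e"
    obtain B where B: "\<And>x. x \<in> M \<Longrightarrow> \<bar>\<phi> x\<bar> \<le> B" using b unfolding bounded_iff by auto
    have B': "\<bar>- \<phi> x\<bar> \<le> B" if "x \<in> M" for x using B[OF that] by simp
    have neg: "expectation_on Q mtopology Z (\<lambda>x. - \<phi> x) = - expectation_on Q mtopology Z \<phi>" for Q :: "'z measure" and Z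
      unfolding expectation_on_def set_lebesgue_integral_def by simp
    have "\<forall>\<^sub>F n in sequentially. expectation_on N mtopology Y \<phi> - e < expectation_on (P n) mtopology (X n) \<phi>"
      by (rule lower[OF \<phi> B e])
    moreover have "\<forall>\<^sub>F n in sequentially. expectation_on N mtopology Y (\<lambda>x. - \<phi> x) - e < expectation_on (P n) mtopology (X n) (\<lambda>x. - \<phi> x)"
      by (rule lower[OF continuous_map_minus[OF \<phi>] B' e])
    ultimately show "\<forall>\<^sub>F n in sequentially. dist (expectation_on (P n) mtopology (X n) \<phi>) (expectation_on N mtopology Y \<phi>) < e"
    proof eventually_elim
      case (elim n)
      then show ?case unfolding neg dist_real_def by linarith
    qed
  qed
  then show ?thesis unfolding weakly_converges_def expectation_on_def using X Y by blast
qed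

end

text \<open>The weighted sum of the deviations from a fixed point is continuous on the product, and
  its sublevel sets serve as neighbourhoods.\<close>

lemma continuous_map_product_Lipschitz:
  fixes \<psi> :: "('i \<Rightarrow> real) \<Rightarrow> real"
  assumes J: "finite J" and L: "\<And>x y. \<bar>\<psi> x - \<psi> y\<bar> \<le> L * (\<Sum>j\<in>J. \<bar>x j - y j\<bar>)"
  shows "continuous_map (product_topology (\<lambda>_. euclideanreal) J) euclideanreal \<psi>"
  unfolding continuous_map_def
proof (intro conjI allI impI)
  let ?T = "product_topology (\<lambda>_. euclideanreal) J"
  fix U :: "real set" assume "openin euclideanreal U"
  then have U: "open U" by simp
  show "openin ?T {x \<in> topspace ?T. \<psi> x \<in> U}"
  proof (subst openin_subopen, intro ballI)
    fix x assume x: "x \<in> {x \<in> topspace ?T. \<psi> x \<in> U}"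
    obtain e where e: "0 < e" "\<And>y. dist y (\<psi> x) < e \<Longrightarrow> y \<in> U" using U x unfolding open_dist by blast
    define V where "V = {y \<in> topspace ?T. L * (\<Sum>j\<in>J. \<bar>x j - y j\<bar>) \<in> {..<e}}"
    have "continuous_map ?T euclideanreal (\<lambda>y. L * (\<Sum>j\<in>J. \<bar>x j - y j\<bar>))"
      by (intro continuous_map_real_mult_left continuous_map_sum continuous_map_real_abs continuous_map_diff
          continuous_map_product_projection J) simp_all
    then have "openin ?T V" unfolding V_def by (rule openin_continuous_map_preimage) simp
    moreover have "x \<in> V" using x e(1) unfolding V_def by simp
    moreover have "V \<subseteq> {x \<in> topspace ?T. \<psi> x \<in> U}"
    proof
      fix y assume "y \<in> V"
      then have y: "y \<in> topspace ?T" "L * (\<Sum>j\<in>J. \<bar>x j - y j\<bar>) < e" unfolding V_def by auto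
      have "\<psi> y \<in> U" using L[of x y] y(2) by (intro e(2)) (simp add: dist_real_def abs_minus_commute)
      then show "y \<in> {x \<in> topspace ?T. \<psi> x \<in> U}" using y(1) by simp
    qed
    ultimately show "\<exists>V. openin ?T V \<and> x \<in> V \<and> V \<subseteq> {x \<in> topspace ?T. \<psi> x \<in> U}" by blast
  qed
qed simp

section \<open>Weak convergence in the little Hoelder space\<close>

text \<open>On the event of small increments the integrands differ by at most \<kappa>, on its
  complement by at most \<open>2 * B\<close>. The comparison is made almost everywhere, because only
  almost every path lies in the space.\<close>

lemma expectation_on_grid_approx:
  assumes X: "C01_process P X" and m: "modulus_of_continuity \<rho>"
    and re: "random_element P (C0_rho_topology \<rho>) (\<lambda>\<omega>. restrict (X \<omega>) {0..1})"
    and \<phi>: "continuous_map (C0_rho_topology \<rho>) euclideanreal \<phi>" "\<And>f. f \<in> C0_rho \<rho> \<Longrightarrow> \<bar>\<phi> f\<bar> \<le> B"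
    and J: "J \<subseteq> {0..1}" and \<psi>: "(\<lambda>\<omega>. \<psi> (restrict (X \<omega>) J)) \<in> borel_measurable P" "\<And>x. \<bar>\<psi> x\<bar> \<le> B"
    and \<epsilon>: "0 \<le> \<epsilon>"
    and close: "\<And>f. f \<in> C0_rho \<rho> \<Longrightarrow> osc_le \<rho> f \<epsilon> h \<Longrightarrow> \<bar>\<phi> f - \<psi> (restrict f J)\<bar> \<le> \<kappa>"
    and \<kappa>: "0 \<le> \<kappa>"
  shows "\<bar>expectation_on P (C0_rho_topology \<rho>) (\<lambda>\<omega>. restrict (X \<omega>) {0..1}) \<phi> - (LINT \<omega>|P. \<psi> (restrict (X \<omega>) J))\<bar>
    \<le> \<kappa> + 2 * B * measure P {\<omega>\<in>space P. \<not> osc_le \<rho> (X \<omega>) \<epsilon> h}"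
proof -
  interpret prob_space P using X by (simp add: C01_process_def)
  have z: "\<rho> 0 = 0" and mono: "mono_on {0..1} \<rho>" using m unfolding modulus_of_continuity_def by blast+
  have top: "topspace (C0_rho_topology \<rho>) = C0_rho \<rho>" by (rule topspace_C0_rho_topology[OF m])
  define S where "S = {\<omega>\<in>space P. restrict (X \<omega>) {0..1} \<in> topspace (C0_rho_topology \<rho>)}"
  define a where "a \<omega> = indicator S \<omega> *\<^sub>R \<phi> (restrict (X \<omega>) {0..1})" for \<omega>
  define b where "b \<omega> = \<psi> (restrict (X \<omega>) J)" for \<omega>
  define Q where "Q = {\<omega>\<in>space P. \<not> osc_le \<rho> (X \<omega>) \<epsilon> h}"
  define w where "w \<omega> = \<kappa> + 2 * B * indicator Q \<omega>" for \<omega>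
  have Q: "Q \<in> sets P" unfolding Q_def by (rule sets_not_osc_le[OF X mono z \<epsilon>])
  have B: "0 \<le> B" using \<psi>(2)[of undefined] by linarith
  have ia: "integrable P a" unfolding a_def S_def
    by (rule integrable_random_element[OF prob_space_axioms re \<phi>(1)]) (use \<phi>(2) top in blast)
  have ib: "integrable P b" unfolding b_def
    by (rule integrable_const_bound[of _ B]) (use \<psi> in simp_all)
  have iQ: "integrable P (indicat_real Q)" using Q by (simp add: integrable_indicator_iff less_top[symmetric])
  have iw: "integrable P w" unfolding w_def using iQ by simp
  have "(LINT \<omega>|P. w \<omega>) = \<kappa> + 2 * B * measure P Q"
    unfolding w_def using iQ Q by (simp add: prob_space Int_absorb2 sets.sets_into_space)
  moreover have "AE \<omega> in P. \<bar>a \<omega> - b \<omega>\<bar> \<le> w \<omega>"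
  proof -
    have "AE \<omega> in P. restrict (X \<omega>) {0..1} \<in> topspace (C0_rho_topology \<rho>)" using re unfolding random_element_def by blast
    then show ?thesis
    proof (rule AE_mp, intro AE_I2 impI)
      fix \<omega> assume \<omega>: "\<omega> \<in> space P" and top\<omega>: "restrict (X \<omega>) {0..1} \<in> topspace (C0_rho_topology \<rho>)"
      then have S: "\<omega> \<in> S" unfolding S_def by simp
      have f: "restrict (X \<omega>) {0..1} \<in> C0_rho \<rho>" using top\<omega> top by simp
      have rJ: "restrict (restrict (X \<omega>) {0..1}) J = restrict (X \<omega>) J"
        using J by (simp add: restrict_restrict Int_absorb1)
      show "\<bar>a \<omega> - b \<omega>\<bar> \<le> w \<omega>"
      proof (cases "osc_le \<rho> (X \<omega>) \<epsilon> h")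
        case True
        then have "\<bar>a \<omega> - b \<omega>\<bar> \<le> \<kappa>" using close[OF f] S unfolding a_def b_def rJ by simp
        moreover have "\<omega> \<notin> Q" using True unfolding Q_def by simp
        ultimately show ?thesis unfolding w_def by simp
      next
        case False
        then have "\<omega> \<in> Q" using \<omega> unfolding Q_def by simp
        moreover have "\<bar>a \<omega>\<bar> \<le> B" "\<bar>b \<omega>\<bar> \<le> B" using \<phi>(2)[OF f] \<psi>(2) S unfolding a_def b_def by simp_all
        ultimately show ?thesis unfolding w_def using \<kappa> by simp
      qed
    qed
  qed
  then have "(LINT \<omega>|P. \<bar>a \<omega> - b \<omega>\<bar>) \<le> (LINT \<omega>|P. w \<omega>)"
    by (rule integral_mono_AE[rotated 2]) (use ia ib iw in simp_all)
  moreover have "\<bar>(LINT \<omega>|P. a \<omega> - b \<omega>)\<bar> \<le> (LINT \<omega>|P. \<bar>a \<omega> - b \<omega>\<bar>)"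
    by (rule integral_abs_bound)
  moreover have "(LINT \<omega>|P. a \<omega> - b \<omega>) = (LINT \<omega>|P. a \<omega>) - (LINT \<omega>|P. b \<omega>)"
    by (rule Bochner_Integration.integral_diff[OF ia ib])
  moreover have "expectation_on P (C0_rho_topology \<rho>) (\<lambda>\<omega>. restrict (X \<omega>) {0..1}) \<phi> = (LINT \<omega>|P. a \<omega>)"
    unfolding expectation_on_def set_lebesgue_integral_def a_def S_def ..
  ultimately show ?thesis unfolding b_def[symmetric] Q_def[symmetric] by linarith
qed

lemma osc_le_zero:
  assumes m: "modulus_of_continuity \<rho>" and c: "0 \<le> c"
  shows "osc_le \<rho> (\<lambda>_. 0) c h"
proof (rule osc_leI[where \<rho>=\<rho>])
  show "\<rho> 0 = 0" using m unfolding modulus_of_continuity_def by blast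
  fix u v :: real assume "0 \<le> u" "u < v" "v \<le> 1"
  then have "v - u \<in> {0..1}" by simp
  then show "\<bar>0 - 0\<bar> \<le> c * \<rho> (v - u)" using modulus_nonneg[OF m] c by simp
qed

lemma zero_in_C0_rho:
  assumes m: "modulus_of_continuity \<rho>"
  shows "restrict (\<lambda>_. 0) {0..1} \<in> C0_rho \<rho>"
proof (subst restrict_in_C0_rho_iff[OF m])
  have "osc_le \<rho> (\<lambda>_. 0) (1 / real (Suc j)) (1 / real (Suc 0))" for j
    by (rule osc_le_zero[OF m]) simp
  then show "\<forall>j. \<exists>k. osc_le \<rho> (\<lambda>_. 0) (1 / real (Suc j)) (1 / real (Suc k))" by blast
qed simp

text \<open>Extending a Lipschitz function from the values on a grid by McShane's formula gives a function
  of finitely many coordinates that is close to it on functions with small increments.\<close>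

lemma ex_grid_approximation:
  assumes m: "modulus_of_continuity \<rho>" and k: "0 < k" and \<epsilon>: "0 \<le> \<epsilon>" and L: "0 \<le> L"
    and lip: "\<And>f g. f \<in> C0_rho \<rho> \<Longrightarrow> g \<in> C0_rho \<rho> \<Longrightarrow> \<bar>\<phi> f - \<phi> g\<bar> \<le> L * holder_dist \<rho> f g"
    and B: "\<And>f. f \<in> C0_rho \<rho> \<Longrightarrow> \<bar>\<phi> f\<bar> \<le> B"
  defines "J \<equiv> (\<lambda>i. real i / real k) ` {..k}"
  shows "\<exists>\<psi>. continuous_map (product_topology (\<lambda>_. euclideanreal) J) euclideanreal \<psi> \<and> (\<forall>x. \<bar>\<psi> x\<bar> \<le> B) \<and>
    (\<forall>f\<in>C0_rho \<rho>. osc_le \<rho> f \<epsilon> (1 / real k) \<longrightarrow> \<bar>\<phi> f - \<psi> (restrict f J)\<bar> \<le> L * (\<epsilon> * (4 + 2 * \<rho> 1)))"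
proof -
  have J: "finite J" unfolding J_def by simp
  define A where "A = {f \<in> C0_rho \<rho>. osc_le \<rho> f \<epsilon> (1 / real k)}"
  have "restrict (\<lambda>_. 0) {0..1} \<in> A"
    unfolding A_def using zero_in_C0_rho[OF m] osc_le_zero[OF m \<epsilon>] by simp
  then have ne: "A \<noteq> {}" by blast
  have B0: "0 \<le> B" using B[OF zero_in_C0_rho[OF m]] by linarith
  have "1 / real k \<in> {0<..1}" using k by simp
  then have r: "0 < \<rho> (1 / real k)" using m unfolding modulus_of_continuity_def by blast
  \<comment> \<open>With this weight the penalty \<open>w\<close> matches the part of
    \<open>L * holder_dist \<rho> f g\<close> that stems from the grid values; the remaining part is
    the error in the claim.\<close>
  define c where "c = L * (1 + 2 / \<rho> (1 / real k))"
  have c: "0 \<le> c" unfolding c_def using L r by simp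
  define w where "w x g = c * (\<Sum>j\<in>J. \<bar>x j - g j\<bar>)" for x g :: "real \<Rightarrow> real"
  have w0: "0 \<le> w x g" for x g unfolding w_def using c by (intro mult_nonneg_nonneg sum_nonneg) auto
  have lb: "- B \<le> \<phi> g + w x g" if "g \<in> A" for g x
    using B[of g] w0[of x g] that unfolding A_def by (simp add: abs_le_iff)
  define \<Psi> where "\<Psi> = inf_conv \<phi> A w"
  \<comment> \<open>\<open>\<Psi>\<close> is at least \<open>- B\<close> but may be large away from
    the grid values of members of \<open>A\<close>. Truncation at \<open>B\<close> restores the
    bound and, since \<phi> is at most \<open>B\<close>, does not harm the approximation.\<close>
  define \<psi> where "\<psi> x = min B (\<Psi> x)" for x
  have "\<bar>\<psi> x\<bar> \<le> B" for x
    using inf_conv_greatest[where A=A and c="- B" and \<phi>=\<phi> and w=w and x=x, OF ne lb] B0 unfolding \<psi>_def \<Psi>_def by simp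
  moreover have "continuous_map (product_topology (\<lambda>_. euclideanreal) J) euclideanreal \<psi>"
  proof (rule continuous_map_product_Lipschitz[OF J])
    have half: "\<Psi> x \<le> \<Psi> y + c * (\<Sum>j\<in>J. \<bar>x j - y j\<bar>)" for x y
      unfolding \<Psi>_def
    proof (rule inf_conv_mono[where A=A and c="- B" and \<phi>=\<phi> and w=w, OF ne lb])
      fix g
      have "(\<Sum>j\<in>J. \<bar>x j - g j\<bar>) \<le> (\<Sum>j\<in>J. \<bar>y j - g j\<bar> + \<bar>x j - y j\<bar>)" by (rule sum_mono) linarith
      then have "w x g \<le> c * ((\<Sum>j\<in>J. \<bar>y j - g j\<bar>) + (\<Sum>j\<in>J. \<bar>x j - y j\<bar>))"
        unfolding w_def sum.distrib[symmetric] using c by (rule mult_left_mono)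
      then show "w x g \<le> w y g + c * (\<Sum>j\<in>J. \<bar>x j - y j\<bar>)" unfolding w_def distrib_left .
    qed
    fix x y :: "real \<Rightarrow> real"
    define D where "D = c * (\<Sum>j\<in>J. \<bar>x j - y j\<bar>)"
    have "(\<Sum>j\<in>J. \<bar>y j - x j\<bar>) = (\<Sum>j\<in>J. \<bar>x j - y j\<bar>)" by (simp only: abs_minus_commute)
    then have "\<Psi> x \<le> \<Psi> y + D" "\<Psi> y \<le> \<Psi> x + D" using half[of x y] half[of y x] unfolding D_def by simp_all
    then show "\<bar>\<psi> x - \<psi> y\<bar> \<le> c * (\<Sum>j\<in>J. \<bar>x j - y j\<bar>)"
      unfolding D_def[symmetric] \<psi>_def by (simp add: min_def abs_if)
  qed
  moreover have "\<bar>\<phi> f - \<psi> (restrict f J)\<bar> \<le> L * (\<epsilon> * (4 + 2 * \<rho> 1))"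
    if f: "f \<in> C0_rho \<rho>" "osc_le \<rho> f \<epsilon> (1 / real k)" for f
  proof -
    have fA: "f \<in> A" using f unfolding A_def by blast
    have err: "0 \<le> L * (\<epsilon> * (4 + 2 * \<rho> 1))" using L \<epsilon> modulus_nonneg[OF m, of 1] by simp
    have "\<Psi> (restrict f J) \<le> \<phi> f + w (restrict f J) f"
      unfolding \<Psi>_def by (rule inf_conv_lower[where A=A and c="- B" and \<phi>=\<phi> and w=w, OF lb fA])
    moreover have "w (restrict f J) f = 0" unfolding w_def by simp
    ultimately have upper: "\<Psi> (restrict f J) \<le> \<phi> f" by simp
    have lower: "\<phi> f - L * (\<epsilon> * (4 + 2 * \<rho> 1)) \<le> \<Psi> (restrict f J)"
      unfolding \<Psi>_def
    proof (rule inf_conv_greatest[OF ne])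
      fix g assume g: "g \<in> A"
      \<comment> \<open>The grid bound asks for a common bound of the deviations; their sum is one,
        and it is the quantity that \<open>w\<close> penalizes.\<close>
      define D where "D = (\<Sum>j\<in>J. \<bar>f j - g j\<bar>)"
      have "holder_dist \<rho> f g \<le> D * (1 + 2 / \<rho> (1 / real k)) + \<epsilon> * (4 + 2 * \<rho> 1)"
      proof (rule holder_dist_grid_bound[OF m k \<epsilon> f(2)])
        show "osc_le \<rho> g \<epsilon> (1 / real k)" using g unfolding A_def by blast
        fix i assume "i \<le> k"
        then have "real i / real k \<in> J" unfolding J_def by blast
        then show "\<bar>f (real i / real k) - g (real i / real k)\<bar> \<le> D"
          unfolding D_def by (intro member_le_sum[where f="\<lambda>j. \<bar>f j - g j\<bar>"] J) simp_all
      qed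
      then have "L * holder_dist \<rho> f g \<le> L * (D * (1 + 2 / \<rho> (1 / real k)) + \<epsilon> * (4 + 2 * \<rho> 1))"
        using L by (rule mult_left_mono)
      also have "\<dots> = c * D + L * (\<epsilon> * (4 + 2 * \<rho> 1))" unfolding c_def by (simp only: distrib_left mult_ac)
      finally have "\<bar>\<phi> f - \<phi> g\<bar> \<le> c * D + L * (\<epsilon> * (4 + 2 * \<rho> 1))"
        using lip[OF f(1), of g] g unfolding A_def by simp
      moreover have "w (restrict f J) g = c * D" unfolding w_def D_def by simp
      ultimately show "\<phi> f - L * (\<epsilon> * (4 + 2 * \<rho> 1)) \<le> \<phi> g + w (restrict f J) g" by linarith
    qed
    show ?thesis using upper lower err B[OF f(1)] unfolding \<psi>_def by (simp add: min_def abs_le_iff)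
  qed
  ultimately show ?thesis by blast
qed

context chained_processes
begin

text \<open>For Lipschitz \<phi>, the expectations for all \<open>n\<close> and for the limit are
  within \<open>e / 3\<close> of those of one continuous function \<psi> of finitely many path
  values, and the latter converge. The limit process enters on the same footing because it inherits
  the tails.\<close>

lemma weakly_converges_C0_rho:
  assumes V: "C01_process N V" and fidi: "fidi_converges M W N V" and m: "modulus_of_continuity \<rho>"
    and lim: "((\<lambda>h. ereal (\<rho> h) / ereal (\<rho>\<^sub>0 h)) \<longlongrightarrow> \<infinity>) (at_right 0)"
  shows "weakly_converges (C0_rho_topology \<rho>) M (\<lambda>n \<omega>. restrict (W n \<omega>) {0..1}) N (\<lambda>\<omega>. restrict (V \<omega>) {0..1})"
proof -
  interpret V: chained_processes "\<lambda>_::nat. N" "\<lambda>_. V" \<rho>\<^sub>0 C by (rule limit_chained_processes[OF fidi V])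
  interpret H: Metric_space "C0_rho \<rho>" "holder_dist \<rho>" by (rule Metric_space_C0_rho[OF m])
  have z: "\<rho> 0 = 0" and mono: "mono_on {0..1} \<rho>" using m unfolding modulus_of_continuity_def by blast+
  have smallW: "\<exists>h>0. \<forall>n. measure (M n) {\<omega>\<in>space (M n). \<not> osc_le \<rho> (W n \<omega>) \<epsilon> h} \<le> e"
    if "0 < \<epsilon>" "0 < e" for \<epsilon> e using small_osc_modulus[OF m lim that(1) _ that(2)] by auto
  have smallV: "\<exists>h>0. measure N {\<omega>\<in>space N. \<not> osc_le \<rho> (V \<omega>) \<epsilon> h} \<le> e"
    if "0 < \<epsilon>" "0 < e" for \<epsilon> e using V.small_osc_modulus[OF m lim that(1) _ that(2)] by auto
  have PW: "prob_space (M n)" for n using W by (simp add: C01_process_def)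
  have PV: "prob_space N" using V by (simp add: C01_process_def)
  let ?T = "C0_rho_topology \<rho>"
  have T: "H.mtopology = ?T" by (simp add: C0_rho_topology_def)
  have reW: "random_element (M n) ?T (\<lambda>\<omega>. restrict (W n \<omega>) {0..1})" for n
    by (rule random_element_C0_rho[OF W m]) (use smallW in blast)
  have reV: "random_element N ?T (\<lambda>\<omega>. restrict (V \<omega>) {0..1})"
    by (rule random_element_C0_rho[OF V m smallV])
  show ?thesis
  proof (rule H.weakly_convergesI_Lipschitz[OF _ PW PV, unfolded T, OF _ reW reV])
    show "C0_rho \<rho> \<noteq> {}" using zero_in_C0_rho[OF m] by blast
    fix \<phi> :: "(real \<Rightarrow> real) \<Rightarrow> real" and L B
    assume L: "0 \<le> L"
      and lip: "\<And>f g. f \<in> C0_rho \<rho> \<Longrightarrow> g \<in> C0_rho \<rho> \<Longrightarrow> \<bar>\<phi> f - \<phi> g\<bar> \<le> L * holder_dist \<rho> f g"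
      and B: "\<And>f. f \<in> C0_rho \<rho> \<Longrightarrow> \<bar>\<phi> f\<bar> \<le> B"
    have B0: "0 \<le> B" using B[OF zero_in_C0_rho[OF m]] by linarith
    have \<phi>: "continuous_map ?T euclideanreal \<phi>"
      unfolding T[symmetric] by (rule H.Lipschitz_continuous_map_real[OF lip])
    let ?EW = "\<lambda>n. expectation_on (M n) ?T (\<lambda>\<omega>. restrict (W n \<omega>) {0..1}) \<phi>"
    let ?EV = "expectation_on N ?T (\<lambda>\<omega>. restrict (V \<omega>) {0..1}) \<phi>"
    show "?EW \<longlonglongrightarrow> ?EV"
    proof (rule tendstoI)
      fix e :: real assume e: "0 < e"
      define K where "K = L * (4 + 2 * \<rho> 1)"
      have K: "0 \<le> K" unfolding K_def using L modulus_nonneg[OF m, of 1] by simp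
      \<comment> \<open>\<epsilon> and \<eta> make the approximation error and the contribution of
        the exceptional event at most \<open>e / 6\<close> each; the added 1 keeps the denominators
        positive if \<open>K\<close> or \<open>B\<close> is zero.\<close>
      define \<epsilon> where "\<epsilon> = e / 6 / (K + 1)"
      define \<eta> where "\<eta> = e / 12 / (B + 1)"
      have \<epsilon>: "0 < \<epsilon>" unfolding \<epsilon>_def using e K by simp
      have \<eta>: "0 < \<eta>" unfolding \<eta>_def using e B0 by simp
      have "L * (\<epsilon> * (4 + 2 * \<rho> 1)) = K * \<epsilon>" unfolding K_def by simp
      also have "\<dots> \<le> (K + 1) * \<epsilon>" using \<epsilon> by simp
      also have "\<dots> = e / 6" unfolding \<epsilon>_def times_divide_eq_right[of "K + 1" "e / 6"]
        by (rule nonzero_mult_div_cancel_left) (use K in linarith)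
      finally have \<epsilon>e: "L * (\<epsilon> * (4 + 2 * \<rho> 1)) \<le> e / 6" .
      have "2 * B * \<eta> \<le> 2 * (B + 1) * \<eta>" using \<eta> by simp
      also have "\<dots> = 2 * (e / 12)" unfolding \<eta>_def mult.assoc times_divide_eq_right[of "B + 1" "e / 12"]
        by (subst nonzero_mult_div_cancel_left) (use B0 in linarith, rule refl)
      finally have \<eta>e: "2 * B * \<eta> \<le> e / 6" by simp
      obtain h1 where h1: "0 < h1" "\<And>n. measure (M n) {\<omega>\<in>space (M n). \<not> osc_le \<rho> (W n \<omega>) \<epsilon> h1} \<le> \<eta>"
        using smallW[OF \<epsilon> \<eta>] by blast
      obtain h2 where h2: "0 < h2" "measure N {\<omega>\<in>space N. \<not> osc_le \<rho> (V \<omega>) \<epsilon> h2} \<le> \<eta>"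
        using smallV[OF \<epsilon> \<eta>] by blast
      \<comment> \<open>One mesh for all \<open>n\<close> and for the limit, so that the same \<psi>
        occurs in every comparison.\<close>
      obtain k0 where "1 / real (Suc k0) \<le> min h1 h2" using ex_inverse_Suc_le[of "min h1 h2"] h1(1) h2(1) by auto
      then obtain k where k: "0 < k" "1 / real k \<le> h1" "1 / real k \<le> h2" by (metis min.bounded_iff zero_less_Suc)
      define J where "J = (\<lambda>i. real i / real k) ` {..k}"
      have J: "finite J" "J \<subseteq> {0..1}" unfolding J_def using k(1) by (auto simp: field_simps)
      obtain \<psi> where \<psi>: "continuous_map (product_topology (\<lambda>_. euclideanreal) J) euclideanreal \<psi>" "\<And>x. \<bar>\<psi> x\<bar> \<le> B"
        and close: "\<And>f. f \<in> C0_rho \<rho> \<Longrightarrow> osc_le \<rho> f \<epsilon> (1 / real k) \<Longrightarrow> \<bar>\<phi> f - \<psi> (restrict f J)\<bar> \<le> L * (\<epsilon> * (4 + 2 * \<rho> 1))"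
        using ex_grid_approximation[OF m k(1) less_imp_le[OF \<epsilon>] L lip B] unfolding J_def[symmetric] by blast
      note f = fidi_tendsto[OF fidi J \<psi>]
      have close': "\<bar>\<phi> f - \<psi> (restrict f J)\<bar> \<le> e / 6" if "f \<in> C0_rho \<rho>" "osc_le \<rho> f \<epsilon> (1 / real k)" for f
        using close[OF that] \<epsilon>e by linarith
      have bound: "e / 6 + 2 * B * p \<le> e / 3" if "p \<le> \<eta>" for p
      proof -
        have "2 * B * p \<le> 2 * B * \<eta>" using that B0 by (intro mult_left_mono) auto
        then show ?thesis using \<eta>e by linarith
      qed
      have e6: "0 \<le> e / 6" using e by simp
      have approxW: "\<bar>?EW n - (LINT \<omega>|M n. \<psi> (restrict (W n \<omega>) J))\<bar> \<le> e / 3" for n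
      proof -
        interpret Mn: prob_space "M n" by (rule PW)
        have "measure (M n) {\<omega>\<in>space (M n). \<not> osc_le \<rho> (W n \<omega>) \<epsilon> (1 / real k)} \<le> measure (M n) {\<omega>\<in>space (M n). \<not> osc_le \<rho> (W n \<omega>) \<epsilon> h1}"
          using osc_le_anti[OF _ k(2)]
          by (intro Mn.finite_measure_mono sets_not_osc_le[OF W mono z less_imp_le[OF \<epsilon>]]) blast
        then have "measure (M n) {\<omega>\<in>space (M n). \<not> osc_le \<rho> (W n \<omega>) \<epsilon> (1 / real k)} \<le> \<eta>" using h1(2)[of n] by linarith
        from bound[OF this] show ?thesis
          using expectation_on_grid_approx[OF W m reW \<phi> B J(2) f(2) \<psi>(2) less_imp_le[OF \<epsilon>] close' e6] by (rule order_trans[rotated])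
      qed
      have approxV: "\<bar>?EV - (LINT \<omega>|N. \<psi> (restrict (V \<omega>) J))\<bar> \<le> e / 3"
      proof -
        interpret N: prob_space N by (rule PV)
        have "measure N {\<omega>\<in>space N. \<not> osc_le \<rho> (V \<omega>) \<epsilon> (1 / real k)} \<le> measure N {\<omega>\<in>space N. \<not> osc_le \<rho> (V \<omega>) \<epsilon> h2}"
          using osc_le_anti[OF _ k(3)]
          by (intro N.finite_measure_mono sets_not_osc_le[OF V mono z less_imp_le[OF \<epsilon>]]) blast
        then have "measure N {\<omega>\<in>space N. \<not> osc_le \<rho> (V \<omega>) \<epsilon> (1 / real k)} \<le> \<eta>" using h2(2) by linarith
        from bound[OF this] show ?thesis
          using expectation_on_grid_approx[OF V m reV \<phi> B J(2) f(3) \<psi>(2) less_imp_le[OF \<epsilon>] close' e6] by (rule order_trans[rotated])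
      qed
      have "0 < e / 3" using e by simp
      from tendstoD[OF f(1) this] show "\<forall>\<^sub>F n in sequentially. dist (?EW n) ?EV < e"
      proof eventually_elim
        case (elim n)
        then show ?case using approxW[of n] approxV unfolding dist_real_def by linarith
      qed
    qed
  qed
qed

end

theorem theorem2p2:
  fixes M :: "nat \<Rightarrow> 'a measure" and W :: "nat \<Rightarrow> 'a \<Rightarrow> real \<Rightarrow> real"
    and \<rho>\<^sub>0 :: "real \<Rightarrow> real" and C :: real
  assumes W: "\<And>n. C01_process (M n) (W n)"
    and rho0: "\<rho>\<^sub>0 ` {0..1} \<subseteq> {0..}" "mono_on {0..1} \<rho>\<^sub>0" "\<rho>\<^sub>0 0 = 0"
    and C: "C > 0"
    and tail: "\<forall>t>C. \<exists>\<kappa>>1. \<exists>K>0. \<forall>n. \<forall>u\<in>{0..1}. \<forall>v\<in>{0..1}. u \<noteq> v \<longrightarrow>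
      measure (M n) {\<omega>\<in>space (M n). incr_ratio \<rho>\<^sub>0 (W n \<omega>) u v > ereal t}
        \<le> K * \<bar>u - v\<bar> powr \<kappa>"
    and growth: "\<exists>p>0. \<exists>K>0. \<forall>h\<in>{0..1}. \<forall>z\<in>{0..1}. \<rho>\<^sub>0 (z * h) \<le> K * z powr p * \<rho>\<^sub>0 h"
  shows
    "(\<forall>t>C.
        (\<forall>n. \<forall>h>0. {\<omega>\<in>space (M n).
            (SUP (u, v)\<in>{(u, v). u \<in> {0..1} \<and> v \<in> {0..1} \<and> 0 < \<bar>u - v\<bar> \<and> \<bar>u - v\<bar> \<le> h}.
               incr_ratio \<rho>\<^sub>0 (W n \<omega>) u v) > ereal t} \<in> sets (M n)) \<and>
        ((\<lambda>h. SUP n. measure (M n) {\<omega>\<in>space (M n).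
            (SUP (u, v)\<in>{(u, v). u \<in> {0..1} \<and> v \<in> {0..1} \<and> 0 < \<bar>u - v\<bar> \<and> \<bar>u - v\<bar> \<le> h}.
               incr_ratio \<rho>\<^sub>0 (W n \<omega>) u v) > ereal t}) \<longlongrightarrow> 0) (at_right 0)) \<and>
     (\<forall>\<rho>. modulus_of_continuity \<rho> \<and>
          ((\<lambda>h. ereal (\<rho> h) / ereal (\<rho>\<^sub>0 h)) \<longlongrightarrow> \<infinity>) (at_right 0) \<longrightarrow>
        stochastically_bounded M (\<lambda>n \<omega>. holder_seminorm \<rho> (W n \<omega>))) \<and>
     (\<forall>(N :: 'b measure) (V :: 'b \<Rightarrow> real \<Rightarrow> real).
        C01_process N V \<and> fidi_converges M W N V \<longrightarrow>
        (\<forall>\<rho>. modulus_of_continuity \<rho> \<longrightarrow>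
          (((\<lambda>h. ereal (\<rho> h) / ereal (\<rho>\<^sub>0 h)) \<longlongrightarrow> \<infinity>) (at_right 0) \<longrightarrow>
             weakly_converges (C0_rho_topology \<rho>) M (\<lambda>n \<omega>. restrict (W n \<omega>) {0..1})
               N (\<lambda>\<omega>. restrict (V \<omega>) {0..1})) \<and>
          (((\<lambda>h. ereal (\<rho> h) / ereal (\<rho>\<^sub>0 h)) \<longlongrightarrow> 1) (at_right 0) \<longrightarrow>
             thresholded_weakly_converges C M (\<lambda>n \<omega>. holder_seminorm \<rho> (W n \<omega>))
               N (\<lambda>\<omega>. holder_seminorm \<rho> (V \<omega>)))))"
proof -
  have \<rho>0_nonneg: "0 \<le> \<rho>\<^sub>0 h" if "h \<in> {0..1}" for h
    using rho0(1) that unfolding image_subset_iff by (simp only: atLeast_iff)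
  \<comment> \<open>Levels above \<open>C > 0\<close> are positive, so the extended-real quotients
    in the assumption can be traded for products.\<close>
  have gt: "incr_ratio \<rho>\<^sub>0 f u v > ereal t \<longleftrightarrow> \<bar>f u - f v\<bar> > t * \<rho>\<^sub>0 \<bar>u - v\<bar>"
    if "C < t" "u \<in> {0..1}" "v \<in> {0..1}" for f u v t
  proof (rule incr_ratio_gt_iff[OF _ \<rho>0_nonneg])
    show "0 \<le> t" using that(1) C by linarith
    show "\<bar>u - v\<bar> \<in> {0..1}" using that(2,3) by auto
  qed
  interpret chained_processes M W \<rho>\<^sub>0 C
  proof
    fix t assume t: "C < t"
    show "\<exists>\<kappa>>1. \<exists>K>0. \<forall>n. \<forall>u\<in>{0..1}. \<forall>v\<in>{0..1}. u \<noteq> v \<longrightarrow>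
      measure (M n) {\<omega>\<in>space (M n). \<bar>W n \<omega> u - W n \<omega> v\<bar> > t * \<rho>\<^sub>0 \<bar>u - v\<bar>} \<le> K * \<bar>u - v\<bar> powr \<kappa>"
      using tail[rule_format, OF t] by (simp only: gt[OF t] cong: ball_cong)
  qed (fact W \<rho>0_nonneg rho0 C growth)+
  have iff: "(SUP (u, v)\<in>{(u, v). u \<in> {0..1} \<and> v \<in> {0..1} \<and> 0 < \<bar>u - v\<bar> \<and> \<bar>u - v\<bar> \<le> h}.
      incr_ratio \<rho>\<^sub>0 f u v) > ereal t \<longleftrightarrow> \<not> osc_le \<rho>\<^sub>0 f t h" if "C < t" for f t h
    by (rule less_SUP_incr_ratio_iff[where \<rho>=\<rho>\<^sub>0, OF \<rho>0_nonneg rho0(3) less_imp_le[OF less_trans[OF C that]]])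
  have a1: "{\<omega>\<in>space (M n). \<not> osc_le \<rho>\<^sub>0 (W n \<omega>) t h} \<in> sets (M n)" if "C < t" for n t h
    by (rule sets_not_osc_le[OF W rho0(2,3)]) (use that C in linarith)
  have a2: "((\<lambda>h. SUP n. measure (M n) {\<omega>\<in>space (M n). \<not> osc_le \<rho>\<^sub>0 (W n \<omega>) t h}) \<longlongrightarrow> 0) (at_right 0)"
    if t: "C < t" for t
  proof (rule tendstoI)
    fix e :: real assume e: "0 < e"
    then obtain h where h: "0 < h" "\<And>n. measure (M n) {\<omega>\<in>space (M n). \<not> osc_le \<rho>\<^sub>0 (W n \<omega>) t h} \<le> e / 2"
      using small_osc[OF t, of "e / 2"] by auto
    have "dist (SUP n. measure (M n) {\<omega>\<in>space (M n). \<not> osc_le \<rho>\<^sub>0 (W n \<omega>) t x}) 0 < e" if x: "x < h" for x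
    proof -
      let ?p = "\<lambda>n. measure (M n) {\<omega>\<in>space (M n). \<not> osc_le \<rho>\<^sub>0 (W n \<omega>) t x}"
      have le: "?p n \<le> e / 2" for n
      proof -
        interpret Mn: prob_space "M n" using W by (simp add: C01_process_def)
        have "?p n \<le> measure (M n) {\<omega>\<in>space (M n). \<not> osc_le \<rho>\<^sub>0 (W n \<omega>) t h}"
          using osc_le_anti[OF _ less_imp_le[OF x]] by (intro Mn.finite_measure_mono a1[OF t]) blast
        then show ?thesis using h(2)[of n] by linarith
      qed
      have "(SUP n. ?p n) \<le> e / 2" by (rule cSUP_least) (use le in auto)
      \<comment> \<open>A supremum of reals in \<open>n\<close>: the member with
        \<open>n = 0\<close> shows that it is not negative, and the uniform bound
        \<open>e / 2\<close> that it is a genuine upper bound of its members.\<close>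
      moreover have "?p 0 \<le> (SUP n. ?p n)" by (rule cSUP_upper[OF UNIV_I bdd_aboveI2[OF le]])
      moreover have "0 \<le> ?p 0" by simp
      ultimately show ?thesis using e unfolding dist_real_def by linarith
    qed
    then show "\<forall>\<^sub>F x in at_right 0. dist (SUP n. measure (M n) {\<omega>\<in>space (M n). \<not> osc_le \<rho>\<^sub>0 (W n \<omega>) t x}) 0 < e"
      unfolding eventually_at_right_field using h(1) by blast
  qed
  show ?thesis
  proof (intro conjI allI impI)
    fix t n and h :: real assume t: "C < t"
    show "{\<omega>\<in>space (M n).
            (SUP (u, v)\<in>{(u, v). u \<in> {0..1} \<and> v \<in> {0..1} \<and> 0 < \<bar>u - v\<bar> \<and> \<bar>u - v\<bar> \<le> h}.
               incr_ratio \<rho>\<^sub>0 (W n \<omega>) u v) > ereal t} \<in> sets (M n)"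
      unfolding iff[OF t] by (rule a1[OF t])
  next
    fix t assume t: "C < t"
    show "((\<lambda>h. SUP n. measure (M n) {\<omega>\<in>space (M n).
            (SUP (u, v)\<in>{(u, v). u \<in> {0..1} \<and> v \<in> {0..1} \<and> 0 < \<bar>u - v\<bar> \<and> \<bar>u - v\<bar> \<le> h}.
               incr_ratio \<rho>\<^sub>0 (W n \<omega>) u v) > ereal t}) \<longlongrightarrow> 0) (at_right 0)"
      unfolding iff[OF t] by (rule a2[OF t])
  qed (blast intro: stochastically_bounded_holder_seminorm weakly_converges_C0_rho thresholded_holder_seminorm)+
qed

end
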